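(* Every continuous affine isometric action of ${\rm Isom}(\mathbb Q\mathbb U)$ on a reflexive Banach space or on $L^1([0,1])$ has a fixed point.
   Context: $\mathbb Q\mathbb U$ is the rational Urysohn metric space: the unique (up to isometry) countable metric space with rational distances that contains an isometric copy of every countable metric space with rational distances and in which every isometry between two finite subspaces extends to a surjective isometry of the whole space. ${\rm Isom}(\mathbb Q\mathbb U)$ is its group of surjective isometries, with the permutation group topology, i.e. the group topology in which the pointwise stabilisers of finite subsets form a neighbourhood basis at the identity. A continuous affine isometric action of $G$ on a Banach space $E$ has the form $\alpha(g)\xi=\pi(g)\xi+b(g)$, where $\pi$ is a strongly continuous isometric linear representation of $G$ on $E$ and $b\colon G\to E$ is continuous with $b(gf)=\pi(g)b(f)+b(g)$. *)

theory Defs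
  imports "HOL-Analysis.Analysis" "HOL-Algebra.Bij" "HOL-Algebra.Coset"
begin

definition distance_preserving_on :: "'a set \<Rightarrow> ('a \<Rightarrow> 'a \<Rightarrow> real) \<Rightarrow> ('b \<Rightarrow> 'b \<Rightarrow> real) \<Rightarrow> ('a \<Rightarrow> 'b) \<Rightarrow> bool"
  where "distance_preserving_on A d e f \<longleftrightarrow> (\<forall>x\<in>A. \<forall>y\<in>A. e (f x) (f y) = d x y)"

definition rational_metric_space :: "'a set \<Rightarrow> ('a \<Rightarrow> 'a \<Rightarrow> real) \<Rightarrow> bool"
  where "rational_metric_space M d \<longleftrightarrow> Metric_space M d \<and> (\<forall>x\<in>M. \<forall>y\<in>M. d x y \<in> \<rat>)"

text \<open>
  Isometries as permutations of the carrier; as in \<^const>\<open>Bij\<close>, functions are extensional, so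
  that each isometry of \<open>M\<close> is represented by exactly one HOL function.
\<close>

definition isometries :: "'a set \<Rightarrow> ('a \<Rightarrow> 'a \<Rightarrow> real) \<Rightarrow> ('a \<Rightarrow> 'a) set"
  where "isometries M d = {g \<in> Bij M. distance_preserving_on M d d g}"

text \<open>
  A definition cannot quantify over types, so the countable spaces to be embedded have their
  points in \<^typ>\<open>nat\<close>. Up to isometry these are all countable metric spaces.
\<close>

definition rational_Urysohn :: "'a set \<Rightarrow> ('a \<Rightarrow> 'a \<Rightarrow> real) \<Rightarrow> bool"
  where "rational_Urysohn M d \<longleftrightarrow>
    countable M \<and> rational_metric_space M d \<and>
    (\<forall>(N :: nat set) e. rational_metric_space N e \<longrightarrow>
       (\<exists>f \<in> N \<rightarrow> M. distance_preserving_on N e d f)) \<and>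
    (\<forall>A f. finite A \<and> A \<subseteq> M \<and> f \<in> A \<rightarrow> M \<and> distance_preserving_on A d d f \<longrightarrow>
       (\<exists>g \<in> isometries M d. \<forall>x\<in>A. g x = f x))"

definition isometry_group :: "'a set \<Rightarrow> ('a \<Rightarrow> 'a \<Rightarrow> real) \<Rightarrow> ('a \<Rightarrow> 'a) monoid"
  where "isometry_group M d = (BijGroup M)\<lparr>carrier := isometries M d\<rparr>"

lemma subgroup_isometries: "subgroup (isometries M d) (BijGroup M)"
proof (rule group.subgroupI[OF group_BijGroup])
  show "isometries M d \<subseteq> carrier (BijGroup M)"
    by (auto simp: isometries_def BijGroup_def)
  have "(\<lambda>x\<in>M. x) \<in> isometries M d"
    by (auto simp: isometries_def id_Bij distance_preserving_on_def)
  then show "isometries M d \<noteq> {}" by blast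
next
  fix g assume g: "g \<in> isometries M d"
  then have gB: "g \<in> Bij M" and gd: "\<And>x y. x \<in> M \<Longrightarrow> y \<in> M \<Longrightarrow> d (g x) (g y) = d x y"
    by (auto simp: isometries_def distance_preserving_on_def)
  have im: "g ` M = M" using gB by (auto simp: Bij_def bij_betw_def)
  let ?h = "\<lambda>x\<in>M. inv_into M g x"
  have hB: "?h \<in> Bij M" by (rule restrict_inv_into_Bij[OF gB])
  have "inv\<^bsub>BijGroup M\<^esub> g = ?h"
    by (rule inv_BijGroup[OF gB])
  moreover have "distance_preserving_on M d d ?h"
    unfolding distance_preserving_on_def
  proof (intro ballI)
    fix x y assume "x \<in> M" "y \<in> M"
    then show "d (?h x) (?h y) = d x y"
      using gd[of "inv_into M g x" "inv_into M g y"] im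
      by (simp add: inv_into_into f_inv_into_f)
  qed
  ultimately show "inv\<^bsub>BijGroup M\<^esub> g \<in> isometries M d"
    using hB by (simp add: isometries_def)
next
  fix g h assume g: "g \<in> isometries M d" and h: "h \<in> isometries M d"
  have B: "g \<in> Bij M" "h \<in> Bij M"
    using g h by (simp_all add: isometries_def)
  have "h x \<in> M" if "x \<in> M" for x
    using Bij_imp_funcset[OF B(2)] that by (rule funcset_mem)
  then have "distance_preserving_on M d d (compose M g h)"
    using g h by (simp add: isometries_def distance_preserving_on_def compose_eq)
  then show "g \<otimes>\<^bsub>BijGroup M\<^esub> h \<in> isometries M d"
    using B by (simp add: isometries_def BijGroup_def compose_Bij)
qed

lemma group_isometry_group: "group (isometry_group M d)"
  unfolding isometry_group_def
  by (rule subgroup.subgroup_is_group[OF subgroup_isometries group_BijGroup])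

definition pointwise_stabiliser :: "('a \<Rightarrow> 'a) monoid \<Rightarrow> 'a set \<Rightarrow> ('a \<Rightarrow> 'a) set"
  where "pointwise_stabiliser G A = {g \<in> carrier G. \<forall>x\<in>A. g x = x}"

text \<open>
  For a group \<open>G\<close> of permutations of \<open>M\<close>: the topology in which the cosets \<open>g H\<close>, with \<open>H\<close> the
  pointwise stabiliser of a finite subset of \<open>M\<close>, form a neighbourhood basis at \<open>g\<close>.
\<close>

definition permutation_group_topology :: "('a \<Rightarrow> 'a) monoid \<Rightarrow> 'a set \<Rightarrow> ('a \<Rightarrow> 'a) topology"
  where "permutation_group_topology G M = topology (\<lambda>U. U \<subseteq> carrier G \<and>
    (\<forall>g\<in>U. \<exists>A. finite A \<and> A \<subseteq> M \<and> g <#\<^bsub>G\<^esub> pointwise_stabiliser G A \<subseteq> U))"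

lemma openin_permutation_group_topology:
  "openin (permutation_group_topology G M) U \<longleftrightarrow> U \<subseteq> carrier G \<and>
    (\<forall>g\<in>U. \<exists>A. finite A \<and> A \<subseteq> M \<and> g <#\<^bsub>G\<^esub> pointwise_stabiliser G A \<subseteq> U)"
proof -
  let ?P = "\<lambda>U g. \<exists>A. finite A \<and> A \<subseteq> M \<and> g <#\<^bsub>G\<^esub> pointwise_stabiliser G A \<subseteq> U"
  let ?L = "\<lambda>U. U \<subseteq> carrier G \<and> (\<forall>g\<in>U. ?P U g)"
  have anti: "g <#\<^bsub>G\<^esub> pointwise_stabiliser G (A \<union> B) \<subseteq> g <#\<^bsub>G\<^esub> pointwise_stabiliser G A"
    "g <#\<^bsub>G\<^esub> pointwise_stabiliser G (A \<union> B) \<subseteq> g <#\<^bsub>G\<^esub> pointwise_stabiliser G B" for g A B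
    by (auto simp: l_coset_def pointwise_stabiliser_def)
  have "istopology ?L"
    unfolding istopology_def
  proof (intro conjI allI impI)
    fix S T assume S: "?L S" and T: "?L T"
    show "S \<inter> T \<subseteq> carrier G" using S by blast
    show "\<forall>g \<in> S \<inter> T. ?P (S \<inter> T) g"
    proof
      fix g assume "g \<in> S \<inter> T"
      then obtain A B where "finite A" "A \<subseteq> M" "g <#\<^bsub>G\<^esub> pointwise_stabiliser G A \<subseteq> S"
        "finite B" "B \<subseteq> M" "g <#\<^bsub>G\<^esub> pointwise_stabiliser G B \<subseteq> T"
        using S T by (meson IntD1 IntD2)
      then show "?P (S \<inter> T) g"
        using anti[of g A B] by (intro exI[of _ "A \<union> B"]) auto
    qed
  next
    fix K assume K: "\<forall>S\<in>K. ?L S"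
    show "\<Union>K \<subseteq> carrier G" using K by blast
    show "\<forall>g \<in> \<Union>K. ?P (\<Union>K) g"
    proof
      fix g assume "g \<in> \<Union>K"
      then obtain S where S: "S \<in> K" "g \<in> S" by blast
      then obtain A where "finite A" "A \<subseteq> M" "g <#\<^bsub>G\<^esub> pointwise_stabiliser G A \<subseteq> S"
        using K by meson
      then show "?P (\<Union>K) g" using S(1) by (intro exI[of _ A]) auto
    qed
  qed
  then show ?thesis
    unfolding permutation_group_topology_def by (subst topology_inverse') auto
qed

lemma topspace_permutation_group_topology:
  "group G \<Longrightarrow> topspace (permutation_group_topology G M) = carrier G"
proof -
  assume "group G"
  then interpret group G .
  have "g <#\<^bsub>G\<^esub> pointwise_stabiliser G {} \<subseteq> carrier G" if "g \<in> carrier G" for g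
    using that by (auto simp: l_coset_def pointwise_stabiliser_def)
  then have "openin (permutation_group_topology G M) (carrier G)"
    unfolding openin_permutation_group_topology by blast
  moreover have "topspace (permutation_group_topology G M) \<subseteq> carrier G"
    using openin_topspace openin_permutation_group_topology by metis
  ultimately show ?thesis
    using openin_subset by fastforce
qed

definition isometric_linear_representation ::
  "('g, 'm) monoid_scheme \<Rightarrow> ('g \<Rightarrow> 'e \<Rightarrow> 'e::real_normed_vector) \<Rightarrow> bool"
  where "isometric_linear_representation G \<pi> \<longleftrightarrow>
    (\<forall>g\<in>carrier G. linear (\<pi> g) \<and> (\<forall>\<xi>. norm (\<pi> g \<xi>) = norm \<xi>)) \<and>
    (\<forall>\<xi>. \<pi> \<one>\<^bsub>G\<^esub> \<xi> = \<xi>) \<and>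
    (\<forall>g\<in>carrier G. \<forall>f\<in>carrier G. \<forall>\<xi>. \<pi> (g \<otimes>\<^bsub>G\<^esub> f) \<xi> = \<pi> g (\<pi> f \<xi>))"

definition strongly_continuous ::
  "'g topology \<Rightarrow> ('g \<Rightarrow> 'e \<Rightarrow> 'e::real_normed_vector) \<Rightarrow> bool"
  where "strongly_continuous T \<pi> \<longleftrightarrow> (\<forall>\<xi>. continuous_map T euclidean (\<lambda>g. \<pi> g \<xi>))"

definition cocycle ::
  "('g, 'm) monoid_scheme \<Rightarrow> ('g \<Rightarrow> 'e \<Rightarrow> 'e::real_normed_vector) \<Rightarrow> ('g \<Rightarrow> 'e) \<Rightarrow> bool"
  where "cocycle G \<pi> b \<longleftrightarrow>
    (\<forall>g\<in>carrier G. \<forall>f\<in>carrier G. b (g \<otimes>\<^bsub>G\<^esub> f) = \<pi> g (b f) + b g)"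

definition continuous_affine_isometric_action ::
  "('g, 'm) monoid_scheme \<Rightarrow> 'g topology \<Rightarrow> ('g \<Rightarrow> 'e \<Rightarrow> 'e::real_normed_vector) \<Rightarrow> bool"
  where "continuous_affine_isometric_action G T \<alpha> \<longleftrightarrow>
    (\<exists>\<pi> b. isometric_linear_representation G \<pi> \<and> strongly_continuous T \<pi> \<and>
       cocycle G \<pi> b \<and> continuous_map T euclidean b \<and>
       (\<forall>g\<in>carrier G. \<forall>\<xi>. \<alpha> g \<xi> = \<pi> g \<xi> + b g))"

definition has_fixed_point :: "('g, 'm) monoid_scheme \<Rightarrow> ('g \<Rightarrow> 'e \<Rightarrow> 'e) \<Rightarrow> bool"
  where "has_fixed_point G \<alpha> \<longleftrightarrow> (\<exists>\<xi>. \<forall>g\<in>carrier G. \<alpha> g \<xi> = \<xi>)"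

lift_definition bidual_embedding :: "'e::real_normed_vector \<Rightarrow> ('e \<Rightarrow>\<^sub>L real) \<Rightarrow>\<^sub>L real"
  is "\<lambda>x \<phi>. blinfun_apply \<phi> x"
  by (rule blinfun.bounded_linear_left)

definition reflexive_space :: "'e::real_normed_vector itself \<Rightarrow> bool"
  where "reflexive_space _ \<longleftrightarrow> surj (bidual_embedding :: 'e \<Rightarrow> _)"

abbreviation lebesgue01 :: "real measure"
  where "lebesgue01 \<equiv> lebesgue_on {0..1}"

definition L1_rel :: "(real \<Rightarrow> real) \<Rightarrow> (real \<Rightarrow> real) \<Rightarrow> bool"
  where "L1_rel f g \<longleftrightarrow>
    integrable lebesgue01 f \<and> integrable lebesgue01 g \<and> (AE x in lebesgue01. f x = g x)"

lemma part_equivp_L1_rel: "part_equivp L1_rel"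
proof (rule part_equivpI)
  show "\<exists>f. L1_rel f f" by (intro exI[of _ "\<lambda>_. 0"]) (simp add: L1_rel_def)
  show "symp L1_rel" by (auto simp: symp_def L1_rel_def elim: AE_mp)
  show "transp L1_rel"
    unfolding transp_def L1_rel_def by (auto elim: AE_mp)
qed

quotient_type L1_unit_interval = "real \<Rightarrow> real" / partial: L1_rel
  by (rule part_equivp_L1_rel)

instantiation L1_unit_interval :: real_normed_vector
begin

lift_definition zero_L1_unit_interval :: L1_unit_interval is "\<lambda>_. 0"
  by (simp add: L1_rel_def)

lift_definition plus_L1_unit_interval ::
  "L1_unit_interval \<Rightarrow> L1_unit_interval \<Rightarrow> L1_unit_interval" is "\<lambda>f g x. f x + g x"
  unfolding L1_rel_def by (auto elim: AE_mp)

lift_definition minus_L1_unit_interval ::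
  "L1_unit_interval \<Rightarrow> L1_unit_interval \<Rightarrow> L1_unit_interval" is "\<lambda>f g x. f x - g x"
  unfolding L1_rel_def by (auto elim: AE_mp)

lift_definition uminus_L1_unit_interval :: "L1_unit_interval \<Rightarrow> L1_unit_interval"
  is "\<lambda>f x. - f x"
  unfolding L1_rel_def by (auto elim: AE_mp)

lift_definition scaleR_L1_unit_interval :: "real \<Rightarrow> L1_unit_interval \<Rightarrow> L1_unit_interval"
  is "\<lambda>c f x. c * f x"
  unfolding L1_rel_def by (auto elim: AE_mp)

lift_definition norm_L1_unit_interval :: "L1_unit_interval \<Rightarrow> real"
  is "\<lambda>f. \<integral>x. \<bar>f x\<bar> \<partial>lebesgue01"
  unfolding L1_rel_def by (intro integral_cong_AE) (auto elim: AE_mp)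

definition dist_L1_unit_interval :: "L1_unit_interval \<Rightarrow> L1_unit_interval \<Rightarrow> real"
  where "dist_L1_unit_interval u v = norm (u - v)"

definition sgn_L1_unit_interval :: "L1_unit_interval \<Rightarrow> L1_unit_interval"
  where "sgn_L1_unit_interval u = inverse (norm u) *\<^sub>R u"

definition uniformity_L1_unit_interval :: "(L1_unit_interval \<times> L1_unit_interval) filter"
  where
    "uniformity_L1_unit_interval = (INF e\<in>{0 <..}. principal {(u, v). dist u v < e})"

definition open_L1_unit_interval :: "L1_unit_interval set \<Rightarrow> bool"
  where "open_L1_unit_interval S =
    (\<forall>u\<in>S. \<forall>\<^sub>F (u', v) in uniformity. u' = u \<longrightarrow> v \<in> S)"

instance
proof
  fix u v w :: L1_unit_interval and a b :: real and U :: "L1_unit_interval set"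
  show "u + v + w = u + (v + w)" by transfer (auto simp: L1_rel_def algebra_simps)
  show "u + v = v + u" by transfer (auto simp: L1_rel_def algebra_simps)
  show "0 + u = u" by transfer (auto simp: L1_rel_def)
  show "- u + u = 0" by transfer (auto simp: L1_rel_def)
  show "u - v = u + - v" by transfer (auto simp: L1_rel_def)
  show "a *\<^sub>R (u + v) = a *\<^sub>R u + a *\<^sub>R v" by transfer (auto simp: L1_rel_def algebra_simps)
  show "(a + b) *\<^sub>R u = a *\<^sub>R u + b *\<^sub>R u" by transfer (auto simp: L1_rel_def algebra_simps)
  show "a *\<^sub>R b *\<^sub>R u = (a * b) *\<^sub>R u" by transfer (auto simp: L1_rel_def algebra_simps)
  show "1 *\<^sub>R u = u" by transfer (auto simp: L1_rel_def)
  show "dist u v = norm (u - v)" by (rule dist_L1_unit_interval_def)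
  show "sgn u = inverse (norm u) *\<^sub>R u" by (rule sgn_L1_unit_interval_def)
  show "(uniformity :: (L1_unit_interval \<times> L1_unit_interval) filter) =
      (INF e\<in>{0 <..}. principal {(u, v). dist u v < e})"
    by (rule uniformity_L1_unit_interval_def)
  show "open U = (\<forall>u\<in>U. \<forall>\<^sub>F (u', v) in uniformity. u' = u \<longrightarrow> v \<in> U)"
    by (rule open_L1_unit_interval_def)
  show "(norm u = 0) = (u = 0)"
  proof transfer
    fix f assume "L1_rel f f"
    then have f: "integrable lebesgue01 f" by (simp add: L1_rel_def)
    have "(\<integral>x. \<bar>f x\<bar> \<partial>lebesgue01) = 0 \<longleftrightarrow> (AE x in lebesgue01. \<bar>f x\<bar> = 0)"
      using f by (intro integral_nonneg_eq_0_iff_AE) auto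
    then show "((\<integral>x. \<bar>f x\<bar> \<partial>lebesgue01) = 0) = L1_rel f (\<lambda>_. 0)"
      using f by (simp add: L1_rel_def)
  qed
  show "norm (u + v) \<le> norm u + norm v"
  proof transfer
    fix f g assume "L1_rel f f" "L1_rel g g"
    then have f: "integrable lebesgue01 f" "integrable lebesgue01 g" by (auto simp: L1_rel_def)
    have "(\<integral>x. \<bar>f x + g x\<bar> \<partial>lebesgue01) \<le> (\<integral>x. \<bar>f x\<bar> + \<bar>g x\<bar> \<partial>lebesgue01)"
      using f by (intro integral_mono) auto
    also have "\<dots> = (\<integral>x. \<bar>f x\<bar> \<partial>lebesgue01) + (\<integral>x. \<bar>g x\<bar> \<partial>lebesgue01)"
      using f by (intro Bochner_Integration.integral_add) auto
    finally show "(\<integral>x. \<bar>f x + g x\<bar> \<partial>lebesgue01)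
      \<le> (\<integral>x. \<bar>f x\<bar> \<partial>lebesgue01) + (\<integral>x. \<bar>g x\<bar> \<partial>lebesgue01)" .
  qed
  show "norm (a *\<^sub>R u) = \<bar>a\<bar> * norm u"
    by transfer (simp add: abs_mult)
qed

end

lemma integrable_L1_rel: "integrable lebesgue01 f \<Longrightarrow> L1_rel f f"
  by (simp add: L1_rel_def)

lemma L1_unit_interval_cases:
  obtains f where "integrable lebesgue01 f" "u = abs_L1_unit_interval f"
proof -
  have "L1_rel (rep_L1_unit_interval u) (rep_L1_unit_interval u)"
    by (rule Quotient3_rep_reflp[OF Quotient3_L1_unit_interval])
  moreover have "u = abs_L1_unit_interval (rep_L1_unit_interval u)"
    by (simp add: Quotient3_abs_rep[OF Quotient3_L1_unit_interval])
  ultimately show thesis using that unfolding L1_rel_def by blast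
qed

instance L1_unit_interval :: banach
proof
  fix X :: "nat \<Rightarrow> L1_unit_interval"
  assume X: "Cauchy X"
  let ?Q = "\<lambda>n k. \<forall>m\<ge>k. norm (X m - X k) < (1/2) ^ n"
  have ex: "\<exists>k>l. ?Q n k" for n l
  proof -
    from CauchyD[OF X, of "(1/2) ^ n"] obtain K
      where "\<And>m k. m \<ge> K \<Longrightarrow> k \<ge> K \<Longrightarrow> norm (X m - X k) < (1/2) ^ n" by auto
    then show ?thesis by (intro exI[of _ "max (Suc l) K"]) auto
  qed
  have "\<exists>r. \<forall>n. ?Q n (r n) \<and> r n < r (Suc n)"
    by (rule dependent_nat_choice) (use ex in blast)+
  then obtain r where r: "\<And>n. ?Q n (r n)" and mono: "strict_mono r"
    by (auto simp: strict_mono_Suc_iff)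
  have "\<exists>f. \<forall>n. integrable lebesgue01 (f n) \<and> X (r n) = abs_L1_unit_interval (f n)"
    by (intro choice) (metis L1_unit_interval_cases)
  then obtain f where f: "\<And>n. integrable lebesgue01 (f n)"
    and Xf: "\<And>n. X (r n) = abs_L1_unit_interval (f n)" by blast
  define h where "h n x = f (Suc n) x - f n x" for n x
  have h: "integrable lebesgue01 (h n)" for n
    unfolding h_def using f by auto
  have norm_diff: "norm (X (r n) - abs_L1_unit_interval g) = (\<integral>x. \<bar>f n x - g x\<bar> \<partial>lebesgue01)"
    if "integrable lebesgue01 g" for n g
    unfolding Xf using that f[of n]
    by (simp add: minus_L1_unit_interval.abs_eq norm_L1_unit_interval.abs_eq integrable_L1_rel)
  have h_bound: "(\<integral>x. \<bar>h n x\<bar> \<partial>lebesgue01) \<le> (1/2) ^ n" for n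
  proof -
    have "norm (X (r (Suc n)) - X (r n)) < (1/2) ^ n"
      using r[of n] strict_monoD[OF mono, of n "Suc n"] by auto
    then show ?thesis using norm_diff[OF f[of n], of "Suc n"] by (simp add: Xf h_def)
  qed
  have sum_int: "summable (\<lambda>n. \<integral>x. \<bar>h n x\<bar> \<partial>lebesgue01)"
    by (rule summable_comparison_test'[of "\<lambda>n. (1/2) ^ n" 0])
       (use h_bound in \<open>auto simp: summable_geometric\<close>)
  have AE_sum: "AE x in lebesgue01. summable (\<lambda>n. \<bar>h n x\<bar>)"
  proof -
    have [measurable]: "h n \<in> borel_measurable lebesgue01" for n
      using h by (rule borel_measurable_integrable)
    have "(\<integral>\<^sup>+x. (\<Sum>n. ennreal \<bar>h n x\<bar>) \<partial>lebesgue01) = (\<Sum>n. \<integral>\<^sup>+x. ennreal \<bar>h n x\<bar> \<partial>lebesgue01)"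
      by (rule nn_integral_suminf) measurable
    also have "\<dots> = (\<Sum>n. ennreal (\<integral>x. \<bar>h n x\<bar> \<partial>lebesgue01))"
      using h by (intro arg_cong[where f=suminf] ext nn_integral_eq_integral) auto
    also have "\<dots> \<noteq> \<infinity>"
      unfolding infinity_ennreal_def by (rule ennreal_suminf_neq_top[OF sum_int]) simp
    finally have "AE x in lebesgue01. (\<Sum>n. ennreal \<bar>h n x\<bar>) \<noteq> \<infinity>"
      by (intro nn_integral_noteq_infinite) measurable
    then show ?thesis
      by eventually_elim (auto intro!: summable_suminf_not_top)
  qed
  define w where "w x = (\<Sum>n. \<bar>h n x\<bar>)" for x
  define S where "S x = (\<Sum>n. h n x)" for x
  have w: "integrable lebesgue01 w"
    unfolding w_def using h AE_sum sum_int by (intro integrable_suminf) auto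
  have S: "integrable lebesgue01 S"
    unfolding S_def using h AE_sum sum_int by (intro integrable_suminf) auto
  define g where "g x = f 0 x + S x" for x
  have g: "integrable lebesgue01 g"
    unfolding g_def using S f by auto
  have f_eq: "f n x = f 0 x + (\<Sum>k<n. h k x)" for n x
    by (induction n) (auto simp: h_def)
  have [measurable]: "f n \<in> borel_measurable lebesgue01" "g \<in> borel_measurable lebesgue01" for n
    using f g by (auto intro: borel_measurable_integrable)
  have lim: "AE x in lebesgue01. (\<lambda>n. \<bar>f n x - g x\<bar>) \<longlonglongrightarrow> 0"
    using AE_sum
  proof eventually_elim
    case (elim x)
    then have "(\<lambda>n. \<Sum>k<n. h k x) \<longlonglongrightarrow> S x"
      unfolding S_def by (rule summable_LIMSEQ[OF summable_rabs_cancel])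
    then have "(\<lambda>n. (\<Sum>k<n. h k x) - S x) \<longlonglongrightarrow> 0"
      by (rule LIM_zero)
    moreover have "f n x - g x = (\<Sum>k<n. h k x) - S x" for n
      unfolding g_def by (subst f_eq) simp
    ultimately show ?case
      by (simp add: tendsto_rabs_zero)
  qed
  have dom: "AE x in lebesgue01. norm \<bar>f n x - g x\<bar> \<le> 2 * w x" for n
    using AE_sum
  proof eventually_elim
    case (elim x)
    have "\<bar>S x\<bar> \<le> w x"
      unfolding S_def w_def by (rule summable_rabs[OF elim])
    moreover have "\<bar>\<Sum>k<n. h k x\<bar> \<le> (\<Sum>k<n. \<bar>h k x\<bar>)" by (rule sum_abs)
    moreover have "(\<Sum>k<n. \<bar>h k x\<bar>) \<le> w x"
      unfolding w_def by (rule sum_le_suminf[OF elim]) auto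
    moreover have "f n x - g x = (\<Sum>k<n. h k x) - S x"
      unfolding g_def by (subst f_eq) simp
    ultimately show ?case unfolding real_norm_def abs_idempotent by linarith
  qed
  have "(\<lambda>n. \<integral>x. \<bar>f n x - g x\<bar> \<partial>lebesgue01) \<longlonglongrightarrow> (\<integral>x. 0 \<partial>lebesgue01)"
  proof (rule integral_dominated_convergence[OF _ _ _ lim dom])
    show "integrable lebesgue01 (\<lambda>x. 2 * w x)" using w by simp
  qed measurable
  then have "(\<lambda>n. norm (X (r n) - abs_L1_unit_interval g)) \<longlonglongrightarrow> 0"
    by (simp add: norm_diff[OF g])
  then have "(X \<circ> r) \<longlonglongrightarrow> abs_L1_unit_interval g"
    by (simp add: tendsto_norm_zero_iff LIM_zero_iff o_def)
  then have "X \<longlonglongrightarrow> abs_L1_unit_interval g"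
    using Cauchy_converges_subseq[OF X mono] by blast
  then show "convergent X" by (rule convergentI)
qed

end

theory Submission
  imports Defs
begin

text \<open>
  Let \<open>A\<close> be a finite set whose pointwise stabiliser moves \<open>0\<close> by at most \<open>1\<close>. Up to this error, the
  distance between \<open>g 0\<close> and \<open>h 0\<close> depends only on the mutual distances of \<open>g A\<close> and \<open>h A\<close>. Copies
  of \<open>A\<close> indexed by \<open>k\<close>-tuples of natural numbers can be placed in the Urysohn space so that
  interlaced tuples (\<open>p\<^sub>1 < q\<^sub>1 < p\<^sub>2 < q\<^sub>2 < \<dots>\<close>) have copies at distance \<open>D\<close>, and completely separated tuples copies at distance
  \<open>k D\<close>. By Kalton's argument, iterated weak limits along an ultrafilter show that a map on tuples
  into a reflexive or a Hilbert space that moves interlaced tuples by at most \<open>C\<close> moves some separated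
  pair by little more than \<open>2 C\<close>, whatever \<open>k\<close> is; \<open>L\<^sup>1\<close> reduces to Hilbert space because its distance
  is the square of a Hilbert space distance. Hence orbits are bounded.

  Now let \<open>\<xi>\<^sub>n\<close> be the point of the orbit that belongs to a copy of \<open>A\<^sub>n\<close> at constant distance from the
  first \<open>n\<close> points of the Urysohn space, where the stabiliser of \<open>A\<^sub>n\<close> moves \<open>0\<close> by at most
  \<open>1 / (n + 1)\<close>. Every \<open>g\<close> agrees on a given finite set with isometries that almost fix
  \<open>\<xi>\<^sub>n, \<dots>, \<xi>\<^sub>m\<close> for large \<open>n \<le> m\<close>, so the asymptotic distances to convex combinations \<open>\<zeta>\<^sub>n\<close> of
  \<open>\<xi>\<^sub>n, \<xi>\<^sub>n\<^sub>+\<^sub>1, \<dots>\<close> are invariant under the action. If the \<open>\<zeta>\<^sub>n\<close> converge to \<open>x\<close> in norm (reflexive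
  spaces) or almost everywhere (\<open>L\<^sup>1\<close>), the point \<open>x\<close> is determined by these asymptotic distances
  and therefore fixed.
\<close>

section \<open>Ultrafilters\<close>

definition ultra :: "'a filter \<Rightarrow> bool"
  where "ultra F \<longleftrightarrow> F \<noteq> bot \<and> (\<forall>P. eventually P F \<or> eventually (\<lambda>x. \<not> P x) F)"

lemma ultra_neq_bot: "ultra F \<Longrightarrow> F \<noteq> bot"
  by (simp add: ultra_def)

text \<open>Zorn's lemma gives a minimal proper filter below \<open>F\<close>. Meeting it with
  \<open>principal {x. P x}\<close> either destroys properness, and then the negation of
  \<open>P\<close> holds eventually, or changes nothing by minimality, and then \<open>P\<close>
  does.\<close>

lemma ultra_exists:
  assumes "F \<noteq> bot"
  obtains U where "U \<le> F" "ultra U"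
proof -
  let ?A = "{G. G \<noteq> bot \<and> G \<le> F}" and ?P = "\<lambda>G H :: 'a filter. H \<le> G"
  have "\<exists>U\<in>?A. \<forall>G\<in>?A. ?P U G \<longrightarrow> G = U"
  proof (rule predicate_Zorn)
    show "partial_order_on ?A (relation_of ?P ?A)"
      by (rule partial_order_on_relation_ofI) auto
    fix C assume C: "C \<in> Chains (relation_of ?P ?A)"
    show "\<exists>u\<in>?A. \<forall>a\<in>C. ?P a u"
    proof (cases "C = {}")
      case True
      then show ?thesis using assms by auto
    next
      case False
      have CA: "C \<subseteq> ?A" and lin: "\<And>G H. G \<in> C \<Longrightarrow> H \<in> C \<Longrightarrow> G \<le> H \<or> H \<le> G"
        using C unfolding Chains_def relation_of_def by auto
      have "eventually P (Inf C) \<longleftrightarrow> (\<exists>G\<in>C. eventually P G)" for P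
        by (rule eventually_Inf_base[OF False]) (use lin in \<open>metis inf.absorb1 inf.absorb2 order_refl\<close>)
      then have "Inf C \<noteq> bot"
        using CA unfolding trivial_limit_def by auto
      moreover obtain G where "G \<in> C" "G \<le> F" using False CA by auto
      then have "Inf C \<le> F" by (meson Inf_lower order_trans)
      ultimately show ?thesis by (auto intro: Inf_lower)
    qed
  qed
  then obtain U where U: "U \<noteq> bot" "U \<le> F"
    and min: "\<And>G. G \<noteq> bot \<Longrightarrow> G \<le> F \<Longrightarrow> G \<le> U \<Longrightarrow> G = U" by auto
  have "eventually P U \<or> eventually (\<lambda>x. \<not> P x) U" for P
  proof (cases "inf U (principal {x. P x}) = bot")
    case True
    then have "eventually (\<lambda>x. P x \<longrightarrow> False) U"
      unfolding trivial_limit_def eventually_inf_principal by simp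
    then show ?thesis by simp
  next
    case False
    have "inf U (principal {x. P x}) = U"
      by (rule min) (use U False in \<open>auto intro: le_infI1\<close>)
    then have "eventually P U"
      using eventually_inf_principal[of P U "{x. P x}"] by simp
    then show ?thesis ..
  qed
  then show thesis using that U unfolding ultra_def by blast
qed

lemma free_ultrafilter_nat:
  obtains U :: "nat filter" where "U \<le> sequentially" "ultra U"
  using ultra_exists[of "sequentially"] sequentially_bot by blast

text \<open>Compactness yields a cluster point. It is a limit, because an ultrafilter that does not
  eventually lie in a neighbourhood eventually avoids it.\<close>

lemma ultra_tendsto_compact:
  fixes f :: "'a \<Rightarrow> 'b::topological_space"
  assumes "ultra F" "compact S" "eventually (\<lambda>x. f x \<in> S) F"
  obtains l where "l \<in> S" "(f \<longlongrightarrow> l) F"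
proof -
  have "filtermap f F \<noteq> bot"
    using assms(1) by (simp add: ultra_def filtermap_bot_iff)
  moreover have "eventually (\<lambda>y. y \<in> S) (filtermap f F)"
    using assms(3) by (simp add: eventually_filtermap)
  ultimately obtain l where l: "l \<in> S" "inf (nhds l) (filtermap f F) \<noteq> bot"
    using assms(2) unfolding compact_filter by blast
  have "(f \<longlongrightarrow> l) F"
  proof (rule topological_tendstoI, rule ccontr)
    fix V assume V: "open V" "l \<in> V" and n: "\<not> eventually (\<lambda>x. f x \<in> V) F"
    then have "eventually (\<lambda>x. f x \<notin> V) F"
      using assms(1) by (auto simp: ultra_def)
    then have "eventually (\<lambda>y. y \<notin> V) (filtermap f F)"
      by (simp add: eventually_filtermap)
    moreover have "eventually (\<lambda>y. y \<in> V) (nhds l)"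
      using V by (rule eventually_nhds_in_open)
    ultimately have "eventually (\<lambda>y. False) (inf (nhds l) (filtermap f F))"
      unfolding eventually_inf by (intro exI[of _ "\<lambda>y. y \<in> V"] exI[of _ "\<lambda>y. y \<notin> V"]) simp
    then show False using l(2) by (simp add: trivial_limit_def)
  qed
  then show thesis using l that by blast
qed

lemma ultra_tendsto_bounded:
  fixes f :: "'a \<Rightarrow> real"
  assumes "ultra F" "\<And>x. \<bar>f x\<bar> \<le> C"
  shows "\<exists>l. \<bar>l\<bar> \<le> C \<and> (f \<longlongrightarrow> l) F"
proof -
  have "eventually (\<lambda>x. f x \<in> {-C..C}) F"
    using assms(2) by (intro always_eventually) (auto simp: abs_le_iff minus_le_iff)
  then obtain l where "l \<in> {-C..C}" "(f \<longlongrightarrow> l) F"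
    by (rule ultra_tendsto_compact[OF assms(1) compact_Icc])
  then show ?thesis by (intro exI[of _ l]) auto
qed

lemma ultra_filtermap: "ultra F \<Longrightarrow> ultra (filtermap f F)"
  by (auto simp: ultra_def filtermap_bot_iff eventually_filtermap)

lemma ultra_principal: "ultra (principal {x})"
  by (auto simp: ultra_def eventually_principal principal_eq_bot_iff)

text \<open>The Fubini sum of filters. Limits along it are iterated limits: the inner one along
  \<open>G x\<close>, then the outer one in \<open>x\<close> along \<open>F\<close>.\<close>

definition filter_bind :: "'a filter \<Rightarrow> ('a \<Rightarrow> 'b filter) \<Rightarrow> 'b filter"
  where "filter_bind F G = Abs_filter (\<lambda>P. eventually (\<lambda>x. eventually P (G x)) F)"

lemma eventually_filter_bind:
  "eventually P (filter_bind F G) \<longleftrightarrow> eventually (\<lambda>x. eventually P (G x)) F"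
  unfolding filter_bind_def
  by (rule eventually_Abs_filter, rule is_filter.intro)
     (auto elim!: eventually_mono simp: eventually_conj_iff intro: always_eventually)

lemma ultra_filter_bind:
  assumes "ultra F" "\<And>x. ultra (G x)"
  shows "ultra (filter_bind F G)"
proof -
  have "eventually P (filter_bind F G) \<or> eventually (\<lambda>x. \<not> P x) (filter_bind F G)" for P
  proof (cases "eventually (\<lambda>x. eventually P (G x)) F")
    case False
    then have "eventually (\<lambda>x. \<not> eventually P (G x)) F"
      using assms(1) by (auto simp: ultra_def)
    then have "eventually (\<lambda>x. eventually (\<lambda>y. \<not> P y) (G x)) F"
      by eventually_elim (use assms(2) in \<open>auto simp: ultra_def\<close>)
    then show ?thesis by (simp add: eventually_filter_bind)
  qed (simp add: eventually_filter_bind)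
  moreover have "\<not> eventually (\<lambda>y. False) (G x)" for x
    using assms(2)[of x] by (simp add: ultra_def trivial_limit_def)
  then have "filter_bind F G \<noteq> bot"
    using assms(1) by (simp add: trivial_limit_def eventually_filter_bind ultra_def)
  ultimately show ?thesis by (simp add: ultra_def)
qed

lemma tendsto_filter_bind:
  fixes h :: "'b \<Rightarrow> 'c::metric_space"
  assumes "\<And>x. (h \<longlongrightarrow> l x) (G x)" "(l \<longlongrightarrow> L) F"
  shows "(h \<longlongrightarrow> L) (filter_bind F G)"
proof (rule tendstoI)
  fix e :: real assume "e > 0"
  then have "eventually (\<lambda>x. dist (l x) L < e / 2) F"
    using assms(2) by (intro tendstoD) auto
  then show "eventually (\<lambda>y. dist (h y) L < e) (filter_bind F G)"
    unfolding eventually_filter_bind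
  proof eventually_elim
    case (elim x)
    have "eventually (\<lambda>y. dist (h y) (l x) < e / 2) (G x)"
      using assms(1) \<open>e > 0\<close> by (intro tendstoD) auto
    then show ?case
      by eventually_elim (use elim in \<open>metis dist_triangle_half_r dist_commute\<close>)
  qed
qed

section \<open>The Hahn-Banach theorem\<close>

definition sublinear :: "('e::real_vector \<Rightarrow> real) \<Rightarrow> bool"
  where "sublinear p \<longleftrightarrow> (\<forall>x y. p (x + y) \<le> p x + p y) \<and> (\<forall>c x. c > 0 \<longrightarrow> p (c *\<^sub>R x) = c * p x)"

lemma sublinear_add: "sublinear p \<Longrightarrow> p (x + y) \<le> p x + p y"
  by (simp add: sublinear_def)

lemma sublinear_scale: "sublinear p \<Longrightarrow> c > 0 \<Longrightarrow> p (c *\<^sub>R x) = c * p x"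
  by (simp add: sublinear_def)

lemma sublinear_0:
  assumes "sublinear p" shows "p 0 = 0"
  using sublinear_scale[OF assms, of 2 0] by simp

lemma sublinear_minus_le:
  assumes "sublinear p" shows "- p (- x) \<le> p x"
  using sublinear_add[OF assms, of x "- x"] sublinear_0[OF assms] by simp

lemma sublinear_scale_nonneg: "sublinear p \<Longrightarrow> c \<ge> 0 \<Longrightarrow> p (c *\<^sub>R x) = c * p x"
  by (cases "c = 0") (auto simp: sublinear_0 sublinear_scale)

text \<open>The members \<open>q i\<close> need not be sublinear one by one; the inequalities only
  have to hold across the family. This serves infima over chains, over the scalars \<open>t\<close>
  in \<open>Hahn_Banach_sublinear\<close> and over the pairs \<open>(t, k)\<close> in
  \<open>blinfun_separating_convex\<close>.\<close>

lemma sublinear_cINF: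
  assumes ne: "A \<noteq> {}"
    and bdd: "\<And>x. bdd_below ((\<lambda>i. q i x) ` A)"
    and add: "\<And>i j x y. i \<in> A \<Longrightarrow> j \<in> A \<Longrightarrow> \<exists>k\<in>A. q k (x + y) \<le> q i x + q j y"
    and scale: "\<And>i c x. i \<in> A \<Longrightarrow> c > 0 \<Longrightarrow> \<exists>k\<in>A. q k (c *\<^sub>R x) \<le> c * q i x"
  shows "sublinear (\<lambda>x. INF i\<in>A. q i x)"
  unfolding sublinear_def
proof (intro conjI allI impI)
  let ?r = "\<lambda>x. INF i\<in>A. q i x"
  have lower: "?r x \<le> q i x" if "i \<in> A" for i x
    using bdd that by (rule cINF_lower)
  fix x y
  have "?r (x + y) - q i x \<le> q j y" if ij: "i \<in> A" "j \<in> A" for i j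
    using add[OF ij, of x y] lower[of _ "x + y"] by fastforce
  then have "?r (x + y) - q i x \<le> ?r y" if "i \<in> A" for i
    using that ne by (intro cINF_greatest) auto
  then have "?r (x + y) - ?r y \<le> ?r x"
    using ne by (intro cINF_greatest) (auto simp: algebra_simps)
  then show "?r (x + y) \<le> ?r x + ?r y" by simp
next
  let ?r = "\<lambda>x. INF i\<in>A. q i x"
  have le: "?r (c *\<^sub>R x) \<le> c * ?r x" if c: "c > 0" for c x
  proof -
    have "?r (c *\<^sub>R x) / c \<le> ?r x"
    proof (rule cINF_greatest[OF ne])
      fix i assume i: "i \<in> A"
      obtain k where k: "k \<in> A" "q k (c *\<^sub>R x) \<le> c * q i x" using scale[OF i c] by blast
      have "?r (c *\<^sub>R x) \<le> q k (c *\<^sub>R x)" using bdd k(1) by (rule cINF_lower)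
      then show "?r (c *\<^sub>R x) / c \<le> q i x" using k c by (simp add: field_simps)
    qed
    then show ?thesis using c by (simp add: field_simps)
  qed
  fix c :: real and x assume c: "c > 0"
  have "?r (inverse c *\<^sub>R c *\<^sub>R x) \<le> inverse c * ?r (c *\<^sub>R x)"
    using c by (intro le) auto
  then have "c * ?r x \<le> ?r (c *\<^sub>R x)" using c by (simp add: field_simps)
  then show "?r (c *\<^sub>R x) = c * ?r x" using le[OF c, of x] by simp
qed

text \<open>A minimal sublinear functional below \<open>p\<close> is linear.\<close>

theorem Hahn_Banach_sublinear:
  fixes p :: "'e::real_vector \<Rightarrow> real"
  assumes p: "sublinear p"
  obtains \<phi> where "linear \<phi>" "\<And>x. \<phi> x \<le> p x"
proof -
  let ?A = "{q. sublinear q \<and> q \<le> p}" and ?P = "\<lambda>q r :: 'e \<Rightarrow> real. r \<le> q"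
  have "\<exists>q\<in>?A. \<forall>r\<in>?A. ?P q r \<longrightarrow> r = q"
  proof (rule predicate_Zorn)
    show "partial_order_on ?A (relation_of ?P ?A)"
      by (rule partial_order_on_relation_ofI) auto
    fix C assume C: "C \<in> Chains (relation_of ?P ?A)"
    show "\<exists>u\<in>?A. \<forall>a\<in>C. ?P a u"
    proof (cases "C = {}")
      case True
      then show ?thesis using p by auto
    next
      case False
      have CA: "C \<subseteq> ?A" and lin: "\<And>G H. G \<in> C \<Longrightarrow> H \<in> C \<Longrightarrow> G \<le> H \<or> H \<le> G"
        using C unfolding Chains_def relation_of_def by auto
      have bdd: "bdd_below ((\<lambda>q. q x) ` C)" for x
      proof (rule bdd_belowI2)
        fix q assume "q \<in> C"
        then have q: "sublinear q" "q (- x) \<le> p (- x)" using CA by (auto simp: le_fun_def)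
        show "- p (- x) \<le> q x" using sublinear_minus_le[OF q(1), of x] q(2) by simp
      qed
      have "sublinear (\<lambda>x. INF q\<in>C. q x)"
      proof (rule sublinear_cINF[OF False bdd])
        fix q r :: "'e \<Rightarrow> real" and x y assume qr: "q \<in> C" "r \<in> C"
        have "\<exists>k\<in>C. k \<le> q \<and> k \<le> r" using lin[OF qr] qr by auto
        then obtain k where k: "k \<in> C" "k \<le> q" "k \<le> r" by blast
        have "sublinear k" using k CA by auto
        then have "k (x + y) \<le> k x + k y" by (rule sublinear_add)
        also have "\<dots> \<le> q x + r y" using k by (intro add_mono) (auto simp: le_fun_def)
        finally show "\<exists>k\<in>C. k (x + y) \<le> q x + r y" using k(1) by blast
      next
        fix q :: "'e \<Rightarrow> real" and c :: real and x assume "q \<in> C" "c > 0"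
        then show "\<exists>k\<in>C. k (c *\<^sub>R x) \<le> c * q x"
          using CA by (intro bexI[of _ q]) (auto simp: sublinear_scale)
      qed
      moreover have le: "(\<lambda>x. INF q\<in>C. q x) \<le> q" if "q \<in> C" for q
        using bdd that by (auto simp: le_fun_def intro: cINF_lower)
      moreover have "(\<lambda>x. INF q\<in>C. q x) \<le> p"
      proof -
        obtain q where q: "q \<in> C" using False by blast
        then have "q \<le> p" using CA by auto
        then show ?thesis using le[OF q] by (rule order_trans[rotated])
      qed
      ultimately show ?thesis by blast
    qed
  qed
  then obtain q where q: "sublinear q" "q \<le> p"
    and min: "\<And>r. sublinear r \<Longrightarrow> r \<le> q \<Longrightarrow> r = q"
    by (auto intro: order_trans)
  have add: "q x + q w \<le> q (x + w)" for x w
  proof -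
    \<comment> \<open>The infimum \<open>?r\<close> is sublinear and lies below \<open>q\<close>
      (take \<open>t = 0\<close>), so minimality gives \<open>?r = q\<close>. The index
      \<open>t = 1\<close> then yields the missing superadditivity.\<close>
    let ?s = "\<lambda>t x. q (x + t *\<^sub>R w) - t * q w"
    let ?r = "\<lambda>x. INF t\<in>{0..}. ?s t x"
    have bdd: "bdd_below ((\<lambda>t. ?s t x) ` {0..})" for x
    proof (rule bdd_belowI2)
      fix t :: real assume "t \<in> {0..}"
      then have "t * q w = q ((x + t *\<^sub>R w) + - x)" by (simp add: sublinear_scale_nonneg[OF q(1)])
      also have "\<dots> \<le> q (x + t *\<^sub>R w) + q (- x)" by (rule sublinear_add[OF q(1)])
      finally show "- q (- x) \<le> ?s t x" by simp
    qed
    have "sublinear ?r"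
    proof (rule sublinear_cINF[OF _ bdd])
      fix s t :: real and x y assume st: "s \<in> {0..}" "t \<in> {0..}"
      have "q ((x + s *\<^sub>R w) + (y + t *\<^sub>R w)) \<le> q (x + s *\<^sub>R w) + q (y + t *\<^sub>R w)"
        by (rule sublinear_add[OF q(1)])
      then have "?s (s + t) (x + y) \<le> ?s s x + ?s t y" by (simp add: algebra_simps)
      then show "\<exists>k\<in>{0..}. ?s k (x + y) \<le> ?s s x + ?s t y"
        using st by (intro bexI[of _ "s + t"]) auto
    next
      fix t c :: real and x assume t: "t \<in> {0..}" "c > 0"
      have "?s (c * t) (c *\<^sub>R x) = q (c *\<^sub>R (x + t *\<^sub>R w)) - c * t * q w"
        by (simp add: algebra_simps)
      also have "\<dots> = c * ?s t x"
        using sublinear_scale[OF q(1) t(2), of "x + t *\<^sub>R w"] by (simp add: algebra_simps)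
      finally show "\<exists>k\<in>{0..}. ?s k (c *\<^sub>R x) \<le> c * ?s t x"
        using t by (intro bexI[of _ "c * t"]) auto
    qed auto
    moreover have "?r \<le> q"
    proof (rule le_funI)
      fix x
      have "?r x \<le> ?s 0 x" by (rule cINF_lower[OF bdd]) simp
      then show "?r x \<le> q x" by simp
    qed
    ultimately have "?r = q" by (rule min)
    then have "q x = ?r x" by (rule fun_cong[OF sym])
    also have "\<dots> \<le> ?s 1 x" by (rule cINF_lower[OF bdd]) simp
    finally have "q x \<le> ?s 1 x" .
    then show ?thesis by simp
  qed
  have add': "q (x + y) = q x + q y" for x y
    using add[of x y] sublinear_add[OF q(1), of x y] by simp
  have neg: "q (- x) = - q x" for x
    using add'[of x "- x"] sublinear_0[OF q(1)] by simp
  have "q (c *\<^sub>R x) = c * q x" for c x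
  proof (cases "c \<ge> 0")
    case True
    then show ?thesis by (rule sublinear_scale_nonneg[OF q(1)])
  next
    case False
    then have "q ((- c) *\<^sub>R (- x)) = (- c) * q (- x)"
      by (intro sublinear_scale_nonneg[OF q(1)]) auto
    then show ?thesis by (simp add: neg)
  qed
  then have "linear q" using add' by (intro linearI) auto
  then show thesis using q(2) by (intro that[of q]) (auto simp: le_fun_def)
qed

text \<open>Apply Hahn-Banach to the infimum of \<open>norm (x + t *\<^sub>R k) - t * d\<close> over
  \<open>t \<ge> 0\<close> and \<open>k \<in> K\<close>, which is subadditive because
  \<open>K\<close> is convex. The index \<open>t = 0\<close> bounds the functional by the norm, and
  \<open>t = 1\<close> at the point \<open>- k\<close> separates.\<close>

lemma blinfun_separating_convex:
  fixes K :: "'e::real_normed_vector set"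
  assumes K: "convex K" "K \<noteq> {}" and d: "d \<ge> 0" "\<And>k. k \<in> K \<Longrightarrow> d \<le> norm k"
  obtains \<phi> :: "'e \<Rightarrow>\<^sub>L real" where "norm \<phi> \<le> 1" "\<And>k. k \<in> K \<Longrightarrow> d \<le> blinfun_apply \<phi> k"
proof -
  let ?A = "{0::real..} \<times> K" and ?s = "\<lambda>(t, k) x. norm (x + t *\<^sub>R k) - t * d"
  let ?p = "\<lambda>x. INF i\<in>?A. ?s i x"
  have bdd: "bdd_below ((\<lambda>i. ?s i x) ` ?A)" for x
  proof (rule bdd_belowI2)
    fix i assume "i \<in> ?A"
    then obtain t k where i: "i = (t, k)" "t \<ge> 0" "k \<in> K" by auto
    have "t * d \<le> norm (t *\<^sub>R k)" using i d by (simp add: mult_left_mono)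
    also have "\<dots> \<le> norm (x + t *\<^sub>R k) + norm x"
      using norm_triangle_ineq[of "x + t *\<^sub>R k" "- x"] by simp
    finally show "- norm x \<le> ?s i x" using i by simp
  qed
  obtain k0 where k0: "k0 \<in> K" using K by blast
  have "sublinear ?p"
  proof (rule sublinear_cINF[OF _ bdd])
    show "?A \<noteq> {}" using K by auto
  next
    fix i j x y assume "i \<in> ?A" "j \<in> ?A"
    then obtain s k t l where ij: "i = (s, k)" "s \<ge> 0" "k \<in> K" "j = (t, l)" "t \<ge> 0" "l \<in> K"
      by auto
    obtain m where m: "m \<in> K" "(s + t) *\<^sub>R m = s *\<^sub>R k + t *\<^sub>R l"
    proof (cases "s + t = 0")
      case True
      then have "s = 0" "t = 0" using ij by auto
      then show ?thesis using that[OF k0] by simp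
    next
      case False
      then have pos: "s + t > 0" using ij by simp
      have "(s / (s + t)) *\<^sub>R k + (t / (s + t)) *\<^sub>R l \<in> K"
        using pos ij by (intro convexD[OF K(1)]) (auto simp flip: add_divide_distrib)
      moreover have "(s + t) *\<^sub>R ((s / (s + t)) *\<^sub>R k + (t / (s + t)) *\<^sub>R l) = s *\<^sub>R k + t *\<^sub>R l"
        using pos by (simp add: scaleR_add_right del: scaleR_left.add)
      ultimately show ?thesis by (rule that)
    qed
    have "norm ((x + s *\<^sub>R k) + (y + t *\<^sub>R l)) \<le> norm (x + s *\<^sub>R k) + norm (y + t *\<^sub>R l)"
      by (rule norm_triangle_ineq)
    moreover have "(x + s *\<^sub>R k) + (y + t *\<^sub>R l) = (x + y) + (s + t) *\<^sub>R m"
      using m(2) by (simp add: algebra_simps)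
    ultimately have "?s (s + t, m) (x + y) \<le> ?s i x + ?s j y"
      using ij by (simp add: algebra_simps)
    then show "\<exists>k\<in>?A. ?s k (x + y) \<le> ?s i x + ?s j y"
      using ij m(1) by (intro bexI[of _ "(s + t, m)"]) auto
  next
    fix i x and c :: real assume "i \<in> ?A" and c: "c > 0"
    then obtain t k where i: "i = (t, k)" "t \<ge> 0" "k \<in> K" by auto
    have "norm (c *\<^sub>R x + (c * t) *\<^sub>R k) = norm (c *\<^sub>R (x + t *\<^sub>R k))"
      by (simp add: scaleR_add_right)
    also have "\<dots> = c * norm (x + t *\<^sub>R k)" using c by simp
    finally have "?s (c * t, k) (c *\<^sub>R x) = c * ?s i x"
      using i by (simp add: right_diff_distrib)
    then show "\<exists>k\<in>?A. ?s k (c *\<^sub>R x) \<le> c * ?s i x"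
      using i c by (intro bexI[of _ "(c * t, k)"]) auto
  qed
  then obtain \<phi> where \<phi>: "linear \<phi>" "\<And>x. \<phi> x \<le> ?p x"
    by (rule Hahn_Banach_sublinear) blast
  have le: "\<phi> x \<le> ?s i x" if "i \<in> ?A" for i x
    using \<phi>(2)[of x] cINF_lower[OF bdd that, of x] by (rule order_trans)
  have "\<phi> x \<le> norm x" for x
    using le[of "(0, k0)" x] k0 by simp
  then have nrm: "norm (\<phi> x) \<le> norm x * 1" for x
    using linear_neg[OF \<phi>(1), of x] by (metis abs_le_iff mult.right_neutral norm_minus_cancel real_norm_def)
  then have bl: "bounded_linear \<phi>"
    using \<phi>(1) by (intro bounded_linear.intro bounded_linear_axioms.intro exI[of _ 1]) auto
  show thesis
  proof (rule that[of "Blinfun \<phi>"])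
    show "norm (Blinfun \<phi>) \<le> 1"
      using nrm bl by (intro norm_blinfun_bound) (auto simp: bounded_linear_Blinfun_apply)
    fix k assume "k \<in> K"
    then have "\<phi> (- k) \<le> - d" using le[of "(1, k)" "- k"] by simp
    then show "d \<le> blinfun_apply (Blinfun \<phi>) k"
      using linear_neg[OF \<phi>(1), of k] by (simp add: bounded_linear_Blinfun_apply[OF bl])
  qed
qed

lemma norming_blinfun:
  fixes x :: "'e::real_normed_vector"
  obtains \<phi> :: "'e \<Rightarrow>\<^sub>L real" where "norm \<phi> \<le> 1" "blinfun_apply \<phi> x = norm x"
proof -
  obtain \<phi> :: "'e \<Rightarrow>\<^sub>L real" where \<phi>: "norm \<phi> \<le> 1" "norm x \<le> blinfun_apply \<phi> x"
    using blinfun_separating_convex[of "{x}" "norm x"] by auto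
  have "norm (blinfun_apply \<phi> x) \<le> norm x"
    using norm_blinfun[of \<phi> x] mult_right_mono[OF \<phi>(1), of "norm x"] by simp
  then show thesis using \<phi> by (intro that[of \<phi>]) auto
qed

section \<open>Limits along interlaced tuples\<close>

text \<open>The first entry is the outermost limit: with the earlier entries held fixed, the last
  entry runs to infinity first.\<close>

fun tuple_filter :: "nat filter \<Rightarrow> nat \<Rightarrow> nat list filter" where
  "tuple_filter U 0 = principal {[]}"
| "tuple_filter U (Suc k) = filter_bind U (\<lambda>n. filtermap (Cons n) (tuple_filter U k))"

text \<open>The nesting alternates between the two tuples. Along a free ultrafilter each new entry
  therefore eventually exceeds all earlier entries of both tuples, and the pairs are
  interlaced.\<close>

fun interlacing_filter :: "nat filter \<Rightarrow> nat \<Rightarrow> (nat list \<times> nat list) filter" where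
  "interlacing_filter U 0 = principal {([], [])}"
| "interlacing_filter U (Suc k) = filter_bind U (\<lambda>n. filter_bind U (\<lambda>m.
     filtermap (\<lambda>(p, q). (n # p, m # q)) (interlacing_filter U k)))"

text \<open>The argument \<open>t\<close> is a lower bound passed on by the recursion; starting from
  \<open>t = 0\<close> makes all entries positive.\<close>

fun interlaced :: "nat \<Rightarrow> nat list \<Rightarrow> nat list \<Rightarrow> bool" where
  "interlaced t [] [] \<longleftrightarrow> True"
| "interlaced t (n # p) (m # q) \<longleftrightarrow> t < n \<and> n < m \<and> interlaced m p q"
| "interlaced t _ _ \<longleftrightarrow> False"

lemma ultra_tuple_filter: "ultra U \<Longrightarrow> ultra (tuple_filter U k)"
  by (induction k) (auto intro!: ultra_principal ultra_filter_bind ultra_filtermap)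

lemma ultra_interlacing_filter: "ultra U \<Longrightarrow> ultra (interlacing_filter U k)"
  by (induction k) (auto intro!: ultra_principal ultra_filter_bind ultra_filtermap)

lemma eventually_gt_sequentially_le:
  "U \<le> sequentially \<Longrightarrow> eventually (\<lambda>n. N < n) U"
  by (rule filter_leD[OF _ eventually_gt_at_top])

lemma eventually_tuple_filter_gt:
  assumes "U \<le> sequentially"
  shows "eventually (\<lambda>p. length p = k \<and> (\<forall>n\<in>set p. N < n)) (tuple_filter U k)"
proof (induction k)
  case (Suc k)
  show ?case
    using eventually_gt_sequentially_le[OF assms, of N]
    by (auto simp: eventually_filter_bind eventually_filtermap intro!: eventually_mono[OF Suc]
        elim!: eventually_mono)
qed (simp add: eventually_principal)

lemma eventually_interlacing_filter:
  assumes "U \<le> sequentially"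
  shows "eventually (\<lambda>(p, q). length p = k \<and> length q = k \<and> interlaced t p q) (interlacing_filter U k)"
proof (induction k arbitrary: t)
  case (Suc k)
  have step: "eventually (\<lambda>x. length (n # fst x) = Suc k \<and> length (m # snd x) = Suc k \<and>
      interlaced t (n # fst x) (m # snd x)) (interlacing_filter U k)" if "t < n" "n < m" for n m
    by (rule eventually_mono[OF Suc[of m]]) (use that in auto)
  have "eventually (\<lambda>m. eventually (\<lambda>x. length (n # fst x) = Suc k \<and> length (m # snd x) = Suc k \<and>
      interlaced t (n # fst x) (m # snd x)) (interlacing_filter U k)) U" if "t < n" for n
    using eventually_gt_sequentially_le[OF assms, of n] by eventually_elim (rule step[OF that])
  then have "eventually (\<lambda>n. eventually (\<lambda>m. eventually (\<lambda>x. length (n # fst x) = Suc k \<and>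
      length (m # snd x) = Suc k \<and> interlaced t (n # fst x) (m # snd x)) (interlacing_filter U k)) U) U"
    using eventually_gt_sequentially_le[OF assms, of t] by (rule eventually_mono[rotated])
  then show ?case
    by (simp add: eventually_filter_bind eventually_filtermap case_prod_unfold)
qed (simp add: eventually_principal)

text \<open>Forgetting one tuple leaves limits over variables that no longer occur, and these change
  nothing because \<open>U\<close> is proper.\<close>

lemma filtermap_fst_interlacing_filter:
  assumes U: "ultra U"
  shows "filtermap fst (interlacing_filter U k) = tuple_filter U k"
proof (induction k)
  case (Suc k)
  have "eventually (\<lambda>x. P (n # fst x)) (interlacing_filter U k) \<longleftrightarrow>
      eventually (\<lambda>p. P (n # p)) (tuple_filter U k)" for P n
    by (subst Suc[symmetric]) (simp add: eventually_filtermap)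
  then show ?case using U
    by (simp add: filter_eq_iff eventually_filter_bind eventually_filtermap case_prod_unfold ultra_def)
qed (simp add: filtermap_principal)

lemma filtermap_snd_interlacing_filter:
  assumes U: "ultra U"
  shows "filtermap snd (interlacing_filter U k) = tuple_filter U k"
proof (induction k)
  case (Suc k)
  have "eventually (\<lambda>x. P (n # snd x)) (interlacing_filter U k) \<longleftrightarrow>
      eventually (\<lambda>p. P (n # p)) (tuple_filter U k)" for P n
    by (subst Suc[symmetric]) (simp add: eventually_filtermap)
  then show ?case using U
    by (simp add: filter_eq_iff eventually_filter_bind eventually_filtermap case_prod_unfold ultra_def)
qed (simp add: filtermap_principal)

lemma tendsto_interlacing_fst:
  assumes "ultra U" "(f \<longlongrightarrow> l) (tuple_filter U k)"
  shows "((\<lambda>(p, q). f p) \<longlongrightarrow> l) (interlacing_filter U k)"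
  using assms(2) unfolding filterlim_def filtermap_fst_interlacing_filter[OF assms(1), symmetric]
  by (simp add: filtermap_filtermap case_prod_unfold)

lemma tendsto_interlacing_snd:
  assumes "ultra U" "(f \<longlongrightarrow> l) (tuple_filter U k)"
  shows "((\<lambda>(p, q). f q) \<longlongrightarrow> l) (interlacing_filter U k)"
  using assms(2) unfolding filterlim_def filtermap_snd_interlacing_filter[OF assms(1), symmetric]
  by (simp add: filtermap_filtermap case_prod_unfold)

section \<open>Exchange of iterated limits\<close>

lemma tendsto_abs_diff_le:
  fixes f g :: "'a \<Rightarrow> real"
  assumes "(f \<longlongrightarrow> l) F" "(g \<longlongrightarrow> m) F" "F \<noteq> bot" "\<And>x. \<bar>f x - g x\<bar> \<le> e"
  shows "\<bar>l - m\<bar> \<le> e"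
proof (rule tendsto_le[OF assms(3)])
  show "((\<lambda>x. \<bar>f x - g x\<bar>) \<longlongrightarrow> \<bar>l - m\<bar>) F" by (intro tendsto_intros assms)
  show "((\<lambda>x. e) \<longlongrightarrow> e) F" by (rule tendsto_const)
qed (simp add: assms(4))

text \<open>Here \<open>x\<close> acts as a weak limit of \<open>u\<close>, tested on
  \<open>Y\<close> up to the error \<open>e\<close>. The error is there for square-integrable
  functions, for which only approximate representatives are constructed; quantifying over all limits
  \<open>l\<close> avoids choosing one.\<close>

definition represents ::
  "'p filter \<Rightarrow> ('x \<Rightarrow> 'y \<Rightarrow> real) \<Rightarrow> 'y set \<Rightarrow> real \<Rightarrow> ('p \<Rightarrow> 'x) \<Rightarrow> 'x \<Rightarrow> bool"
  where "represents F B Y e u x \<longleftrightarrow>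
    (\<forall>y\<in>Y. \<forall>l. ((\<lambda>p. B (u p) y) \<longlongrightarrow> l) F \<longrightarrow> \<bar>l - B x y\<bar> \<le> e)"

lemma representsI:
  assumes "\<And>y. y \<in> Y \<Longrightarrow> ((\<lambda>p. B (u p) y) \<longlongrightarrow> B x y) F" "F \<noteq> bot" "e \<ge> 0"
  shows "represents F B Y e u x"
  unfolding represents_def
proof (intro ballI allI impI)
  fix y l assume "y \<in> Y" "((\<lambda>p. B (u p) y) \<longlongrightarrow> l) F"
  then have "l = B x y" using assms(1,2) tendsto_unique by blast
  then show "\<bar>l - B x y\<bar> \<le> e" using assms(3) by simp
qed

text \<open>The limit over the longer tuples is the limit over \<open>m\<close> of the limits
  \<open>g m\<close> over the tails. Each \<open>g m\<close> is within \<open>e\<close> of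
  \<open>s m\<close>, so the iterated limit is within \<open>e\<close> of \<open>b\<close>; it is
  also within \<open>d\<close> of \<open>c\<close>.\<close>

lemma tuple_limit_approx:
  fixes h :: "nat list \<Rightarrow> real"
  assumes U: "ultra U" and bdd: "\<And>q. \<bar>h q\<bar> \<le> C"
    and s: "\<And>m l. ((\<lambda>q. h (m # q)) \<longlongrightarrow> l) (tuple_filter U k) \<Longrightarrow> \<bar>l - s m\<bar> \<le> e"
    and c: "\<And>l. (h \<longlongrightarrow> l) (tuple_filter U (Suc k)) \<Longrightarrow> \<bar>l - c\<bar> \<le> d"
    and b: "(s \<longlongrightarrow> b) U"
  shows "\<bar>b - c\<bar> \<le> d + e"
proof -
  have "\<exists>l. \<bar>l\<bar> \<le> C \<and> ((\<lambda>q. h (m # q)) \<longlongrightarrow> l) (tuple_filter U k)" for m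
    by (rule ultra_tendsto_bounded[OF ultra_tuple_filter[OF U] bdd])
  then obtain g where g: "\<And>m. \<bar>g m\<bar> \<le> C"
      "\<And>m. ((\<lambda>q. h (m # q)) \<longlongrightarrow> g m) (tuple_filter U k)"
    by metis
  obtain l where l: "(g \<longlongrightarrow> l) U"
    using ultra_tendsto_bounded[of U g C] U g(1) by blast
  have "(h \<longlongrightarrow> l) (tuple_filter U (Suc k))"
    using tendsto_filter_bind[of h g "\<lambda>n. filtermap (Cons n) (tuple_filter U k)", OF _ l] g(2)
    by (simp add: filterlim_filtermap)
  then have "\<bar>l - c\<bar> \<le> d" by (rule c)
  moreover have "\<bar>l - b\<bar> \<le> e"
    by (rule tendsto_abs_diff_le[OF l b ultra_neq_bot[OF U]]) (rule s[OF g(2)])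
  ultimately show ?thesis by linarith
qed

text \<open>
  The limit of \<open>B (u p) (v q)\<close> along interlaced pairs is the value of \<open>B\<close> at the two separate
  limits, because limits in either variable are attained: the order in which the coordinates of
  \<open>p\<close> and \<open>q\<close> run to infinity does not matter.
\<close>

lemma interlacing_limit:
  fixes B :: "'x \<Rightarrow> 'y \<Rightarrow> real"
  assumes U: "ultra U"
    and bdd: "\<And>x y. x \<in> X \<Longrightarrow> y \<in> Y \<Longrightarrow> \<bar>B x y\<bar> \<le> C"
    and repX: "\<And>k u e. e > 0 \<Longrightarrow> (\<And>p. u p \<in> X) \<Longrightarrow> \<exists>x\<in>X. represents (tuple_filter U k) B Y e u x"
    and repY: "\<And>k v e. e > 0 \<Longrightarrow> (\<And>q. v q \<in> Y) \<Longrightarrow>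
      \<exists>y\<in>Y. represents (tuple_filter U k) (\<lambda>y x. B x y) X e v y"
  shows "\<lbrakk>\<And>p. u p \<in> X; \<And>q. v q \<in> Y; x \<in> X; y \<in> Y;
    represents (tuple_filter U k) B Y d u x;
    represents (tuple_filter U k) (\<lambda>y x. B x y) X d v y;
    ((\<lambda>(p, q). B (u p) (v q)) \<longlongrightarrow> a) (interlacing_filter U k)\<rbrakk> \<Longrightarrow> \<bar>a - B x y\<bar> \<le> 2 * d"
proof (induction k arbitrary: u v x y d a)
  case 0
  have "((\<lambda>(p, q). B (u p) (v q)) \<longlongrightarrow> B (u []) (v [])) (principal {([], [])})"
    by (rule tendsto_eventually) (simp add: eventually_principal)
  then have a: "a = B (u []) (v [])"
    using 0(7) tendsto_unique[of "principal {([], [])}"] by (simp add: principal_eq_bot_iff)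
  have "((\<lambda>p. B (u p) (v [])) \<longlongrightarrow> B (u []) (v [])) (principal {[]})"
    by (rule tendsto_eventually) (simp add: eventually_principal)
  then have "\<bar>B (u []) (v []) - B x (v [])\<bar> \<le> d"
    using 0(5,2) by (simp add: represents_def)
  moreover have "((\<lambda>q. B x (v q)) \<longlongrightarrow> B x (v [])) (principal {[]})"
    by (rule tendsto_eventually) (simp add: eventually_principal)
  then have "\<bar>B x (v []) - B x y\<bar> \<le> d"
    using 0(6,3) by (simp add: represents_def)
  ultimately show ?case unfolding a by linarith
next
  case (Suc k)
  note uX = Suc.prems(1) and vY = Suc.prems(2) and xX = Suc.prems(3) and yY = Suc.prems(4)
  have "\<bar>a - B x y\<bar> \<le> 2 * d + e'" if "e' > 0" for e'
  proof -
    \<comment> \<open>The two final estimates, \<open>d + e\<close> and \<open>d + 3 * e\<close>,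
      add up to \<open>2 * d + e'\<close>.\<close>
    define e where "e = e' / 4"
    have e: "e > 0" using that by (simp add: e_def)
    have "\<exists>x\<in>X. represents (tuple_filter U k) B Y e (\<lambda>p. u (n # p)) x" for n
      by (rule repX[OF e uX])
    then obtain xs where xs: "\<And>n. xs n \<in> X"
        "\<And>n. represents (tuple_filter U k) B Y e (\<lambda>p. u (n # p)) (xs n)"
      by metis
    have "\<exists>y\<in>Y. represents (tuple_filter U k) (\<lambda>y x. B x y) X e (\<lambda>q. v (m # q)) y" for m
      by (rule repY[OF e vY])
    then obtain ys where ys: "\<And>m. ys m \<in> Y"
        "\<And>m. represents (tuple_filter U k) (\<lambda>y x. B x y) X e (\<lambda>q. v (m # q)) (ys m)"
      by metis
    have "\<exists>l. \<bar>l\<bar> \<le> C \<and> ((\<lambda>(p, q). B (u (n # p)) (v (m # q))) \<longlongrightarrow> l) (interlacing_filter U k)" for n m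
      by (rule ultra_tendsto_bounded[OF ultra_interlacing_filter[OF U]])
         (auto intro: bdd uX vY)
    then obtain A where A: "\<And>n m. \<bar>A n m\<bar> \<le> C"
        "\<And>n m. ((\<lambda>(p, q). B (u (n # p)) (v (m # q))) \<longlongrightarrow> A n m) (interlacing_filter U k)"
      by metis
    have "\<exists>l. \<bar>l\<bar> \<le> C \<and> (A n \<longlongrightarrow> l) U" for n
      by (rule ultra_tendsto_bounded[OF U A(1)])
    then obtain A' where A': "\<And>n. \<bar>A' n\<bar> \<le> C" "\<And>n. (A n \<longlongrightarrow> A' n) U" by metis
    obtain a' where a': "(A' \<longlongrightarrow> a') U"
      using ultra_tendsto_bounded[of U A' C] U A'(1) by blast
    have "((\<lambda>(p, q). B (u p) (v q)) \<longlongrightarrow> a') (interlacing_filter U (Suc k))"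
      unfolding interlacing_filter.simps
      by (rule tendsto_filter_bind[OF _ a'], rule tendsto_filter_bind[OF _ A'(2)])
         (use A(2) in \<open>simp add: filterlim_filtermap case_prod_unfold\<close>)
    then have a: "a = a'"
      using Suc.prems(7) tendsto_unique ultra_neq_bot[OF ultra_interlacing_filter[OF U]] by blast
    \<comment> \<open>With the first entries \<open>n\<close> and \<open>m\<close> fixed, the
      induction hypothesis compares the inner limit with the representatives of the tails. Then the
      limit over \<open>m\<close> replaces \<open>ys m\<close> by \<open>y\<close>, and the limit
      over \<open>n\<close> replaces \<open>xs n\<close> by \<open>x\<close>.\<close>
    have A_approx: "\<bar>A n m - B (xs n) (ys m)\<bar> \<le> 2 * e" for n m
      by (rule Suc.IH[OF uX vY xs(1) ys(1) xs(2) ys(2) A(2)])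
    have "\<exists>l. \<bar>l\<bar> \<le> C \<and> ((\<lambda>m. B (xs n) (ys m)) \<longlongrightarrow> l) U" for n
      by (rule ultra_tendsto_bounded[OF U bdd[OF xs(1) ys(1)]])
    then obtain b where b: "\<And>n. ((\<lambda>m. B (xs n) (ys m)) \<longlongrightarrow> b n) U" by metis
    have b_approx: "\<bar>b n - B (xs n) y\<bar> \<le> d + e" for n
    proof (rule tuple_limit_approx[OF U _ _ _ b])
      show "\<bar>B (xs n) (v q)\<bar> \<le> C" for q using bdd xs(1) vY by blast
      show "\<bar>l - B (xs n) (ys m)\<bar> \<le> e"
        if "((\<lambda>q. B (xs n) (v (m # q))) \<longlongrightarrow> l) (tuple_filter U k)" for m l
        using ys(2)[of m] xs(1) that by (auto simp: represents_def)
      show "\<bar>l - B (xs n) y\<bar> \<le> d"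
        if "((\<lambda>q. B (xs n) (v q)) \<longlongrightarrow> l) (tuple_filter U (Suc k))" for l
        using Suc.prems(6) xs(1) that by (auto simp: represents_def)
    qed
    have A'_b: "\<bar>A' n - b n\<bar> \<le> 2 * e" for n
      by (rule tendsto_abs_diff_le[OF A'(2) b ultra_neq_bot[OF U] A_approx])
    have A'_approx: "\<bar>A' n - B (xs n) y\<bar> \<le> d + 3 * e" for n
      using b_approx[of n] A'_b[of n] by linarith
    obtain c where c: "((\<lambda>n. B (xs n) y) \<longlongrightarrow> c) U"
      using ultra_tendsto_bounded[of U "\<lambda>n. B (xs n) y" C] U bdd[OF xs(1) yY] by blast
    have "\<bar>c - B x y\<bar> \<le> d + e"
    proof (rule tuple_limit_approx[OF U _ _ _ c])
      show "\<bar>B (u p) y\<bar> \<le> C" for p using bdd uX yY by blast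
      show "\<bar>l - B (xs n) y\<bar> \<le> e"
        if "((\<lambda>p. B (u (n # p)) y) \<longlongrightarrow> l) (tuple_filter U k)" for n l
        using xs(2)[of n] yY that by (auto simp: represents_def)
      show "\<bar>l - B x y\<bar> \<le> d"
        if "((\<lambda>p. B (u p) y) \<longlongrightarrow> l) (tuple_filter U (Suc k))" for l
        using Suc.prems(5) yY that by (auto simp: represents_def)
    qed
    moreover have "\<bar>a' - c\<bar> \<le> d + 3 * e"
      by (rule tendsto_abs_diff_le[OF a' c ultra_neq_bot[OF U] A'_approx])
    ultimately show ?thesis unfolding a e_def by linarith
  qed
  then show ?case by (rule field_le_epsilon)
qed

text \<open>
  The first property keeps images of the interlacing graphs bounded at large scale, whatever their
  diameter. The second is the substitute for weak convergence of bounded sequences.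
\<close>

definition interlacing_bound :: "'e::real_normed_vector itself \<Rightarrow> bool"
  where "interlacing_bound _ \<longleftrightarrow> (\<forall>k C R (f :: nat list \<Rightarrow> 'e).
    (\<forall>p. norm (f p) \<le> R) \<and>
    (\<forall>p q. length p = k \<and> length q = k \<and> interlaced 0 p q \<longrightarrow> norm (f p - f q) \<le> C) \<longrightarrow>
    (\<exists>p q. length p = k \<and> length q = k \<and> (\<forall>n\<in>set p. \<forall>m\<in>set q. n < m) \<and>
       norm (f p - f q) \<le> 2 * C + 1))"

lemma interlacing_boundD:
  fixes f :: "nat list \<Rightarrow> 'e::real_normed_vector"
  assumes "interlacing_bound TYPE('e)" "\<And>p. norm (f p) \<le> R"
    and "\<And>p q. length p = k \<Longrightarrow> length q = k \<Longrightarrow> interlaced 0 p q \<Longrightarrow> norm (f p - f q) \<le> C"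
  shows "\<exists>p q. length p = k \<and> length q = k \<and> (\<forall>n\<in>set p. \<forall>m\<in>set q. n < m) \<and>
    norm (f p - f q) \<le> 2 * C + 1"
  by (rule assms(1)[unfolded interlacing_bound_def, rule_format, of f R k C]) (use assms(2,3) in blast)

definition asymptotic_centres :: "'e::real_normed_vector itself \<Rightarrow> bool"
  where "asymptotic_centres _ \<longleftrightarrow> (\<forall>\<xi> :: nat \<Rightarrow> 'e. bounded (range \<xi>) \<longrightarrow>
    (\<exists>\<zeta> x. (\<forall>n. \<zeta> n \<in> convex hull (\<xi> ` {n..})) \<and>
       (\<forall>\<eta>. (\<lambda>n. norm (\<eta> - \<zeta> n) - norm (x - \<zeta> n)) \<longlonglongrightarrow> norm (\<eta> - x))))"

text \<open>What holds along \<open>tuple_filter U k\<close> holds for some tuples with arbitrarily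
  large entries, so \<open>q\<close> can be taken beyond the maximum of \<open>p\<close>. In the
  proof \<open>insert 0\<close> gives the empty tuple a maximum.\<close>

lemma separated_tuples_exist:
  assumes U: "U \<le> sequentially" "ultra U" and P: "eventually P (tuple_filter U k)"
  obtains p q where "length p = k" "length q = k" "\<forall>n\<in>set p. \<forall>m\<in>set q. n < m" "P p" "P q"
proof -
  have "\<exists>p. length p = k \<and> (\<forall>n\<in>set p. N < n) \<and> P p" for N
    using eventually_happens'[OF ultra_neq_bot[OF ultra_tuple_filter[OF U(2)]]
        eventually_conj[OF eventually_tuple_filter_gt[OF U(1), of k N] P]] by auto
  then obtain p q where pq: "length p = k" "P p" "length q = k" "\<forall>m\<in>set q. Max (insert 0 (set p)) < m" "P q"
    by metis
  have "n < m" if "n \<in> set p" "m \<in> set q" for n m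
    using pq(4) that Max_ge[of "insert 0 (set p)" n] by (auto intro: le_less_trans)
  then show thesis using pq that by blast
qed

section \<open>Reflexive spaces\<close>

text \<open>The limits of \<open>\<phi> (u p)\<close> depend linearly and boundedly on
  \<open>\<phi>\<close>, so they form an element of the bidual, which reflexivity turns into a
  point. A functional norming this point gives the norm bound.\<close>

lemma reflexive_weak_limit:
  fixes u :: "'p \<Rightarrow> 'e::real_normed_vector"
  assumes refl: "reflexive_space TYPE('e)" and F: "ultra F" and u: "\<And>p. norm (u p) \<le> R"
  obtains x where "norm x \<le> R" "\<And>\<phi> :: 'e \<Rightarrow>\<^sub>L real. ((\<lambda>p. \<phi> (u p)) \<longlongrightarrow> \<phi> x) F"
proof -
  have bdd: "\<bar>blinfun_apply \<phi> (u p)\<bar> \<le> norm \<phi> * R" for \<phi> :: "'e \<Rightarrow>\<^sub>L real" and p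
    using order_trans[OF norm_blinfun mult_left_mono[OF u norm_ge_zero]] by (metis real_norm_def)
  have "\<exists>l. \<bar>l\<bar> \<le> norm \<phi> * R \<and> ((\<lambda>p. blinfun_apply \<phi> (u p)) \<longlongrightarrow> l) F" for \<phi> :: "'e \<Rightarrow>\<^sub>L real"
    by (rule ultra_tendsto_bounded[OF F bdd])
  then obtain L where L: "\<And>\<phi> :: 'e \<Rightarrow>\<^sub>L real. \<bar>L \<phi>\<bar> \<le> norm \<phi> * R"
      "\<And>\<phi> :: 'e \<Rightarrow>\<^sub>L real. ((\<lambda>p. blinfun_apply \<phi> (u p)) \<longlongrightarrow> L \<phi>) F"
    by metis
  have "bounded_linear L"
  proof (rule bounded_linear_intro)
    fix \<phi> \<psi> :: "'e \<Rightarrow>\<^sub>L real" and c :: real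
    have "((\<lambda>p. blinfun_apply (\<phi> + \<psi>) (u p)) \<longlongrightarrow> L \<phi> + L \<psi>) F"
      unfolding blinfun.add_left by (intro tendsto_intros L)
    then show "L (\<phi> + \<psi>) = L \<phi> + L \<psi>"
      using tendsto_unique[OF ultra_neq_bot[OF F] L(2)] by blast
    have "((\<lambda>p. blinfun_apply (c *\<^sub>R \<phi>) (u p)) \<longlongrightarrow> c *\<^sub>R L \<phi>) F"
      unfolding blinfun.scaleR_left by (intro tendsto_intros L)
    then show "L (c *\<^sub>R \<phi>) = c *\<^sub>R L \<phi>"
      using tendsto_unique[OF ultra_neq_bot[OF F] L(2)] by blast
    show "norm (L \<phi>) \<le> norm \<phi> * R" using L(1) by simp
  qed
  moreover obtain x :: 'e where x: "bidual_embedding x = Blinfun L"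
    using refl unfolding reflexive_space_def by (metis surjD)
  ultimately have Lx: "L \<phi> = blinfun_apply \<phi> x" for \<phi>
    by (metis bidual_embedding.rep_eq bounded_linear_Blinfun_apply)
  obtain \<phi> :: "'e \<Rightarrow>\<^sub>L real" where \<phi>: "norm \<phi> \<le> 1" "blinfun_apply \<phi> x = norm x"
    by (rule norming_blinfun)
  have "0 \<le> R" using u norm_ge_zero order_trans by blast
  then have "norm x \<le> R"
    using L(1)[of \<phi>] \<phi> mult_right_mono[OF \<phi>(1), of R] by (simp add: Lx)
  then show thesis using L(2) by (intro that[of x]) (simp_all add: Lx)
qed

text \<open>Banach-Alaoglu along an ultrafilter: bounded real values converge at every point, and
  the pointwise limit inherits linearity and the norm bound.\<close>

lemma dual_ball_limit:
  fixes \<phi> :: "'p \<Rightarrow> 'e::real_normed_vector \<Rightarrow>\<^sub>L real"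
  assumes F: "ultra F" and \<phi>: "\<And>p. norm (\<phi> p) \<le> 1"
  obtains \<psi> :: "'e \<Rightarrow>\<^sub>L real" where "norm \<psi> \<le> 1" "\<And>y. ((\<lambda>p. \<phi> p y) \<longlongrightarrow> \<psi> y) F"
proof -
  have bdd: "\<bar>blinfun_apply (\<phi> p) y\<bar> \<le> norm y" for p y
    using order_trans[OF norm_blinfun mult_right_mono[OF \<phi> norm_ge_zero]]
    by (metis real_norm_def mult_1)
  have "\<exists>l. \<bar>l\<bar> \<le> norm y \<and> ((\<lambda>p. blinfun_apply (\<phi> p) y) \<longlongrightarrow> l) F" for y
    by (rule ultra_tendsto_bounded[OF F bdd])
  then obtain L where L: "\<And>y. \<bar>L y\<bar> \<le> norm y"
      "\<And>y. ((\<lambda>p. blinfun_apply (\<phi> p) y) \<longlongrightarrow> L y) F"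
    by metis
  have bl: "bounded_linear L"
  proof (rule bounded_linear_intro)
    fix x y :: 'e and c :: real
    have "((\<lambda>p. blinfun_apply (\<phi> p) (x + y)) \<longlongrightarrow> L x + L y) F"
      unfolding blinfun.add_right by (intro tendsto_intros L)
    then show "L (x + y) = L x + L y"
      using tendsto_unique[OF ultra_neq_bot[OF F] L(2)] by blast
    have "((\<lambda>p. blinfun_apply (\<phi> p) (c *\<^sub>R x)) \<longlongrightarrow> c *\<^sub>R L x) F"
      unfolding blinfun.scaleR_right by (intro tendsto_intros L)
    then show "L (c *\<^sub>R x) = c *\<^sub>R L x"
      using tendsto_unique[OF ultra_neq_bot[OF F] L(2)] by blast
    show "norm (L x) \<le> norm x * 1" using L(1) by simp
  qed
  show thesis
  proof (rule that[of "Blinfun L"])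
    show "norm (Blinfun L) \<le> 1"
      using L(1) by (intro norm_blinfun_bound) (auto simp: bounded_linear_Blinfun_apply[OF bl])
    show "((\<lambda>p. blinfun_apply (\<phi> p) y) \<longlongrightarrow> blinfun_apply (Blinfun L) y) F" for y
      using L(2) by (simp add: bounded_linear_Blinfun_apply[OF bl])
  qed
qed

text \<open>
  Kalton's argument: let \<open>x\<close> be the weak limit of \<open>f\<close> and let \<open>\<phi> p\<close> norm \<open>f p - x\<close>. For interlaced
  \<open>p, q\<close> the number \<open>\<phi> p (f q - x)\<close> is at least \<open>norm (f p - x) - C\<close>, while its limit is \<open>0\<close>.
\<close>

lemma reflexive_interlacing_bound:
  assumes refl: "reflexive_space TYPE('e::real_normed_vector)"
  shows "interlacing_bound TYPE('e)"
  unfolding interlacing_bound_def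
proof (intro allI impI, elim conjE)
  fix k C R and f :: "nat list \<Rightarrow> 'e"
  assume R: "\<forall>p. norm (f p) \<le> R"
    and C: "\<forall>p q. length p = k \<and> length q = k \<and> interlaced 0 p q \<longrightarrow> norm (f p - f q) \<le> C"
  obtain U :: "nat filter" where U: "U \<le> sequentially" "ultra U" by (rule free_ultrafilter_nat)
  note ut = ultra_tuple_filter[OF U(2)] and ui = ultra_interlacing_filter[OF U(2)]
  obtain x where x: "norm x \<le> R"
      "\<And>\<phi> :: 'e \<Rightarrow>\<^sub>L real. ((\<lambda>p. \<phi> (f p)) \<longlongrightarrow> \<phi> x) (tuple_filter U k)"
    using reflexive_weak_limit[where u = f, OF refl ut[of k] R[rule_format]] by blast
  have "\<exists>\<phi> :: 'e \<Rightarrow>\<^sub>L real. norm \<phi> \<le> 1 \<and> blinfun_apply \<phi> (f p - x) = norm (f p - x)" for p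
    using norming_blinfun by metis
  then obtain \<phi> :: "nat list \<Rightarrow> 'e \<Rightarrow>\<^sub>L real" where \<phi>: "\<And>p. norm (\<phi> p) \<le> 1"
      "\<And>p. blinfun_apply (\<phi> p) (f p - x) = norm (f p - x)" by metis
  obtain \<psi> :: "'e \<Rightarrow>\<^sub>L real" where \<psi>: "norm \<psi> \<le> 1"
      "\<And>y. ((\<lambda>p. blinfun_apply (\<phi> p) y) \<longlongrightarrow> blinfun_apply \<psi> y) (tuple_filter U k)"
    using dual_ball_limit[where \<phi> = \<phi>, OF ut[of k] \<phi>(1)] by blast
  have "\<bar>norm (f p - x)\<bar> \<le> R + R" for p
    unfolding abs_norm_cancel using norm_triangle_ineq4[of "f p" x] R[rule_format, of p] x(1) by linarith
  then obtain s where s: "((\<lambda>p. norm (f p - x)) \<longlongrightarrow> s) (tuple_filter U k)"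
    using ultra_tendsto_bounded[OF ut, of "\<lambda>p. norm (f p - x)" "R + R" k] by blast
  have bdd: "\<bar>blinfun_apply \<phi> y\<bar> \<le> R" if "norm \<phi> \<le> 1" "norm y \<le> R" for \<phi> :: "'e \<Rightarrow>\<^sub>L real" and y
    using norm_blinfun[of \<phi> y] mult_right_mono[OF that(1), of "norm y"] that(2) by simp
  have ev: "\<bar>case r of (p, q) \<Rightarrow> blinfun_apply (\<phi> p) (f q)\<bar> \<le> R" for r
    using bdd[OF \<phi>(1) R[rule_format]] by (cases r) simp
  obtain a where a: "((\<lambda>(p, q). blinfun_apply (\<phi> p) (f q)) \<longlongrightarrow> a) (interlacing_filter U k)"
    using ultra_tendsto_bounded[OF ui[of k],
      of "\<lambda>(p, q). blinfun_apply (\<phi> p) (f q)" R] ev by blast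
  let ?B = "\<lambda>\<phi> :: 'e \<Rightarrow>\<^sub>L real. \<lambda>y. blinfun_apply \<phi> y"
  \<comment> \<open>In this duality limits are attained exactly in both variables, weak-star for
    functionals and weakly for vectors, hence the error \<open>0\<close>.\<close>
  have "\<bar>a - blinfun_apply \<psi> x\<bar> \<le> 2 * 0"
  proof (rule interlacing_limit[OF U(2), of "{\<phi>. norm \<phi> \<le> 1}" "{y. norm y \<le> R}" ?B R \<phi> f])
    show "\<bar>?B \<phi> y\<bar> \<le> R" if "\<phi> \<in> {\<phi>. norm \<phi> \<le> 1}" "y \<in> {y. norm y \<le> R}" for \<phi> y
      using that bdd by auto
  next
    fix j and u :: "nat list \<Rightarrow> 'e \<Rightarrow>\<^sub>L real" and e :: real
    assume e: "e > 0" and u: "\<And>p. u p \<in> {\<phi>. norm \<phi> \<le> 1}"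
    then have u: "norm (u p) \<le> 1" for p by blast
    obtain \<theta> :: "'e \<Rightarrow>\<^sub>L real" where "norm \<theta> \<le> 1"
        "\<And>y. ((\<lambda>p. blinfun_apply (u p) y) \<longlongrightarrow> blinfun_apply \<theta> y) (tuple_filter U j)"
      using dual_ball_limit[where \<phi> = u, OF ut[of j] u] by blast
    then show "\<exists>\<theta>\<in>{\<phi>. norm \<phi> \<le> 1}. represents (tuple_filter U j) ?B {y. norm y \<le> R} e u \<theta>"
      using e by (intro bexI[of _ \<theta>] representsI ultra_neq_bot ut) auto
  next
    fix j and v :: "nat list \<Rightarrow> 'e" and e :: real
    assume e: "e > 0" and v: "\<And>q. v q \<in> {y. norm y \<le> R}"
    then have v: "norm (v q) \<le> R" for q by blast
    obtain y where "norm y \<le> R"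
        "\<And>\<theta> :: 'e \<Rightarrow>\<^sub>L real. ((\<lambda>p. \<theta> (v p)) \<longlongrightarrow> \<theta> y) (tuple_filter U j)"
      using reflexive_weak_limit[where u = v, OF refl ut[of j] v] by blast
    then show "\<exists>y\<in>{y. norm y \<le> R}.
        represents (tuple_filter U j) (\<lambda>y \<phi>. ?B \<phi> y) {\<phi>. norm \<phi> \<le> 1} e v y"
      using e by (intro bexI[of _ y] representsI ultra_neq_bot ut) auto
  next
    show "represents (tuple_filter U k) ?B {y. norm y \<le> R} 0 \<phi> \<psi>"
      by (intro representsI ultra_neq_bot ut \<psi>(2)) auto
    show "represents (tuple_filter U k) (\<lambda>y \<phi>. ?B \<phi> y) {\<phi>. norm \<phi> \<le> 1} 0 f x"
      by (intro representsI ultra_neq_bot ut x(2)) auto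
  qed (use \<phi> R x \<psi> a in auto)
  then have a: "((\<lambda>(p, q). blinfun_apply (\<phi> p) (f q)) \<longlongrightarrow> blinfun_apply \<psi> x) (interlacing_filter U k)" using a by simp
  \<comment> \<open>Since \<open>\<phi> p\<close> norms \<open>f p - x\<close>, the bound
    \<open>\<phi> p (f p - f q) \<le> C\<close> reads
    \<open>norm (f p - x) \<le> C + (\<phi> p (f q) - \<phi> p x)\<close>. Both terms in the bracket
    tend to \<open>\<psi> x\<close>.\<close>
  have "s \<le> C + (blinfun_apply \<psi> x - blinfun_apply \<psi> x)"
  proof (rule tendsto_le[OF ultra_neq_bot[OF ui[of k]]])
    show "((\<lambda>(p, q). norm (f p - x)) \<longlongrightarrow> s) (interlacing_filter U k)"
      by (rule tendsto_interlacing_fst[OF U(2) s])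
    show "((\<lambda>r. C + ((\<lambda>(p, q). blinfun_apply (\<phi> p) (f q)) r - (\<lambda>(p, q). blinfun_apply (\<phi> p) x) r)) \<longlongrightarrow> C + (blinfun_apply \<psi> x - blinfun_apply \<psi> x))
        (interlacing_filter U k)"
      by (intro tendsto_intros a tendsto_interlacing_fst[OF U(2)] \<psi>)
    show "\<forall>\<^sub>F r in interlacing_filter U k. (case r of (p, q) \<Rightarrow> norm (f p - x))
        \<le> C + ((\<lambda>(p, q). blinfun_apply (\<phi> p) (f q)) r - (\<lambda>(p, q). blinfun_apply (\<phi> p) x) r)"
      using eventually_interlacing_filter[OF U(1), of k 0]
    proof eventually_elim
      case (elim r)
      obtain p q where r: "r = (p, q)" by (cases r)
      then have "norm (f p - f q) \<le> C" using elim C by auto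
      moreover have "\<bar>blinfun_apply (\<phi> p) (f p - f q)\<bar> \<le> norm (f p - f q)"
        using norm_blinfun[of "\<phi> p" "f p - f q"] mult_right_mono[OF \<phi>(1), of "norm (f p - f q)" p] by simp
      ultimately have "blinfun_apply (\<phi> p) (f p - f q) \<le> C" by linarith
      then show ?case unfolding r using \<phi>(2)[of p] by (simp add: blinfun.diff_right)
    qed
  qed
  then have "eventually (\<lambda>p. norm (f p - x) < C + 1 / 2) (tuple_filter U k)"
    using s by (intro order_tendstoD) auto
  then obtain p q where pq: "length p = k" "length q = k" "\<forall>n\<in>set p. \<forall>m\<in>set q. n < m"
    "norm (f p - x) < C + 1 / 2" "norm (f q - x) < C + 1 / 2"
    by (rule separated_tuples_exist[OF U])
  have "norm (f p - f q) \<le> norm (f p - x) + norm (f q - x)"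
    using norm_triangle_ineq4[of "f p - x" "f q - x"] by simp
  then show "\<exists>p q. length p = k \<and> length q = k \<and> (\<forall>n\<in>set p. \<forall>m\<in>set q. n < m) \<and>
      norm (f p - f q) \<le> 2 * C + 1"
    using pq by (intro exI[of _ p] exI[of _ q]) auto
qed

text \<open>Mazur's lemma: the weak limit \<open>x\<close> along an ultrafilter lies in the norm
  closure of the hull of every tail, since a separating functional would contradict weak
  convergence. With \<open>\<zeta> n\<close> chosen to converge to \<open>x\<close> in norm, the
  asymptotic identity is continuity of the norm.\<close>

lemma reflexive_asymptotic_centres:
  assumes refl: "reflexive_space TYPE('e::real_normed_vector)"
  shows "asymptotic_centres TYPE('e)"
  unfolding asymptotic_centres_def
proof (intro allI impI)
  fix \<xi> :: "nat \<Rightarrow> 'e"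
  assume "bounded (range \<xi>)"
  then obtain R where R: "\<And>n. norm (\<xi> n) \<le> R" by (auto simp: bounded_iff)
  obtain U :: "nat filter" where U: "U \<le> sequentially" "ultra U" by (rule free_ultrafilter_nat)
  obtain x where x: "\<And>\<phi> :: 'e \<Rightarrow>\<^sub>L real. ((\<lambda>n. \<phi> (\<xi> n)) \<longlongrightarrow> \<phi> x) U"
    using reflexive_weak_limit[OF refl U(2), of \<xi> R] R by blast
  have "\<exists>z\<in>convex hull (\<xi> ` {n..}). norm (x - z) < d" if "d > 0" for n d
  proof (rule ccontr)
    assume "\<not> ?thesis"
    then have d: "d \<le> norm k" if "k \<in> (\<lambda>z. z - x) ` (convex hull (\<xi> ` {n..}))" for k
      using that by (force simp: norm_minus_commute)
    obtain \<phi> :: "'e \<Rightarrow>\<^sub>L real" where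
      \<phi>: "\<And>k. k \<in> (\<lambda>z. z - x) ` (convex hull (\<xi> ` {n..})) \<Longrightarrow> d \<le> blinfun_apply \<phi> k"
    proof (rule blinfun_separating_convex[OF _ _ _ d])
      show "convex ((\<lambda>z. z - x) ` (convex hull (\<xi> ` {n..})))"
        by (simp add: convex_translation_subtract_eq)
    qed (use \<open>d > 0\<close> in auto)
    have "d \<le> blinfun_apply \<phi> (\<xi> m - x)" if "m \<ge> n" for m
      using that by (intro \<phi> imageI hull_inc) auto
    then have "eventually (\<lambda>m. \<phi> x + d \<le> \<phi> (\<xi> m)) U"
      by (intro filter_leD[OF U(1)] eventually_sequentiallyI[of n]) (simp add: blinfun.diff_right algebra_simps)
    then have "\<phi> x + d \<le> \<phi> x"
      using ultra_neq_bot[OF U(2)] by (intro tendsto_lowerbound[OF x])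
    then show False using \<open>d > 0\<close> by simp
  qed
  then have "\<exists>z\<in>convex hull (\<xi> ` {n..}). norm (x - z) < 1 / Suc n" for n by simp
  then obtain \<zeta> where \<zeta>: "\<And>n. \<zeta> n \<in> convex hull (\<xi> ` {n..})" "\<And>n. norm (x - \<zeta> n) < 1 / Suc n"
    by metis
  have lim: "(\<lambda>n. x - \<zeta> n) \<longlonglongrightarrow> 0"
    by (rule Lim_null_comparison[OF _ LIMSEQ_inverse_real_of_nat])
       (use \<zeta>(2) in \<open>auto intro!: always_eventually less_imp_le simp: inverse_eq_divide\<close>)
  have "(\<lambda>n. norm (\<eta> - \<zeta> n) - norm (x - \<zeta> n)) \<longlonglongrightarrow> norm (\<eta> - x)" for \<eta>
  proof -
    have "(\<lambda>n. norm ((\<eta> - x) + (x - \<zeta> n)) - norm (x - \<zeta> n)) \<longlonglongrightarrow> norm ((\<eta> - x) + 0) - norm (0 :: 'e)"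
      by (intro tendsto_intros lim)
    then show ?thesis by simp
  qed
  then show "\<exists>\<zeta> x. (\<forall>n. \<zeta> n \<in> convex hull (\<xi> ` {n..})) \<and>
      (\<forall>\<eta>. (\<lambda>n. norm (\<eta> - \<zeta> n) - norm (x - \<zeta> n)) \<longlonglongrightarrow> norm (\<eta> - x))"
    using \<zeta>(1) by blast
qed

section \<open>Square-integrable functions\<close>

text \<open>Functions rather than classes modulo null sets: only the semi-inner product given by the
  integral of \<open>u w * v w\<close> enters the estimates.\<close>

definition square_integrable :: "'w measure \<Rightarrow> ('w \<Rightarrow> real) set"
  where "square_integrable M = {u \<in> borel_measurable M. integrable M (\<lambda>w. (u w)\<^sup>2)}"

lemma integrable_square_integrable_mult:
  assumes "u \<in> square_integrable M" "v \<in> square_integrable M"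
  shows "integrable M (\<lambda>w. u w * v w)"
proof (rule Bochner_Integration.integrable_bound)
  show "integrable M (\<lambda>w. (u w)\<^sup>2 + (v w)\<^sup>2)"
    using assms by (auto simp: square_integrable_def)
  show "(\<lambda>w. u w * v w) \<in> borel_measurable M"
    using assms by (auto simp: square_integrable_def)
  have "norm (a * b) \<le> norm (a\<^sup>2 + b\<^sup>2)" for a b :: real
  proof -
    have "2 * \<bar>a * b\<bar> \<le> a\<^sup>2 + b\<^sup>2"
      using sum_squares_bound[of "\<bar>a\<bar>" "\<bar>b\<bar>"] by (simp add: abs_mult)
    then show ?thesis by simp
  qed
  then show "AE w in M. norm (u w * v w) \<le> norm ((u w)\<^sup>2 + (v w)\<^sup>2)" by simp
qed

lemma square_integrable_add_scale:
  assumes u: "u \<in> square_integrable M" and v: "v \<in> square_integrable M"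
  shows "(\<lambda>w. u w + c * v w) \<in> square_integrable M"
    and "(\<integral>w. (u w + c * v w)\<^sup>2 \<partial>M) = (\<integral>w. (u w)\<^sup>2 \<partial>M) + 2 * c * (\<integral>w. u w * v w \<partial>M) + c\<^sup>2 * (\<integral>w. (v w)\<^sup>2 \<partial>M)"
proof -
  have i: "integrable M (\<lambda>w. (u w)\<^sup>2)" "integrable M (\<lambda>w. (v w)\<^sup>2)" "integrable M (\<lambda>w. u w * v w)"
    using u v integrable_square_integrable_mult[OF u v] by (auto simp: square_integrable_def)
  have eq: "(u w + c * v w)\<^sup>2 = (u w)\<^sup>2 + 2 * c * (u w * v w) + c\<^sup>2 * (v w)\<^sup>2" for w
    by (simp add: power2_eq_square algebra_simps)
  have "integrable M (\<lambda>w. (u w + c * v w)\<^sup>2)" unfolding eq using i by simp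
  then show "(\<lambda>w. u w + c * v w) \<in> square_integrable M"
    using u v unfolding square_integrable_def by auto
  show "(\<integral>w. (u w + c * v w)\<^sup>2 \<partial>M) = (\<integral>w. (u w)\<^sup>2 \<partial>M) + 2 * c * (\<integral>w. u w * v w \<partial>M) + c\<^sup>2 * (\<integral>w. (v w)\<^sup>2 \<partial>M)"
    unfolding eq using i by simp
qed

lemma square_integrable_mult_bound:
  assumes "u \<in> square_integrable M" "v \<in> square_integrable M"
  shows "2 * \<bar>\<integral>w. u w * v w \<partial>M\<bar> \<le> (\<integral>w. (u w)\<^sup>2 \<partial>M) + (\<integral>w. (v w)\<^sup>2 \<partial>M)"
proof -
  have "0 \<le> (\<integral>w. (u w + c * v w)\<^sup>2 \<partial>M)" for c by simp
  from this[of 1] this[of "-1"] show ?thesis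
    unfolding square_integrable_add_scale(2)[OF assms] by (simp add: abs_if)
qed

text \<open>
  An approximate Riesz representation of the functional \<open>v \<mapsto> lim \<integral>u p * v\<close>, by a near-minimiser
  of \<open>\<integral>v\<^sup>2 - 2 * lim \<integral>u p * v\<close>; it makes completeness of the space unnecessary.
\<close>

lemma square_integrable_weak_limit:
  fixes u :: "'p \<Rightarrow> 'w \<Rightarrow> real"
  assumes F: "ultra F" and e: "e > 0"
    and u: "\<And>p. u p \<in> {u \<in> square_integrable M. (\<integral>w. (u w)\<^sup>2 \<partial>M) \<le> R}" (is "\<And>p. u p \<in> ?X")
  shows "\<exists>x\<in>?X. represents F (\<lambda>u v. \<integral>w. u w * v w \<partial>M) ?X e u x"
proof -
  let ?B = "\<lambda>u v. \<integral>w. u w * v w \<partial>M"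
  have uS: "u p \<in> square_integrable M" and uR: "(\<integral>w. (u p w)\<^sup>2 \<partial>M) \<le> R" for p using u by auto
  have R: "R \<ge> 0" using uR[of undefined] by (rule order_trans[rotated]) simp
  have "\<exists>l. 2 * l \<le> R + (\<integral>w. (v w)\<^sup>2 \<partial>M) \<and> ((\<lambda>p. ?B (u p) v) \<longlongrightarrow> l) F"
    if v: "v \<in> square_integrable M" for v
  proof -
    have "\<bar>?B (u p) v\<bar> \<le> (R + (\<integral>w. (v w)\<^sup>2 \<partial>M)) / 2" for p
      using square_integrable_mult_bound[OF uS[of p] v] uR[of p] by simp
    then obtain l where "\<bar>l\<bar> \<le> (R + (\<integral>w. (v w)\<^sup>2 \<partial>M)) / 2" "((\<lambda>p. ?B (u p) v) \<longlongrightarrow> l) F"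
      using ultra_tendsto_bounded[OF F, of "\<lambda>p. ?B (u p) v"] by blast
    then show ?thesis by (intro exI[of _ l]) auto
  qed
  then obtain L where L_le: "\<And>v. v \<in> square_integrable M \<Longrightarrow> 2 * L v \<le> R + (\<integral>w. (v w)\<^sup>2 \<partial>M)"
    and L: "\<And>v. v \<in> square_integrable M \<Longrightarrow> ((\<lambda>p. ?B (u p) v) \<longlongrightarrow> L v) F"
    by metis
  have L_add: "L (\<lambda>w. x w + c * y w) = L x + c * L y"
    if x: "x \<in> square_integrable M" and y: "y \<in> square_integrable M" for x y c
  proof -
    have "?B (u p) (\<lambda>w. x w + c * y w) = ?B (u p) x + c * ?B (u p) y" for p
    proof -
      have "(\<lambda>w. u p w * (x w + c * y w)) = (\<lambda>w. u p w * x w + c * (u p w * y w))"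
        by (auto simp: algebra_simps)
      then show ?thesis
        using integrable_square_integrable_mult[OF uS x, of p] integrable_square_integrable_mult[OF uS y, of p]
        by simp
    qed
    then have "((\<lambda>p. ?B (u p) (\<lambda>w. x w + c * y w)) \<longlongrightarrow> L x + c * L y) F"
      by (simp add: L[OF x] L[OF y] tendsto_add tendsto_mult_left)
    then show ?thesis
      using tendsto_unique[OF ultra_neq_bot[OF F] L[OF square_integrable_add_scale(1)[OF x y]]] by blast
  qed
  have zero: "(\<lambda>_. 0) \<in> square_integrable M" by (simp add: square_integrable_def)
  have "((\<lambda>p. ?B (u p) (\<lambda>_. 0)) \<longlongrightarrow> 0) F" by simp
  then have L0: "L (\<lambda>_. 0) = 0"
    using tendsto_unique[OF ultra_neq_bot[OF F] L[OF zero]] by blast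
  define Q where "Q v = (\<integral>w. (v w)\<^sup>2 \<partial>M) - 2 * L v" for v
  have Q_ge: "- R \<le> Q v" if "v \<in> square_integrable M" for v
    using L_le[OF that] by (simp add: Q_def)
  \<comment> \<open>If \<open>?V > 0\<close>, the minimiser of \<open>Q\<close> on the line through
    \<open>v\<close> is at \<open>c = L v / ?V\<close>, and the estimate \<open>L_le\<close> at this
    very point places it in the ball \<open>?X\<close>. So the infimum of \<open>Q\<close> over
    \<open>?X\<close> is a lower bound on the whole space.\<close>
  have scaled: "\<exists>v'\<in>?X. Q v' \<le> Q v" if v: "v \<in> square_integrable M" for v
  proof -
    let ?V = "\<integral>w. (v w)\<^sup>2 \<partial>M"
    have V: "?V \<ge> 0" by simp
    have cv: "(\<lambda>w. c * v w) \<in> square_integrable M" "(\<integral>w. (c * v w)\<^sup>2 \<partial>M) = c\<^sup>2 * ?V"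
        "L (\<lambda>w. c * v w) = c * L v" for c
      using square_integrable_add_scale[OF zero v, of c] L_add[OF zero v, of c] L0 by auto
    show ?thesis
    proof (cases "?V = 0")
      case True
      then show ?thesis using v R by (intro bexI[of _ v]) auto
    next
      case False
      then have V: "?V > 0" using V by linarith
      define c where "c = L v / ?V"
      have Lv: "L v = c * ?V" using V by (simp add: c_def)
      have "2 * (c * (c * ?V)) \<le> R + c\<^sup>2 * ?V"
        using L_le[OF cv(1)[of c]] by (simp only: cv Lv)
      then have "c\<^sup>2 * ?V \<le> R" by (simp add: power2_eq_square)
      moreover have "Q (\<lambda>w. c * v w) \<le> Q v"
      proof -
        have "0 \<le> (1 - c)\<^sup>2 * ?V" by simp
        then show ?thesis unfolding Q_def by (simp only: cv Lv) (simp add: power2_eq_square algebra_simps)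
      qed
      ultimately show ?thesis using cv(1,2) by (intro bexI[of _ "\<lambda>w. c * v w"]) auto
    qed
  qed
  \<comment> \<open>Varying \<open>x\<close> by \<open>d\<close> and \<open>- d\<close> times
    \<open>y\<close> below gives \<open>2 * \<bar>L y - ?B x y\<bar> \<le> d * (1 + R)\<close>,
    which this choice turns into \<open>2 * e\<close>.\<close>
  define d where "d = 2 * e / (R + 1)"
  have d: "d > 0" using e R by (simp add: d_def)
  have bdd: "bdd_below (Q ` ?X)" using Q_ge by (intro bdd_belowI2[of _ "- R"]) auto
  have "?X \<noteq> {}" using u by blast
  then obtain x where x: "x \<in> ?X" "Q x < Inf (Q ` ?X) + d\<^sup>2"
    using cInf_lessD[of "Q ` ?X" "Inf (Q ` ?X) + d\<^sup>2"] d by auto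
  have Q_min: "Q x - d\<^sup>2 \<le> Q v" if v: "v \<in> square_integrable M" for v
  proof -
    obtain v' where v': "v' \<in> ?X" "Q v' \<le> Q v" using scaled[OF v] by blast
    have "Inf (Q ` ?X) \<le> Q v'" by (rule cINF_lower[OF bdd v'(1)])
    then show ?thesis using x(2) v'(2) by linarith
  qed
  have xS: "x \<in> square_integrable M" using x by simp
  have "\<bar>L y - ?B x y\<bar> \<le> e" if y: "y \<in> ?X" for y
  proof -
    have yS: "y \<in> square_integrable M" and yR: "(\<integral>w. (y w)\<^sup>2 \<partial>M) \<le> R" using y by auto
    have *: "0 \<le> d\<^sup>2 + t\<^sup>2 * R + 2 * t * (?B x y - L y)" for t
    proof -
      have "Q (\<lambda>w. x w + t * y w) = Q x + 2 * t * (?B x y - L y) + t\<^sup>2 * (\<integral>w. (y w)\<^sup>2 \<partial>M)"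
        unfolding Q_def square_integrable_add_scale(2)[OF xS yS] L_add[OF xS yS] by (simp add: algebra_simps)
      moreover have "t\<^sup>2 * (\<integral>w. (y w)\<^sup>2 \<partial>M) \<le> t\<^sup>2 * R" using yR by (intro mult_left_mono) auto
      ultimately show ?thesis
        using Q_min[OF square_integrable_add_scale(1)[OF xS yS], of t] by linarith
    qed
    have "d * (2 * \<bar>L y - ?B x y\<bar>) \<le> d * (d * (1 + R))"
      using *[of d] *[of "- d"] by (simp add: abs_if power2_eq_square algebra_simps)
    then have "2 * \<bar>L y - ?B x y\<bar> \<le> d * (1 + R)" using d by simp
    also have "\<dots> = 2 * e" using R by (simp add: d_def field_simps)
    finally show ?thesis by simp
  qed
  then have "represents F ?B ?X e u x"
    unfolding represents_def using L tendsto_unique[OF ultra_neq_bot[OF F]] by blast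
  then show ?thesis using x(1) by blast
qed

section \<open>The space of integrable functions\<close>

text \<open>The signed indicator of the region between the axis and the graph of \<open>f\<close>.
  Half-open intervals make the squared difference of two layers exactly the indicator of the
  interval between the two values.\<close>

definition sign_layer :: "(real \<Rightarrow> real) \<Rightarrow> real \<times> real \<Rightarrow> real"
  where "sign_layer f = (\<lambda>(t, s). if 0 \<le> s \<and> s < f t then 1 else if f t \<le> s \<and> s < 0 then - 1 else 0)"

lemma borel_measurable_sign_layer:
  assumes [measurable]: "f \<in> borel_measurable lebesgue01"
  shows "sign_layer f \<in> borel_measurable (lebesgue01 \<Otimes>\<^sub>M lborel)"
  unfolding sign_layer_def case_prod_unfold by measurable

lemma sign_layer_diff_square:
  "(sign_layer f (t, s) - sign_layer g (t, s))\<^sup>2 = indicator {min (f t) (g t)..<max (f t) (g t)} s"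
  by (auto simp: sign_layer_def indicator_def min_def max_def)

text \<open>By Tonelli both integrals are the area between the graphs: the slice over
  \<open>t\<close> is an interval of length \<open>\<bar>f t - g t\<bar>\<close>.\<close>

lemma sign_layer_isometry:
  assumes f: "integrable lebesgue01 f" and g: "integrable lebesgue01 g"
  shows "integrable (lebesgue01 \<Otimes>\<^sub>M lborel) (\<lambda>w. (sign_layer f w - sign_layer g w)\<^sup>2)"
    and "(\<integral>w. (sign_layer f w - sign_layer g w)\<^sup>2 \<partial>(lebesgue01 \<Otimes>\<^sub>M lborel)) = (\<integral>t. \<bar>f t - g t\<bar> \<partial>lebesgue01)"
proof -
  have [measurable]: "f \<in> borel_measurable lebesgue01" "g \<in> borel_measurable lebesgue01"
    using f g by auto
  have [measurable]: "sign_layer f \<in> borel_measurable (lebesgue01 \<Otimes>\<^sub>M lborel)"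
    "sign_layer g \<in> borel_measurable (lebesgue01 \<Otimes>\<^sub>M lborel)"
    by (simp_all add: borel_measurable_sign_layer)
  have "(\<integral>\<^sup>+ w. ennreal ((sign_layer f w - sign_layer g w)\<^sup>2) \<partial>(lebesgue01 \<Otimes>\<^sub>M lborel)) =
      (\<integral>\<^sup>+ t. \<integral>\<^sup>+ s. ennreal ((sign_layer f (t, s) - sign_layer g (t, s))\<^sup>2) \<partial>lborel \<partial>lebesgue01)"
    by (rule lborel.nn_integral_fst[symmetric]) measurable
  also have "\<dots> = (\<integral>\<^sup>+ t. ennreal \<bar>f t - g t\<bar> \<partial>lebesgue01)"
  proof (rule nn_integral_cong)
    fix t
    have "(\<integral>\<^sup>+ s. ennreal ((sign_layer f (t, s) - sign_layer g (t, s))\<^sup>2) \<partial>lborel) =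
        (\<integral>\<^sup>+ s. indicator {min (f t) (g t)..<max (f t) (g t)} s \<partial>lborel)"
      unfolding sign_layer_diff_square by (intro nn_integral_cong) (auto simp: indicator_def)
    also have "\<dots> = emeasure lborel {min (f t) (g t)..<max (f t) (g t)}"
      by (rule nn_integral_indicator) simp
    also have "\<dots> = ennreal \<bar>f t - g t\<bar>"
      by (subst emeasure_lborel_Ico) (auto simp: min_def max_def intro!: arg_cong[of _ _ ennreal])
    finally show "(\<integral>\<^sup>+ s. ennreal ((sign_layer f (t, s) - sign_layer g (t, s))\<^sup>2) \<partial>lborel) = ennreal \<bar>f t - g t\<bar>" .
  qed
  also have "\<dots> = ennreal (\<integral>t. \<bar>f t - g t\<bar> \<partial>lebesgue01)"
    using f g by (intro nn_integral_eq_integral) auto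
  finally have "(\<integral>\<^sup>+ w. ennreal ((sign_layer f w - sign_layer g w)\<^sup>2) \<partial>(lebesgue01 \<Otimes>\<^sub>M lborel)) =
      ennreal (\<integral>t. \<bar>f t - g t\<bar> \<partial>lebesgue01)" .
  then have "integrable (lebesgue01 \<Otimes>\<^sub>M lborel) (\<lambda>w. (sign_layer f w - sign_layer g w)\<^sup>2) \<and>
      (\<integral>w. (sign_layer f w - sign_layer g w)\<^sup>2 \<partial>(lebesgue01 \<Otimes>\<^sub>M lborel)) = (\<integral>t. \<bar>f t - g t\<bar> \<partial>lebesgue01)"
    by (subst (asm) nn_integral_eq_integrable) auto
  then show "integrable (lebesgue01 \<Otimes>\<^sub>M lborel) (\<lambda>w. (sign_layer f w - sign_layer g w)\<^sup>2)"
    and "(\<integral>w. (sign_layer f w - sign_layer g w)\<^sup>2 \<partial>(lebesgue01 \<Otimes>\<^sub>M lborel)) = (\<integral>t. \<bar>f t - g t\<bar> \<partial>lebesgue01)"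
    by auto
qed

lemma integrable_rep_L1: "integrable lebesgue01 (rep_L1_unit_interval u)"
  using Quotient3_rep_reflp[OF Quotient3_L1_unit_interval, of u] by (simp add: L1_rel_def)

lemma abs_rep_L1: "abs_L1_unit_interval (rep_L1_unit_interval u) = u"
  by (rule Quotient3_abs_rep[OF Quotient3_L1_unit_interval])

lemma rep_abs_L1:
  assumes "integrable lebesgue01 f"
  shows "AE t in lebesgue01. rep_L1_unit_interval (abs_L1_unit_interval f) t = f t"
proof -
  have "L1_rel (rep_L1_unit_interval (abs_L1_unit_interval f)) f"
    by (rule Quotient3_rep_abs[OF Quotient3_L1_unit_interval, OF integrable_L1_rel[OF assms]])
  then show ?thesis by (simp add: L1_rel_def)
qed

lemma norm_diff_abs_L1:
  assumes "integrable lebesgue01 f" "integrable lebesgue01 g"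
  shows "norm (abs_L1_unit_interval f - abs_L1_unit_interval g) = (\<integral>t. \<bar>f t - g t\<bar> \<partial>lebesgue01)"
  using assms by (simp add: minus_L1_unit_interval.abs_eq norm_L1_unit_interval.abs_eq integrable_L1_rel)

lemma norm_diff_L1:
  "norm (u - v) = (\<integral>t. \<bar>rep_L1_unit_interval u t - rep_L1_unit_interval v t\<bar> \<partial>lebesgue01)"
  using norm_diff_abs_L1[OF integrable_rep_L1[of u] integrable_rep_L1[of v]] by (simp add: abs_rep_L1)

lemma norm_L1: "norm u = (\<integral>t. \<bar>rep_L1_unit_interval u t\<bar> \<partial>lebesgue01)"
  using norm_L1_unit_interval.abs_eq[OF integrable_L1_rel[OF integrable_rep_L1[of u]]]
  by (simp add: abs_rep_L1)

lemma rep_L1_add_AE: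
  "AE t in lebesgue01. rep_L1_unit_interval (u + v) t = rep_L1_unit_interval u t + rep_L1_unit_interval v t"
proof -
  have "u + v = abs_L1_unit_interval (\<lambda>t. rep_L1_unit_interval u t + rep_L1_unit_interval v t)"
    using plus_L1_unit_interval.abs_eq[OF integrable_L1_rel integrable_L1_rel, OF integrable_rep_L1 integrable_rep_L1, of u v]
    by (simp add: abs_rep_L1)
  then show ?thesis using rep_abs_L1 integrable_rep_L1 by auto
qed

lemma rep_L1_scaleR_AE:
  "AE t in lebesgue01. rep_L1_unit_interval (c *\<^sub>R u) t = c * rep_L1_unit_interval u t"
proof -
  have "c *\<^sub>R u = abs_L1_unit_interval (\<lambda>t. c * rep_L1_unit_interval u t)"
    using scaleR_L1_unit_interval.abs_eq[OF integrable_L1_rel, OF integrable_rep_L1, of c u]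
    by (simp add: abs_rep_L1)
  then show ?thesis using rep_abs_L1 integrable_rep_L1 by auto
qed

text \<open>
  Kalton's argument again, in a Hilbert space: \<open>sign_layer\<close> turns the distance of \<open>L\<^sup>1\<close> into the
  square of a Hilbert space distance.
\<close>

lemma L1_interlacing_bound: "interlacing_bound TYPE(L1_unit_interval)"
  unfolding interlacing_bound_def
proof (intro allI impI, elim conjE)
  fix k C R and f :: "nat list \<Rightarrow> L1_unit_interval"
  assume R: "\<forall>p. norm (f p) \<le> R"
    and C: "\<forall>p q. length p = k \<and> length q = k \<and> interlaced 0 p q \<longrightarrow> norm (f p - f q) \<le> C"
  obtain U :: "nat filter" where U: "U \<le> sequentially" "ultra U" by (rule free_ultrafilter_nat)
  note ut = ultra_tuple_filter[OF U(2)] and ui = ultra_interlacing_filter[OF U(2)]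
  let ?M = "lebesgue01 \<Otimes>\<^sub>M (lborel :: real measure)"
  let ?B = "\<lambda>u v. \<integral>w. u w * v w \<partial>?M"
  let ?X = "{u \<in> square_integrable ?M. (\<integral>w. (u w)\<^sup>2 \<partial>?M) \<le> R}"
  define u where "u p = sign_layer (rep_L1_unit_interval (f p))" for p
  have sl0: "sign_layer (\<lambda>_. 0) = (\<lambda>_. 0)" by (auto simp: sign_layer_def)
  have uS: "u p \<in> square_integrable ?M" for p
    using sign_layer_isometry(1)[OF integrable_rep_L1[of "f p"], of "\<lambda>_. 0"]
      borel_measurable_sign_layer[OF borel_measurable_integrable[OF integrable_rep_L1[of "f p"]]]
    by (simp add: sl0 u_def square_integrable_def)
  have u_norm: "(\<integral>w. (u p w)\<^sup>2 \<partial>?M) = norm (f p)" for p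
    using sign_layer_isometry(2)[OF integrable_rep_L1[of "f p"], of "\<lambda>_. 0"]
    by (simp add: sl0 u_def norm_L1)
  have diff: "(\<integral>w. (v w - v' w)\<^sup>2 \<partial>?M) = (\<integral>w. (v w)\<^sup>2 \<partial>?M) - 2 * ?B v v' + (\<integral>w. (v' w)\<^sup>2 \<partial>?M)"
    if "v \<in> square_integrable ?M" "v' \<in> square_integrable ?M" for v v'
    using square_integrable_add_scale(2)[OF that, of "-1"] by simp
  have u_dist: "norm (f p - f q) = norm (f p) - 2 * ?B (u p) (u q) + norm (f q)" for p q
    using sign_layer_isometry(2)[OF integrable_rep_L1[of "f p"] integrable_rep_L1[of "f q"]]
      diff[OF uS uS, of p q] by (simp add: norm_diff_L1 u_def[symmetric] u_norm)
  have uX: "u p \<in> ?X" for p using uS u_norm R by auto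
  have bdd: "\<bar>?B x y\<bar> \<le> R" if "x \<in> ?X" "y \<in> ?X" for x y
    using square_integrable_mult_bound[of x ?M y] that by auto
  \<comment> \<open>Below, \<open>D p\<close> and \<open>D q\<close> are less than
    \<open>C / 2 + 5 * e\<close>, so \<open>2 * D p + 2 * D q\<close> is less than
    \<open>2 * C + 20 * e = 2 * C + 1\<close>.\<close>
  define e :: real where "e = 1 / 20"
  have e: "e > 0" by (simp add: e_def)
  obtain x where x: "x \<in> ?X" and rep: "represents (tuple_filter U k) ?B ?X e u x"
    using square_integrable_weak_limit[where u = u, OF ut[of k] e uX] by blast
  have rep': "represents (tuple_filter U k) (\<lambda>y x. ?B x y) ?X e u x"
    using rep by (simp add: mult.commute)
  obtain b where b: "((\<lambda>p. ?B (u p) x) \<longlongrightarrow> b) (tuple_filter U k)"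
    using ultra_tendsto_bounded[OF ut, of "\<lambda>p. ?B (u p) x" R k] bdd uX x by blast
  have b_approx: "\<bar>b - ?B x x\<bar> \<le> e" using rep x b by (auto simp: represents_def)
  obtain s where s: "((\<lambda>p. norm (f p)) \<longlongrightarrow> s) (tuple_filter U k)"
    using ultra_tendsto_bounded[OF ut, of "\<lambda>p. norm (f p)" R k] R by auto
  have ev: "\<bar>case r of (p, q) \<Rightarrow> ?B (u p) (u q)\<bar> \<le> R" for r
    using bdd[OF uX uX] by (cases r) simp
  obtain a where a: "((\<lambda>(p, q). ?B (u p) (u q)) \<longlongrightarrow> a) (interlacing_filter U k)"
    using ultra_tendsto_bounded[OF ui[of k], of "\<lambda>(p, q). ?B (u p) (u q)" R] ev by blast
  have a_approx: "\<bar>a - ?B x x\<bar> \<le> 2 * e"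
  proof (rule interlacing_limit[OF U(2), of ?X ?X ?B R u u])
    show "\<exists>x\<in>?X. represents (tuple_filter U j) ?B ?X e' v x"
      if "e' > 0" "\<And>p. v p \<in> ?X" for j v e'
      by (rule square_integrable_weak_limit[OF ut that])
    show "\<exists>x\<in>?X. represents (tuple_filter U j) (\<lambda>y x. ?B x y) ?X e' v x"
      if "e' > 0" "\<And>p. v p \<in> ?X" for j v e'
      using square_integrable_weak_limit[OF ut[of j] that] by (simp add: mult.commute)
  qed (fact bdd uX x rep rep' a)+
  have "s - 2 * a + s \<le> C"
  proof (rule tendsto_upperbound[OF _ _ ultra_neq_bot[OF ui[of k]]])
    show "((\<lambda>r. (\<lambda>(p, q). norm (f p)) r - 2 * (\<lambda>(p, q). ?B (u p) (u q)) r + (\<lambda>(p, q). norm (f q)) r)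
        \<longlongrightarrow> s - 2 * a + s) (interlacing_filter U k)"
      by (intro tendsto_intros tendsto_interlacing_fst[OF U(2)] tendsto_interlacing_snd[OF U(2)] s a)
    show "\<forall>\<^sub>F r in interlacing_filter U k. (\<lambda>(p, q). norm (f p)) r - 2 * (\<lambda>(p, q). ?B (u p) (u q)) r +
        (\<lambda>(p, q). norm (f q)) r \<le> C"
      using eventually_interlacing_filter[OF U(1), of k 0]
    proof eventually_elim
      case (elim r)
      obtain p q where r: "r = (p, q)" by (cases r)
      then have "norm (f p - f q) \<le> C" using elim C by auto
      then show ?case unfolding r u_dist by simp
    qed
  qed
  \<comment> \<open>The squared distance from \<open>u p\<close> to \<open>x\<close>, expanded so
    that its limit is visible. As \<open>b\<close> is close to \<open>?B x x\<close>, this limit is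
    about \<open>s - ?B x x\<close>, and \<open>s - 2 * a + s \<le> C\<close> with \<open>a\<close>
    close to \<open>?B x x\<close> bounds that by about \<open>C / 2\<close>.\<close>
  define D where "D p = norm (f p) - 2 * ?B (u p) x + ?B x x" for p
  have "(D \<longlongrightarrow> s - 2 * b + ?B x x) (tuple_filter U k)"
    unfolding D_def by (intro tendsto_intros s b)
  moreover have "s - 2 * b + ?B x x < C / 2 + 5 * e"
    using \<open>s - 2 * a + s \<le> C\<close> a_approx b_approx e by linarith
  ultimately have "eventually (\<lambda>p. D p < C / 2 + 5 * e) (tuple_filter U k)"
    by (rule order_tendstoD)
  then obtain p q where pq: "length p = k" "length q = k" "\<forall>n\<in>set p. \<forall>m\<in>set q. n < m"
      "D p < C / 2 + 5 * e" "D q < C / 2 + 5 * e"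
    by (rule separated_tuples_exist[OF U])
  have xS: "x \<in> square_integrable ?M" using x by simp
  have D: "D p = (\<integral>w. (u p w - x w)\<^sup>2 \<partial>?M)" for p
    unfolding D_def diff[OF uS xS] u_norm by (simp add: power2_eq_square)
  have uxS: "(\<lambda>w. u p w - x w) \<in> square_integrable ?M" for p
    using square_integrable_add_scale(1)[OF uS xS, where c = "-1"] by simp
  have "norm (f p - f q) = (\<integral>w. ((u p w - x w) - (u q w - x w))\<^sup>2 \<partial>?M)"
    unfolding u_dist using diff[OF uS uS, of p q] by (simp add: u_norm)
  also have "\<dots> \<le> 2 * D p + 2 * D q"
    unfolding diff[OF uxS uxS] D using square_integrable_mult_bound[OF uxS uxS, of p q] by linarith
  also have "\<dots> \<le> 2 * C + 1" using pq(4,5) by (simp add: e_def)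
  finally show "\<exists>p q. length p = k \<and> length q = k \<and> (\<forall>n\<in>set p. \<forall>m\<in>set q. n < m) \<and>
      norm (f p - f q) \<le> 2 * C + 1"
    using pq by (intro exI[of _ p] exI[of _ q]) auto
qed

section \<open>Almost everywhere convergent convex combinations in L^1\<close>

lemma finite_measure_lebesgue01: "finite_measure lebesgue01"
  by (rule finite_measureI) (simp add: emeasure_restrict_space)

lemma measure_lebesgue01: "measure lebesgue01 {0..1} = 1"
  by (simp add: measure_restrict_space)

text \<open>A zero limit would send \<open>x k\<close> to infinity, against the finite lower
  limit.\<close>

lemma exp_tendsto_pos:
  fixes x :: "nat \<Rightarrow> real"
  assumes "(\<lambda>k. exp (- x k / 2)) \<longlonglongrightarrow> l" "liminf (\<lambda>k. ennreal (x k)) < \<infinity>"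
  shows "l > 0"
proof (rule ccontr)
  assume "\<not> l > 0"
  moreover have "l \<ge> 0" by (rule LIMSEQ_le_const[OF assms(1)]) auto
  ultimately have "l = 0" by simp
  then have "filterlim (\<lambda>k. exp (- x k / 2)) (at_right 0) sequentially"
    using assms(1) by (intro tendsto_imp_filterlim_at_right) auto
  then have "filterlim (\<lambda>k. ln (exp (- x k / 2))) at_bot sequentially"
    by (rule filterlim_compose[OF ln_at_0])
  then have "filterlim (\<lambda>k. - x k / 2) at_bot sequentially" by simp
  then have ev: "eventually (\<lambda>k. - x k / 2 \<le> - C / 2) sequentially" for C
    by (simp only: filterlim_at_bot)
  have "ennreal C \<le> liminf (\<lambda>k. ennreal (x k))" for C
  proof (rule Liminf_bounded)
    show "\<forall>\<^sub>F k in sequentially. ennreal C \<le> ennreal (x k)"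
      using ev[of C] by eventually_elim (simp add: ennreal_leI)
  qed
  moreover obtain r where r: "r \<ge> 0" "liminf (\<lambda>k. ennreal (x k)) = ennreal r"
    using assms(2) by (cases "liminf (\<lambda>k. ennreal (x k))") auto
  ultimately have "ennreal (r + 1) \<le> ennreal r" by metis
  then show False using r(1) by (simp add: ennreal_le_iff)
qed

text \<open>Convergence of the exponentials gives convergence of \<open>f k t\<close> wherever
  \<open>h t > 0\<close>. By Fatou the bound \<open>R\<close> on the integrals keeps the lower limit
  of \<open>f k t\<close> finite almost everywhere, which excludes \<open>h t = 0\<close> there; the
  same bound makes \<open>a = - 2 * ln h\<close> integrable.\<close>

lemma exp_convergent_Fatou:
  fixes f :: "nat \<Rightarrow> 'w \<Rightarrow> real"
  assumes f: "\<And>k. integrable M (f k)" "\<And>k. AE t in M. 0 \<le> f k t" "\<And>k. (\<integral>t. f k t \<partial>M) \<le> R"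
    and h: "h \<in> borel_measurable M" "AE t in M. (\<lambda>k. exp (- f k t / 2)) \<longlonglongrightarrow> h t"
  obtains a where "integrable M a" "AE t in M. (\<lambda>k. f k t) \<longlonglongrightarrow> a t"
proof -
  have [measurable]: "f k \<in> borel_measurable M" "h \<in> borel_measurable M" for k
    using f(1) h(1) by auto
  have R: "0 \<le> R" using integral_nonneg_AE[OF f(2)] f(3) by (rule order_trans)
  have "(\<integral>\<^sup>+ t. liminf (\<lambda>k. ennreal (f k t)) \<partial>M) \<le> liminf (\<lambda>k. \<integral>\<^sup>+ t. ennreal (f k t) \<partial>M)"
    by (rule nn_integral_liminf) measurable
  also have "\<dots> \<le> ennreal R"
  proof (rule Liminf_le)
    show "\<forall>\<^sub>F k in sequentially. (\<integral>\<^sup>+ t. ennreal (f k t) \<partial>M) \<le> ennreal R"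
      using f by (intro always_eventually allI) (simp add: nn_integral_eq_integral ennreal_leI)
  qed simp
  finally have Fatou: "(\<integral>\<^sup>+ t. liminf (\<lambda>k. ennreal (f k t)) \<partial>M) \<le> ennreal R" .
  then have "(\<integral>\<^sup>+ t. liminf (\<lambda>k. ennreal (f k t)) \<partial>M) \<noteq> \<infinity>"
    by (auto simp: top_unique)
  then have fin: "AE t in M. liminf (\<lambda>k. ennreal (f k t)) \<noteq> \<infinity>"
    by (intro nn_integral_noteq_infinite) measurable
  define a where "a t = - 2 * ln (h t)" for t
  have [measurable]: "a \<in> borel_measurable M" unfolding a_def by measurable
  have lim: "AE t in M. (\<lambda>k. f k t) \<longlonglongrightarrow> a t"
    using h(2) fin
  proof eventually_elim
    case (elim t)
    have "h t > 0"
      by (rule exp_tendsto_pos[OF elim(1)]) (use elim(2) in \<open>simp add: less_top\<close>)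
    then have "(\<lambda>k. - 2 * ln (exp (- f k t / 2))) \<longlonglongrightarrow> - 2 * ln (h t)"
      using elim(1) by (intro tendsto_intros) auto
    then show ?case by (simp add: a_def)
  qed
  have nonneg: "AE t in M. \<forall>k. 0 \<le> f k t" using f(2) by (simp add: AE_all_countable)
  have "AE t in M. liminf (\<lambda>k. ennreal (f k t)) = ennreal (a t)"
    using lim by eventually_elim (intro lim_imp_Liminf tendsto_ennrealI, simp_all)
  then have "(\<integral>\<^sup>+ t. ennreal (a t) \<partial>M) = (\<integral>\<^sup>+ t. liminf (\<lambda>k. ennreal (f k t)) \<partial>M)"
    by (intro nn_integral_cong_AE) auto
  then have "(\<integral>\<^sup>+ t. ennreal (a t) \<partial>M) < \<infinity>"
    using Fatou by (auto intro: le_less_trans)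
  moreover have "AE t in M. 0 \<le> a t"
    using lim nonneg by eventually_elim (auto intro: LIMSEQ_le_const)
  ultimately have "integrable M a"
    by (intro integrableI_nonneg) auto
  then show thesis using lim that by blast
qed

text \<open>The infima \<open>j n\<close> of \<open>J\<close> over the shrinking sets
  \<open>K n\<close> increase to a limit. Take \<open>c n\<close> within \<open>1 / Suc n\<close> of
  \<open>j n\<close>: the midpoint of \<open>c n\<close> and \<open>c m\<close> lies in
  \<open>K n\<close> for \<open>m \<ge> n\<close>, so its value is at least \<open>j n\<close>, and
  the midpoint defect is at most \<open>j m - j n\<close> plus the two errors.\<close>

lemma convergent_convex_blocks:
  fixes K :: "nat \<Rightarrow> 'v::real_vector set" and J :: "'v \<Rightarrow> real"
  assumes K: "\<And>n. convex (K n)" "\<And>n. K n \<noteq> {}" "\<And>n. K (Suc n) \<subseteq> K n"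
    and J: "\<And>c. c \<in> K 0 \<Longrightarrow> 0 \<le> J c \<and> J c \<le> C"
  obtains c where "\<And>n. c n \<in> K n"
    "\<And>e. e > 0 \<Longrightarrow> \<exists>N. \<forall>n\<ge>N. \<forall>m\<ge>n. J (c n) + J (c m) - 2 * J ((1 / 2) *\<^sub>R (c n + c m)) < e"
proof -
  have dec: "K m \<subseteq> K n" if "n \<le> m" for n m
    using K(3) that by (rule lift_Suc_antimono_le)
  have bdd: "bdd_below (J ` K n)" for n
    using J dec[of 0 n] by (intro bdd_belowI2[of _ 0]) auto
  define j where "j n = Inf (J ` K n)" for n
  have j_le: "j n \<le> J c" if "c \<in> K n" for n c
    unfolding j_def using bdd that by (rule cINF_lower)
  have "\<exists>c\<in>K n. J c < j n + 1 / Suc n" for n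
    using cInf_lessD[of "J ` K n" "j n + 1 / Suc n"] K(2)[of n] by (auto simp: j_def)
  then obtain c where c: "\<And>n. c n \<in> K n" "\<And>n. J (c n) < j n + 1 / Suc n" by metis
  have "incseq j"
    unfolding incseq_def j_def using dec K(2) bdd by (auto intro!: cInf_superset_mono)
  moreover have "j n \<le> C" for n
    using j_le[OF c(1)[of n]] J[of "c n"] c(1)[of n] dec[of 0 n] by auto
  ultimately obtain l where l: "j \<longlonglongrightarrow> l" "\<And>n. j n \<le> l"
    using incseq_convergent by metis
  have "\<exists>N. \<forall>n\<ge>N. \<forall>m\<ge>n. J (c n) + J (c m) - 2 * J ((1 / 2) *\<^sub>R (c n + c m)) < e" if e: "e > 0" for e
  proof -
    have "eventually (\<lambda>n. l - e / 4 < j n) sequentially"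
      by (rule order_tendstoD(1)[OF l(1)]) (use e in simp)
    moreover have "eventually (\<lambda>n. inverse (real (Suc n)) < e / 4) sequentially"
      by (rule order_tendstoD(2)[OF LIMSEQ_inverse_real_of_nat]) (use e in simp)
    ultimately have "eventually (\<lambda>n. l - e / 4 < j n \<and> inverse (real (Suc n)) < e / 4) sequentially"
      by (rule eventually_conj)
    then obtain N where N: "\<And>n. n \<ge> N \<Longrightarrow> l - e / 4 < j n \<and> inverse (real (Suc n)) < e / 4"
      by (auto simp: eventually_sequentially)
    show ?thesis
    proof (intro exI[of _ N] allI impI)
      fix n m assume nm: "N \<le> n" "n \<le> m"
      have "(1 / 2) *\<^sub>R c n + (1 / 2) *\<^sub>R c m \<in> K n"
        using dec[OF nm(2)] c(1) by (intro convexD[OF K(1)]) auto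
      then have "j n \<le> J ((1 / 2) *\<^sub>R (c n + c m))"
        by (intro j_le) (simp add: scaleR_add_right)
      moreover have "J (c n) < j n + inverse (real (Suc n))" "J (c m) < j m + inverse (real (Suc m))"
        using c(2) by (simp_all add: inverse_eq_divide)
      moreover have "inverse (real (Suc n)) < e / 4" "inverse (real (Suc m)) < e / 4" "l - e / 4 < j n"
        using N[of n] N[of m] nm by auto
      ultimately show "J (c n) + J (c m) - 2 * J ((1 / 2) *\<^sub>R (c n + c m)) < e"
        using l(2)[of m] e by linarith
    qed
  qed
  then show thesis using that c(1) by blast
qed

text \<open>The midpoint defect in the hypothesis is the integral of the squared difference of
  \<open>exp (- a n t / 2)\<close> and \<open>exp (- a m t / 2)\<close>. So these functions are
  Cauchy in L^2, hence in L^1, which is complete.\<close>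

lemma L1_Cauchy_exp:
  fixes a :: "nat \<Rightarrow> real \<Rightarrow> real"
  assumes i: "\<And>n. integrable lebesgue01 (a n)" and nn: "\<And>n. AE t in lebesgue01. 0 \<le> a n t"
    and C: "\<And>e. e > 0 \<Longrightarrow> \<exists>N. \<forall>n\<ge>N. \<forall>m\<ge>n. (\<integral>t. exp (- a n t) \<partial>lebesgue01) +
      (\<integral>t. exp (- a m t) \<partial>lebesgue01) - 2 * (\<integral>t. exp (- (a n t + a m t) / 2) \<partial>lebesgue01) < e"
  obtains h where "integrable lebesgue01 h"
    "(\<lambda>n. \<integral>t. \<bar>exp (- a n t / 2) - h t\<bar> \<partial>lebesgue01) \<longlonglongrightarrow> 0"
proof -
  interpret finite_measure lebesgue01 by (rule finite_measure_lebesgue01)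
  have int: "integrable lebesgue01 (\<lambda>t. exp (- g t))"
    if "integrable lebesgue01 g" "AE t in lebesgue01. 0 \<le> g t" for g :: "real \<Rightarrow> real"
    by (rule integrable_const_bound[of _ 1]) (use that in auto)
  have ig: "integrable lebesgue01 (\<lambda>t. exp (- a n t))" for n using int i nn by auto
  have ih: "integrable lebesgue01 (\<lambda>t. exp (- a n t / 2))" for n
    using int[of "\<lambda>t. a n t / 2"] i nn[of n] by auto
  have im: "integrable lebesgue01 (\<lambda>t. exp (- (a n t + a m t) / 2))" for n m
  proof -
    have "AE t in lebesgue01. 0 \<le> (a n t + a m t) / 2"
      using nn[of n] nn[of m] by eventually_elim simp
    then have "integrable lebesgue01 (\<lambda>t. exp (- ((a n t + a m t) / 2)))"
      using i by (intro int) auto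
    then show ?thesis by (simp only: minus_divide_left)
  qed
  have sq: "(exp (- a n t / 2) - exp (- a m t / 2))\<^sup>2 =
      exp (- a n t) + exp (- a m t) - 2 * exp (- (a n t + a m t) / 2)" for n m t
  proof -
    have "(exp (- a n t / 2))\<^sup>2 = exp (- a n t)" "(exp (- a m t / 2))\<^sup>2 = exp (- a m t)"
      "exp (- a n t / 2) * exp (- a m t / 2) = exp (- (a n t + a m t) / 2)"
      by (simp_all add: exp_double[symmetric] flip: exp_add)
    then show ?thesis by (simp add: power2_diff)
  qed
  have small: "(\<integral>t. \<bar>exp (- a n t / 2) - exp (- a m t / 2)\<bar> \<partial>lebesgue01) \<le> e"
    if e: "e > 0" and le: "(\<integral>t. exp (- a n t) \<partial>lebesgue01) + (\<integral>t. exp (- a m t) \<partial>lebesgue01) -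
      2 * (\<integral>t. exp (- (a n t + a m t) / 2) \<partial>lebesgue01) < e\<^sup>2" for n m e
  proof -
    let ?d = "\<lambda>t. exp (- a n t / 2) - exp (- a m t / 2)"
    have "integrable lebesgue01 (\<lambda>t. (?d t)\<^sup>2)" unfolding sq using ig im by simp
    moreover have "(\<integral>t. (?d t)\<^sup>2 \<partial>lebesgue01) < e\<^sup>2" unfolding sq using ig im le by simp
    \<comment> \<open>Integrating \<open>2 * e * y \<le> y\<^sup>2 + e\<^sup>2\<close> over a space
      of total mass one takes the place of Cauchy-Schwarz.\<close>
    moreover have "(\<integral>t. 2 * e * \<bar>?d t\<bar> \<partial>lebesgue01) \<le> (\<integral>t. (?d t)\<^sup>2 + e\<^sup>2 \<partial>lebesgue01)"
    proof (rule integral_mono)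
      show "integrable lebesgue01 (\<lambda>t. 2 * e * \<bar>?d t\<bar>)" using ih by simp
      show "integrable lebesgue01 (\<lambda>t. (?d t)\<^sup>2 + e\<^sup>2)" using \<open>integrable lebesgue01 (\<lambda>t. (?d t)\<^sup>2)\<close> by simp
      show "2 * e * \<bar>?d t\<bar> \<le> (?d t)\<^sup>2 + e\<^sup>2" for t
        using sum_squares_bound[of "\<bar>?d t\<bar>" e] by (simp add: algebra_simps)
    qed
    ultimately have "2 * e * (\<integral>t. \<bar>?d t\<bar> \<partial>lebesgue01) \<le> 2 * e * e"
      by (simp add: measure_lebesgue01 power2_eq_square)
    then show ?thesis using e by simp
  qed
  define A where "A n = abs_L1_unit_interval (\<lambda>t. exp (- a n t / 2))" for n
  have "Cauchy A"
  proof (rule metric_CauchyI)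
    fix e :: real assume e: "e > 0"
    obtain N where N: "\<And>n m. n \<ge> N \<Longrightarrow> m \<ge> n \<Longrightarrow> (\<integral>t. exp (- a n t) \<partial>lebesgue01) +
      (\<integral>t. exp (- a m t) \<partial>lebesgue01) - 2 * (\<integral>t. exp (- (a n t + a m t) / 2) \<partial>lebesgue01) < (e / 2)\<^sup>2"
      using C[of "(e / 2)\<^sup>2"] e by auto
    have d: "dist (A n) (A m) < e" if "n \<ge> N" "m \<ge> n" for n m
    proof -
      have "dist (A n) (A m) = (\<integral>t. \<bar>exp (- a n t / 2) - exp (- a m t / 2)\<bar> \<partial>lebesgue01)"
        unfolding dist_norm A_def using ih by (intro norm_diff_abs_L1)
      also have "\<dots> \<le> e / 2" using e N[OF that] by (intro small) auto
      finally show ?thesis using e by simp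
    qed
    show "\<exists>M. \<forall>m\<ge>M. \<forall>n\<ge>M. dist (A m) (A n) < e"
      using d by (metis dist_commute linorder_le_cases)
  qed
  then obtain H where H: "A \<longlonglongrightarrow> H" using Cauchy_convergent convergent_def by blast
  let ?h = "rep_L1_unit_interval H"
  have "norm (A n - H) = (\<integral>t. \<bar>exp (- a n t / 2) - ?h t\<bar> \<partial>lebesgue01)" for n
    using norm_diff_abs_L1[OF ih integrable_rep_L1[of H]] by (simp add: A_def abs_rep_L1)
  moreover have "(\<lambda>n. norm (A n - H)) \<longlonglongrightarrow> 0" using H by (simp add: LIM_zero tendsto_norm_zero)
  ultimately show thesis by (intro that[of ?h] integrable_rep_L1) simp
qed

text \<open>
  Near-minimisers \<open>(u\<^sub>n, v\<^sub>n)\<close> of \<open>\<integral>exp (- u) + exp (- v)\<close> over convex combinations of the positive and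
  negative parts of \<open>\<xi>\<^sub>n, \<xi>\<^sub>n\<^sub>+\<^sub>1, \<dots>\<close> converge almost everywhere along a subsequence, by strict
  convexity. For almost everywhere convergence the Brezis-Lieb identity gives the asymptotic centre.
\<close>

lemma L1_asymptotic_centres: "asymptotic_centres TYPE(L1_unit_interval)"
  unfolding asymptotic_centres_def
proof (intro allI impI)
  fix \<xi> :: "nat \<Rightarrow> L1_unit_interval"
  assume "bounded (range \<xi>)"
  then obtain R where R: "\<And>n. norm (\<xi> n) \<le> R" by (auto simp: bounded_iff)
  let ?r = rep_L1_unit_interval
  interpret finite_measure lebesgue01 by (rule finite_measure_lebesgue01)
  define pos where "pos n = abs_L1_unit_interval (\<lambda>t. max (?r (\<xi> n) t) 0)" for n
  define neg where "neg n = abs_L1_unit_interval (\<lambda>t. max (- ?r (\<xi> n) t) 0)" for n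
  have ip: "integrable lebesgue01 (\<lambda>t. max (?r (\<xi> n) t) 0)"
    and im: "integrable lebesgue01 (\<lambda>t. max (- ?r (\<xi> n) t) 0)" for n
    using integrable_rep_L1[of "\<xi> n"] by auto
  have pn: "pos n - neg n = \<xi> n" for n
  proof -
    have "pos n - neg n = abs_L1_unit_interval (\<lambda>t. max (?r (\<xi> n) t) 0 - max (- ?r (\<xi> n) t) 0)"
      unfolding pos_def neg_def
      by (rule minus_L1_unit_interval.abs_eq[OF integrable_L1_rel[OF ip] integrable_L1_rel[OF im]])
    also have "(\<lambda>t. max (?r (\<xi> n) t) 0 - max (- ?r (\<xi> n) t) 0) = ?r (\<xi> n)"
      by (auto simp: max_def)
    finally show ?thesis by (simp add: abs_rep_L1)
  qed
  define P where "P = {u. (AE t in lebesgue01. 0 \<le> ?r u t) \<and> norm u \<le> R}"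
  have "convex P"
  proof (rule convexI)
    fix u v and a b :: real assume uv: "u \<in> P" "v \<in> P" and ab: "0 \<le> a" "0 \<le> b" "a + b = 1"
    have "AE t in lebesgue01. ?r (a *\<^sub>R u + b *\<^sub>R v) t = a * ?r u t + b * ?r v t"
      using rep_L1_add_AE[of "a *\<^sub>R u" "b *\<^sub>R v"] rep_L1_scaleR_AE[of a u] rep_L1_scaleR_AE[of b v]
      by eventually_elim simp
    moreover have "AE t in lebesgue01. 0 \<le> ?r u t" "AE t in lebesgue01. 0 \<le> ?r v t"
      using uv by (auto simp: P_def)
    ultimately have "AE t in lebesgue01. 0 \<le> ?r (a *\<^sub>R u + b *\<^sub>R v) t"
      by eventually_elim (use ab in simp)
    moreover have "a *\<^sub>R u + b *\<^sub>R v \<in> cball 0 R"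
      using uv ab by (intro convexD[OF convex_cball]) (auto simp: P_def)
    ultimately show "a *\<^sub>R u + b *\<^sub>R v \<in> P" by (simp add: P_def)
  qed
  have posP: "pos n \<in> P" for n
  proof -
    have "norm (pos n) = (\<integral>t. \<bar>max (?r (\<xi> n) t) 0\<bar> \<partial>lebesgue01)"
      unfolding pos_def by (rule norm_L1_unit_interval.abs_eq[OF integrable_L1_rel[OF ip]])
    also have "\<dots> \<le> (\<integral>t. \<bar>?r (\<xi> n) t\<bar> \<partial>lebesgue01)"
      using ip integrable_rep_L1[of "\<xi> n"] by (intro integral_mono) auto
    also have "\<dots> \<le> R" using R[of n] by (simp add: norm_L1)
    finally show ?thesis
      using rep_abs_L1[OF ip[of n]] unfolding P_def pos_def[symmetric] by auto
  qed
  have negP: "neg n \<in> P" for n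
  proof -
    have "norm (neg n) = (\<integral>t. \<bar>max (- ?r (\<xi> n) t) 0\<bar> \<partial>lebesgue01)"
      unfolding neg_def by (rule norm_L1_unit_interval.abs_eq[OF integrable_L1_rel[OF im]])
    also have "\<dots> \<le> (\<integral>t. \<bar>?r (\<xi> n) t\<bar> \<partial>lebesgue01)"
      using im integrable_rep_L1[of "\<xi> n"] by (intro integral_mono) auto
    also have "\<dots> \<le> R" using R[of n] by (simp add: norm_L1)
    finally show ?thesis
      using rep_abs_L1[OF im[of n]] unfolding P_def neg_def[symmetric] by auto
  qed
  \<comment> \<open>Pairs force the same convex coefficients on the positive and the negative parts,
    so the difference of the two components stays in the convex hull of the
    \<open>\<xi> i\<close>.\<close>
  define K where "K n = convex hull ((\<lambda>i. (pos i, neg i)) ` {n..})" for n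
  have KP: "K n \<subseteq> P \<times> P" for n
    unfolding K_def using posP negP \<open>convex P\<close> by (intro hull_minimal) (auto intro: convex_Times)
  let ?I = "\<lambda>u. \<integral>t. exp (- ?r u t) \<partial>lebesgue01"
  have I_int: "integrable lebesgue01 (\<lambda>t. exp (- ?r u t))" if "u \<in> P" for u
    by (rule integrable_const_bound[of _ 1])
       (use that integrable_rep_L1[of u] in \<open>auto simp: P_def\<close>)
  have I_le: "?I u \<le> 1" if "u \<in> P" for u
  proof -
    have "?I u \<le> (\<integral>t. 1 \<partial>lebesgue01)"
      using I_int[OF that] that by (intro integral_mono_AE) (auto simp: P_def)
    then show ?thesis by (simp add: measure_lebesgue01)
  qed
  have I_mid: "?I ((1 / 2) *\<^sub>R (u + v)) = (\<integral>t. exp (- (?r u t + ?r v t) / 2) \<partial>lebesgue01)" for u v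
  proof (rule integral_cong_AE)
    show "AE t in lebesgue01. exp (- ?r ((1 / 2) *\<^sub>R (u + v)) t) = exp (- (?r u t + ?r v t) / 2)"
      using rep_L1_scaleR_AE[of "1 / 2" "u + v"] rep_L1_add_AE[of u v] by eventually_elim simp
  qed (use borel_measurable_integrable[OF integrable_rep_L1] in measurable)
  let ?D = "\<lambda>u v. ?I u + ?I v - 2 * (\<integral>t. exp (- (?r u t + ?r v t) / 2) \<partial>lebesgue01)"
  \<comment> \<open>The inequality between arithmetic and geometric means. With it a small sum
    \<open>?D (u n) (u m) + ?D (v n) (v m)\<close> makes each summand small.\<close>
  have D_nonneg: "0 \<le> ?D u v" if "u \<in> P" "v \<in> P" for u v
  proof -
    have mid: "(1 / 2) *\<^sub>R (u + v) \<in> P"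
      using convexD[OF \<open>convex P\<close> that, of "1/2" "1/2"] by (simp add: scaleR_add_right)
    have "AE t in lebesgue01. 2 * exp (- ?r ((1 / 2) *\<^sub>R (u + v)) t) \<le> exp (- ?r u t) + exp (- ?r v t)"
      using rep_L1_scaleR_AE[of "1 / 2" "u + v"] rep_L1_add_AE[of u v]
    proof eventually_elim
      case (elim t)
      have "2 * (exp (- ?r u t / 2) * exp (- ?r v t / 2)) \<le> (exp (- ?r u t / 2))\<^sup>2 + (exp (- ?r v t / 2))\<^sup>2"
        using sum_squares_bound[of "exp (- ?r u t / 2)" "exp (- ?r v t / 2)"] by (simp add: mult.assoc)
      then show ?case
        by (simp add: elim exp_double[symmetric] add_divide_distrib diff_divide_distrib flip: exp_add)
    qed
    then have "(\<integral>t. 2 * exp (- ?r ((1 / 2) *\<^sub>R (u + v)) t) \<partial>lebesgue01) \<le>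
        (\<integral>t. exp (- ?r u t) + exp (- ?r v t) \<partial>lebesgue01)"
      using I_int[OF mid] I_int[OF that(1)] I_int[OF that(2)] by (intro integral_mono_AE) auto
    then show ?thesis
      unfolding I_mid[symmetric] using I_int[OF that(1)] I_int[OF that(2)] by simp
  qed
  define J where "J c = ?I (fst c) + ?I (snd c)" for c
  have J_bounds: "0 \<le> J c \<and> J c \<le> 2" if "c \<in> K 0" for c
    using KP[of 0] that I_le[of "fst c"] I_le[of "snd c"] unfolding J_def
    by (auto intro!: add_nonneg_nonneg)
  obtain c where c: "\<And>n. c n \<in> K n"
    "\<And>e. e > 0 \<Longrightarrow> \<exists>N. \<forall>n\<ge>N. \<forall>m\<ge>n. J (c n) + J (c m) - 2 * J ((1 / 2) *\<^sub>R (c n + c m)) < e"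
  proof (rule convergent_convex_blocks[of K J 2])
    show "K (Suc n) \<subseteq> K n" for n unfolding K_def by (intro hull_mono image_mono) auto
  qed (use J_bounds in \<open>auto simp: K_def\<close>)
  define u where "u n = fst (c n)" for n
  define v where "v n = snd (c n)" for n
  have uP: "u n \<in> P" and vP: "v n \<in> P" for n
    using subsetD[OF KP c(1)[of n]] by (simp_all add: u_def v_def mem_Times_iff)
  have D_sum: "J (c n) + J (c m) - 2 * J ((1 / 2) *\<^sub>R (c n + c m)) = ?D (u n) (u m) + ?D (v n) (v m)" for n m
    by (simp add: J_def u_def v_def I_mid)
  have Du: "\<exists>N. \<forall>n\<ge>N. \<forall>m\<ge>n. ?D (u n) (u m) < e" if e: "e > 0" for e
  proof -
    obtain N where N: "\<forall>n\<ge>N. \<forall>m\<ge>n. ?D (u n) (u m) + ?D (v n) (v m) < e"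
      using c(2)[OF e] unfolding D_sum by blast
    show ?thesis
    proof (intro exI[of _ N] allI impI)
      fix n m assume "N \<le> n" "n \<le> m"
      then show "?D (u n) (u m) < e" using N D_nonneg[OF vP vP, of n m] by fastforce
    qed
  qed
  have Dv: "\<exists>N. \<forall>n\<ge>N. \<forall>m\<ge>n. ?D (v n) (v m) < e" if e: "e > 0" for e
  proof -
    obtain N where N: "\<forall>n\<ge>N. \<forall>m\<ge>n. ?D (u n) (u m) + ?D (v n) (v m) < e"
      using c(2)[OF e] unfolding D_sum by blast
    show ?thesis
    proof (intro exI[of _ N] allI impI)
      fix n m assume "N \<le> n" "n \<le> m"
      then show "?D (v n) (v m) < e" using N D_nonneg[OF uP uP, of n m] by fastforce
    qed
  qed
  have nn: "AE t in lebesgue01. 0 \<le> ?r (u n) t" "AE t in lebesgue01. 0 \<le> ?r (v n) t" for n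
    using uP[of n] vP[of n] by (auto simp: P_def)
  obtain h where h: "integrable lebesgue01 h"
      "(\<lambda>n. \<integral>t. \<bar>exp (- ?r (u n) t / 2) - h t\<bar> \<partial>lebesgue01) \<longlonglongrightarrow> 0"
    using L1_Cauchy_exp[of "\<lambda>n. ?r (u n)", OF integrable_rep_L1 nn(1) Du] by blast
  obtain h' where h': "integrable lebesgue01 h'"
      "(\<lambda>n. \<integral>t. \<bar>exp (- ?r (v n) t / 2) - h' t\<bar> \<partial>lebesgue01) \<longlonglongrightarrow> 0"
    using L1_Cauchy_exp[of "\<lambda>n. ?r (v n)", OF integrable_rep_L1 nn(2) Dv] by blast
  have half: "integrable lebesgue01 (\<lambda>t. exp (- ?r w t / 2))" if "w \<in> P" for w
    by (rule integrable_const_bound[of _ 1])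
       (use that integrable_rep_L1[of w] in \<open>auto simp: P_def\<close>)
  \<comment> \<open>Adding both errors yields a single subsequence along which both exponentials
    converge almost everywhere.\<close>
  define G where "G n t = \<bar>exp (- ?r (u n) t / 2) - h t\<bar> + \<bar>exp (- ?r (v n) t / 2) - h' t\<bar>" for n t
  have iG: "integrable lebesgue01 (G n)" for n
    unfolding G_def using half[OF uP] half[OF vP] h(1) h'(1) by simp
  have "(\<integral>t. norm (G n t) \<partial>lebesgue01) = (\<integral>t. \<bar>exp (- ?r (u n) t / 2) - h t\<bar> \<partial>lebesgue01) +
      (\<integral>t. \<bar>exp (- ?r (v n) t / 2) - h' t\<bar> \<partial>lebesgue01)" for n
    unfolding G_def using half[OF uP] half[OF vP] h(1) h'(1) by simp
  then have "(\<lambda>n. \<integral>t. norm (G n t) \<partial>lebesgue01) \<longlonglongrightarrow> 0"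
    using tendsto_add[OF h(2) h'(2)] by simp
  then obtain r where r: "strict_mono r" "AE t in lebesgue01. (\<lambda>n. G (r n) t) \<longlonglongrightarrow> 0"
    using tendsto_L1_AE_subseq[of lebesgue01 G, OF iG] by blast
  have lu: "AE t in lebesgue01. (\<lambda>k. exp (- ?r (u (r k)) t / 2)) \<longlonglongrightarrow> h t"
    using r(2)
  proof eventually_elim
    case (elim t)
    then have "(\<lambda>k. exp (- ?r (u (r k)) t / 2) - h t) \<longlonglongrightarrow> 0"
      by (rule Lim_null_comparison[rotated]) (auto simp: G_def)
    then show ?case by (simp add: LIM_zero_iff)
  qed
  have lv: "AE t in lebesgue01. (\<lambda>k. exp (- ?r (v (r k)) t / 2)) \<longlonglongrightarrow> h' t"
    using r(2)
  proof eventually_elim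
    case (elim t)
    then have "(\<lambda>k. exp (- ?r (v (r k)) t / 2) - h' t) \<longlonglongrightarrow> 0"
      by (rule Lim_null_comparison[rotated]) (auto simp: G_def)
    then show ?case by (simp add: LIM_zero_iff)
  qed
  have int_le: "(\<integral>t. ?r w t \<partial>lebesgue01) \<le> R" if "w \<in> P" for w
  proof -
    have "(\<integral>t. ?r w t \<partial>lebesgue01) \<le> (\<integral>t. \<bar>?r w t\<bar> \<partial>lebesgue01)"
      using integrable_rep_L1[of w] by (intro integral_mono) auto
    then show ?thesis using that by (simp add: P_def norm_L1)
  qed
  obtain a where a: "integrable lebesgue01 a" "AE t in lebesgue01. (\<lambda>k. ?r (u (r k)) t) \<longlonglongrightarrow> a t"
    using exp_convergent_Fatou[of lebesgue01 "\<lambda>k. ?r (u (r k))" R h, OF integrable_rep_L1 nn(1)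
        int_le[OF uP] borel_measurable_integrable[OF h(1)] lu] by blast
  obtain b where b: "integrable lebesgue01 b" "AE t in lebesgue01. (\<lambda>k. ?r (v (r k)) t) \<longlonglongrightarrow> b t"
    using exp_convergent_Fatou[of lebesgue01 "\<lambda>k. ?r (v (r k))" R h', OF integrable_rep_L1 nn(2)
        int_le[OF vP] borel_measurable_integrable[OF h'(1)] lv] by blast
  define \<zeta> where "\<zeta> k = u (r k) - v (r k)" for k
  define x where "x = abs_L1_unit_interval (\<lambda>t. a t - b t)"
  have "\<zeta> k \<in> convex hull (\<xi> ` {k..})" for k
  proof -
    have lin: "linear (\<lambda>c :: L1_unit_interval \<times> L1_unit_interval. fst c - snd c)"
      by (rule linearI) (auto simp: scaleR_diff_right)
    have "\<zeta> k \<in> (\<lambda>c. fst c - snd c) ` K (r k)"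
      unfolding \<zeta>_def u_def v_def using c(1)[of "r k"] by blast
    also have "\<dots> = convex hull (\<xi> ` {r k..})"
      unfolding K_def convex_hull_linear_image[OF lin] image_image by (simp add: pn)
    also have "\<dots> \<subseteq> convex hull (\<xi> ` {k..})"
      using strict_mono_imp_increasing[OF r(1), of k] by (intro hull_mono image_mono) auto
    finally show ?thesis .
  qed
  moreover have "(\<lambda>n. norm (\<eta> - \<zeta> n) - norm (x - \<zeta> n)) \<longlonglongrightarrow> norm (\<eta> - x)" for \<eta>
  proof -
    have i_ab: "integrable lebesgue01 (\<lambda>t. a t - b t)" using a(1) b(1) by simp
    define z where "z n t = ?r (u (r n)) t - ?r (v (r n)) t" for n t
    have iz: "integrable lebesgue01 (z n)" for n
      unfolding z_def using integrable_rep_L1 by simp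
    have \<zeta>_eq: "\<zeta> n = abs_L1_unit_interval (z n)" for n
      using minus_L1_unit_interval.abs_eq[OF integrable_L1_rel integrable_L1_rel, OF integrable_rep_L1 integrable_rep_L1, of "u (r n)" "v (r n)"]
      by (simp add: abs_rep_L1 \<zeta>_def z_def[abs_def])
    have n1: "norm (\<eta> - \<zeta> n) = (\<integral>t. \<bar>?r \<eta> t - z n t\<bar> \<partial>lebesgue01)" for n
      using norm_diff_abs_L1[OF integrable_rep_L1[of \<eta>] iz[of n]] by (simp add: \<zeta>_eq abs_rep_L1)
    have n2: "norm (x - \<zeta> n) = (\<integral>t. \<bar>a t - b t - z n t\<bar> \<partial>lebesgue01)" for n
      unfolding x_def \<zeta>_eq by (rule norm_diff_abs_L1[OF i_ab iz])
    have n3: "norm (\<eta> - x) = (\<integral>t. \<bar>?r \<eta> t - (a t - b t)\<bar> \<partial>lebesgue01)"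
      using norm_diff_abs_L1[OF integrable_rep_L1[of \<eta>] i_ab] by (simp add: x_def abs_rep_L1)
    have i1: "integrable lebesgue01 (\<lambda>t. \<bar>?r \<eta> t - z n t\<bar>)"
      and i2: "integrable lebesgue01 (\<lambda>t. \<bar>a t - b t - z n t\<bar>)"
      and i3: "integrable lebesgue01 (\<lambda>t. \<bar>?r \<eta> t - (a t - b t)\<bar>)" for n
      using integrable_rep_L1[of \<eta>] iz[of n] i_ab by auto
    \<comment> \<open>Brezis-Lieb by dominated convergence: the difference of the two moduli is
      bounded by \<open>\<bar>?r \<eta> t - (a t - b t)\<bar>\<close>, although the
      \<open>z n\<close> themselves may have no integrable majorant.\<close>
    have "(\<lambda>n. \<integral>t. \<bar>?r \<eta> t - z n t\<bar> - \<bar>a t - b t - z n t\<bar> \<partial>lebesgue01)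
        \<longlonglongrightarrow> (\<integral>t. \<bar>?r \<eta> t - (a t - b t)\<bar> \<partial>lebesgue01)"
    proof (rule integral_dominated_convergence[where w = "\<lambda>t. \<bar>?r \<eta> t - (a t - b t)\<bar>"])
      show "AE t in lebesgue01. (\<lambda>n. \<bar>?r \<eta> t - z n t\<bar> - \<bar>a t - b t - z n t\<bar>) \<longlonglongrightarrow> \<bar>?r \<eta> t - (a t - b t)\<bar>"
        using a(2) b(2)
      proof eventually_elim
        case (elim t)
        then have "(\<lambda>n. z n t) \<longlonglongrightarrow> a t - b t" unfolding z_def by (rule tendsto_diff)
        then have "(\<lambda>n. \<bar>?r \<eta> t - z n t\<bar> - \<bar>a t - b t - z n t\<bar>) \<longlonglongrightarrow>
            \<bar>?r \<eta> t - (a t - b t)\<bar> - \<bar>a t - b t - (a t - b t)\<bar>"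
          by (intro tendsto_intros)
        then show ?case by simp
      qed
      show "AE t in lebesgue01. norm (\<bar>?r \<eta> t - z n t\<bar> - \<bar>a t - b t - z n t\<bar>) \<le> \<bar>?r \<eta> t - (a t - b t)\<bar>" for n
        by (intro AE_I2) (simp add: abs_if)
    qed (use i1 i2 i3 in auto)
    then show ?thesis unfolding n1 n2 n3 using i1 i2 by simp
  qed
  ultimately show "\<exists>\<zeta> x. (\<forall>n. \<zeta> n \<in> convex hull (\<xi> ` {n..})) \<and>
      (\<forall>\<eta>. (\<lambda>n. norm (\<eta> - \<zeta> n) - norm (x - \<zeta> n)) \<longlonglongrightarrow> norm (\<eta> - x))"
    by blast
qed

section \<open>Distances between tuples\<close>

definition count_le :: "nat list \<Rightarrow> nat \<Rightarrow> nat"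
  where "count_le p t = length (filter (\<lambda>n. n \<le> t) p)"

text \<open>Subtraction on \<open>nat\<close> is truncated: one summand vanishes and the other is
  the absolute difference.\<close>

definition count_gap :: "nat list \<Rightarrow> nat list \<Rightarrow> nat \<Rightarrow> nat"
  where "count_gap p q t = (count_le p t - count_le q t) + (count_le q t - count_le p t)"

text \<open>The counts ignore the order of a tuple; the maximum with \<open>1\<close> separates permuted tuples.\<close>

definition tuple_dist :: "nat list \<Rightarrow> nat list \<Rightarrow> nat"
  where "tuple_dist p q = (if p = q then 0 else max 1 (SUP t. count_gap p q t))"

lemma count_le_le_length: "count_le p t \<le> length p"
  by (simp add: count_le_def)

lemma count_gap_le_max: "count_gap p q t \<le> max (length p) (length q)"
  using count_le_le_length[of p t] count_le_le_length[of q t] by (auto simp: count_gap_def)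

lemma count_gap_le_SUP: "count_gap p q t \<le> (SUP t. count_gap p q t)"
  by (rule cSUP_upper) (auto intro!: bdd_aboveI2 count_gap_le_max)

lemma SUP_count_gap_le: "(\<And>t. count_gap p q t \<le> k) \<Longrightarrow> (SUP t. count_gap p q t) \<le> k"
  by (rule cSUP_least) auto

lemma tuple_dist_commute: "tuple_dist p q = tuple_dist q p"
proof -
  have "count_gap p q = count_gap q p" by (simp add: count_gap_def fun_eq_iff)
  then show ?thesis by (auto simp: tuple_dist_def)
qed

lemma tuple_dist_pos: "p \<noteq> q \<Longrightarrow> 1 \<le> tuple_dist p q"
  by (simp add: tuple_dist_def)

lemma tuple_dist_triangle: "tuple_dist p r \<le> tuple_dist p q + tuple_dist q r"
proof (cases "p = r \<or> p = q \<or> q = r")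
  case True
  then show ?thesis by (auto simp: tuple_dist_def)
next
  case False
  have "(SUP t. count_gap p r t) \<le> (SUP t. count_gap p q t) + (SUP t. count_gap q r t)"
  proof (rule SUP_count_gap_le)
    fix t
    have "count_gap p r t \<le> count_gap p q t + count_gap q r t" by (simp add: count_gap_def)
    then show "count_gap p r t \<le> (SUP t. count_gap p q t) + (SUP t. count_gap q r t)"
      using count_gap_le_SUP[of p q t] count_gap_le_SUP[of q r t] by linarith
  qed
  then show ?thesis using False by (auto simp: tuple_dist_def)
qed

lemma tuple_dist_le:
  assumes "length p = k" "length q = k" "1 \<le> k"
  shows "tuple_dist p q \<le> k"
  using SUP_count_gap_le[of p q k] count_gap_le_max[of p q] assms by (auto simp: tuple_dist_def)

text \<open>Interlaced entries alternate, so up to any threshold \<open>p\<close> is ahead of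
  \<open>q\<close> by at most one entry. The conjunct for \<open>s \<le> t\<close> strengthens the
  induction: up to the head of the second tuple the tails contribute nothing.\<close>

lemma interlaced_count_le:
  "interlaced t p q \<Longrightarrow> count_le q s \<le> count_le p s \<and> count_le p s \<le> count_le q s + 1 \<and>
    (s \<le> t \<longrightarrow> count_le p s = 0)"
  by (induction t p q rule: interlaced.induct) (fastforce simp: count_le_def)+

lemma tuple_dist_interlaced:
  assumes "interlaced t p q" "p \<noteq> []"
  shows "tuple_dist p q = 1"
proof -
  have "p \<noteq> q" using assms by (cases "(t, p, q)" rule: interlaced.cases) auto
  moreover have "(SUP t. count_gap p q t) \<le> 1"
  proof (rule SUP_count_gap_le)
    fix s show "count_gap p q s \<le> 1"
      using interlaced_count_le[OF assms(1), of s] by (auto simp: count_gap_def)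
  qed
  ultimately show ?thesis by (simp add: tuple_dist_def)
qed

lemma tuple_dist_separated:
  assumes "length p = k" "length q = k" "1 \<le> k" and less: "\<forall>n\<in>set p. \<forall>m\<in>set q. n < m"
  shows "tuple_dist p q = k"
proof (rule antisym[OF tuple_dist_le[OF assms(1-3)]])
  \<comment> \<open>This threshold counts all entries of \<open>p\<close> and none of
    \<open>q\<close>.\<close>
  define t where "t = Max (set p)"
  have ne: "set p \<noteq> {}" using assms(1,3) by auto
  have "filter (\<lambda>n. n \<le> t) p = p" by (auto simp: t_def intro: filter_True)
  moreover have "\<forall>m\<in>set q. t < m" using less ne by (auto simp: t_def)
  then have "filter (\<lambda>n. n \<le> t) q = []" by (auto simp: filter_empty_conv)
  ultimately have "count_gap p q t = k" using assms(1) by (simp add: count_gap_def count_le_def)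
  moreover have "p \<noteq> q" using less ne by (metis ex_in_conv less_irrefl)
  ultimately show "k \<le> tuple_dist p q" using count_gap_le_SUP[of p q t] by (simp add: tuple_dist_def)
qed

section \<open>Isometries of the rational Urysohn space\<close>

locale urysohn_space =
  fixes M :: "'a set" and d :: "'a \<Rightarrow> 'a \<Rightarrow> real"
  assumes urysohn: "rational_Urysohn M d"
begin

abbreviation Iso :: "('a \<Rightarrow> 'a) monoid" where "Iso \<equiv> isometry_group M d"

sublocale Iso: group Iso
  by (rule group_isometry_group)

sublocale Metric_space M d
  using urysohn by (simp add: rational_Urysohn_def rational_metric_space_def)

lemma dist_rational: "x \<in> M \<Longrightarrow> y \<in> M \<Longrightarrow> d x y \<in> \<rat>"
  using urysohn by (auto simp: rational_Urysohn_def rational_metric_space_def)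

lemma carrier_Iso: "carrier Iso = isometries M d"
  by (simp add: isometry_group_def)

lemma Iso_closed: "g \<in> carrier Iso \<Longrightarrow> x \<in> M \<Longrightarrow> g x \<in> M"
  unfolding carrier_Iso isometries_def by (auto dest: Bij_imp_funcset)

lemma Iso_dist: "g \<in> carrier Iso \<Longrightarrow> x \<in> M \<Longrightarrow> y \<in> M \<Longrightarrow> d (g x) (g y) = d x y"
  unfolding carrier_Iso isometries_def distance_preserving_on_def by auto

lemma Iso_mult_apply:
  assumes "g \<in> carrier Iso" "h \<in> carrier Iso" "x \<in> M"
  shows "(g \<otimes>\<^bsub>Iso\<^esub> h) x = g (h x)"
  using assms unfolding carrier_Iso isometries_def
  by (simp add: isometry_group_def BijGroup_def compose_eq)

lemma Iso_one_apply: "x \<in> M \<Longrightarrow> \<one>\<^bsub>Iso\<^esub> x = x"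
  by (simp add: isometry_group_def BijGroup_def)

lemma Iso_inv_apply:
  assumes "g \<in> carrier Iso" "x \<in> M"
  shows "(inv\<^bsub>Iso\<^esub> g) (g x) = x"
  using Iso_mult_apply[of "inv\<^bsub>Iso\<^esub> g" g x] assms by (simp add: Iso_one_apply)

text \<open>The extension property for indexed families: a repetition in \<open>x\<close> forces one
  in \<open>y\<close>, as the distance is then \<open>0\<close>, so sending \<open>x i\<close> to
  \<open>y i\<close> is well defined.\<close>

lemma homogeneous:
  fixes x y :: "'j \<Rightarrow> 'a"
  assumes J: "finite J" and x: "x ` J \<subseteq> M" and y: "y ` J \<subseteq> M"
    and eq: "\<And>i j. i \<in> J \<Longrightarrow> j \<in> J \<Longrightarrow> d (x i) (x j) = d (y i) (y j)"
  obtains k where "k \<in> carrier Iso" "\<And>i. i \<in> J \<Longrightarrow> k (x i) = y i"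
proof -
  define f where "f z = y (SOME i. i \<in> J \<and> x i = z)" for z
  have f: "f (x i) = y i" if i: "i \<in> J" for i
  proof -
    let ?i = "SOME j. j \<in> J \<and> x j = x i"
    have "?i \<in> J \<and> x ?i = x i" by (rule someI[of _ i]) (simp add: i)
    then have "d (y ?i) (y i) = 0" and "?i \<in> J"
      using eq[of ?i i] i x by auto
    then show ?thesis unfolding f_def using y i by (subst (asm) zero) auto
  qed
  have "finite (x ` J) \<and> x ` J \<subseteq> M \<and> f \<in> x ` J \<rightarrow> M \<and> distance_preserving_on (x ` J) d d f"
    using J x y eq f by (auto simp: distance_preserving_on_def)
  moreover have "\<forall>A f. finite A \<and> A \<subseteq> M \<and> f \<in> A \<rightarrow> M \<and> distance_preserving_on A d d f \<longrightarrow>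
      (\<exists>g\<in>isometries M d. \<forall>x\<in>A. g x = f x)"
    using urysohn unfolding rational_Urysohn_def by (elim conjE)
  ultimately have "\<exists>g\<in>isometries M d. \<forall>z\<in>x ` J. g z = f z" by (elim allE impE)
  then obtain k where "k \<in> isometries M d" "\<forall>z\<in>x ` J. k z = f z" by blast
  then show thesis using that f by (simp add: carrier_Iso)
qed

text \<open>An enumeration of \<open>N\<close> transports its metric to a set of natural numbers,
  the form in which the embedding property is given.\<close>

lemma universal:
  fixes N :: "'n set"
  assumes "countable N" "rational_metric_space N e"
  obtains f where "f \<in> N \<rightarrow> M" "\<And>x y. x \<in> N \<Longrightarrow> y \<in> N \<Longrightarrow> d (f x) (f y) = e x y"
proof -
  let ?t = "to_nat_on N" and ?s = "from_nat_into N"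
  interpret N: Metric_space N e using assms(2) by (simp add: rational_metric_space_def)
  have st: "?s (?t x) = x" if "x \<in> N" for x using assms(1) that by simp
  have "rational_metric_space (?t ` N) (\<lambda>i j. e (?s i) (?s j))"
    unfolding rational_metric_space_def
  proof (intro conjI ballI)
    show "Metric_space (?t ` N) (\<lambda>i j. e (?s i) (?s j))"
      by unfold_locales (auto simp: st N.commute intro: N.triangle)
    fix i j assume "i \<in> ?t ` N" "j \<in> ?t ` N"
    then show "e (?s i) (?s j) \<in> \<rat>"
      using assms(2) by (auto simp: st rational_metric_space_def)
  qed
  moreover have "\<forall>(N :: nat set) e. rational_metric_space N e \<longrightarrow>
      (\<exists>f\<in>N \<rightarrow> M. distance_preserving_on N e d f)"
    using urysohn unfolding rational_Urysohn_def by (elim conjE)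
  ultimately have "\<exists>f\<in>?t ` N \<rightarrow> M. distance_preserving_on (?t ` N) (\<lambda>i j. e (?s i) (?s j)) d f"
    by (elim allE impE)
  then obtain f where "f \<in> ?t ` N \<rightarrow> M" "distance_preserving_on (?t ` N) (\<lambda>i j. e (?s i) (?s j)) d f"
    by blast
  then show thesis
    by (intro that[of "f \<circ> ?t"]) (auto simp: distance_preserving_on_def st)
qed

lemma finite_diameter:
  assumes "finite Q"
  obtains n :: nat where "1 \<le> n" "\<And>a b. a \<in> Q \<Longrightarrow> b \<in> Q \<Longrightarrow> d a b \<le> real n"
proof -
  have "finite ((\<lambda>(a, b). d a b) ` (Q \<times> Q))" using assms by simp
  then obtain C where "\<forall>z\<in>(\<lambda>(a, b). d a b) ` (Q \<times> Q). z \<le> C"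
    using bdd_above_finite unfolding bdd_above_def by blast
  then have C: "d a b \<le> C" if "a \<in> Q" "b \<in> Q" for a b using that by auto
  obtain n :: nat where "C \<le> real n" using real_arch_simple by blast
  then show thesis by (intro that[of "Suc n"]) (auto intro: order_trans[OF C])
qed

text \<open>Give \<open>UNIV \<times> A\<close> the metric \<open>d\<close> within a copy and the
  constant \<open>r * \<delta> i j\<close> between different copies. A detour through another copy
  has length at least \<open>2 * r\<close>, so the bound on the diameter of \<open>A\<close> secures
  the triangle inequality. Universality embeds this space, and homogeneity carries \<open>A\<close>
  onto each copy.\<close>

lemma spread_copies:
  fixes \<delta> :: "'i::countable \<Rightarrow> 'i \<Rightarrow> nat"
  assumes A: "finite A" "A \<subseteq> M" and r: "r \<in> \<rat>" "r > 0" "\<And>a b. a \<in> A \<Longrightarrow> b \<in> A \<Longrightarrow> d a b \<le> 2 * r"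
    and \<delta>: "\<And>i j. \<delta> i j = \<delta> j i" "\<And>i j. i \<noteq> j \<Longrightarrow> 1 \<le> \<delta> i j" "\<And>i j k. \<delta> i k \<le> \<delta> i j + \<delta> j k"
  shows "\<exists>g. (\<forall>i. g i \<in> carrier Iso) \<and>
    (\<forall>i j. \<forall>a\<in>A. \<forall>b\<in>A. i \<noteq> j \<longrightarrow> d (g i a) (g j b) = r * \<delta> i j)"
proof -
  define e where "e = (\<lambda>(i, a) (j, b). if i = j then d a b else r * real (\<delta> i j))"
  have r\<delta>: "r \<le> r * real (\<delta> i j)" if "i \<noteq> j" for i j
    using \<delta>(2)[OF that] r(2) by simp
  have "Metric_space (UNIV \<times> A) e"
  proof
    show "0 \<le> e x y" for x y using r(2) by (auto simp: e_def split: prod.splits)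
    show "e x y = e y x" for x y by (auto simp: e_def commute \<delta>(1) split: prod.splits)
    show "e x y = 0 \<longleftrightarrow> x = y" if xy: "x \<in> UNIV \<times> A" "y \<in> UNIV \<times> A" for x y
    proof -
      obtain i a j b where x: "x = (i, a)" "y = (j, b)" by (cases x, cases y) auto
      then have "a \<in> M" "b \<in> M" using xy A(2) by auto
      then show ?thesis using r(2) \<delta>(2)[of i j] unfolding x e_def by auto
    qed
    show "e x z \<le> e x y + e y z"
      if xyz: "x \<in> UNIV \<times> A" "y \<in> UNIV \<times> A" "z \<in> UNIV \<times> A" for x y z
    proof -
      obtain i a j b k c where x: "x = (i, a)" "y = (j, b)" "z = (k, c)"
        by (cases x, cases y, cases z) auto
      then have abc: "a \<in> A" "b \<in> A" "c \<in> A" using xyz by auto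
      then have tri: "d a c \<le> d a b + d b c" using A(2) by (intro triangle) auto
      have "r * real (\<delta> i k) \<le> r * real (\<delta> i j + \<delta> j k)"
        using r(2) \<delta>(3) by (intro mult_left_mono) (auto simp del: of_nat_add)
      then have "r * real (\<delta> i k) \<le> r * real (\<delta> i j) + r * real (\<delta> j k)"
        by (simp add: distrib_left)
      then show ?thesis
        using tri r(3)[OF abc(1,3)] r\<delta>[of i j] r\<delta>[of j k]
        unfolding x e_def by (auto simp: \<delta>(1))
    qed
  qed
  moreover have "e x y \<in> \<rat>" if "x \<in> UNIV \<times> A" "y \<in> UNIV \<times> A" for x y
    using that r(1) subsetD[OF A(2)] by (auto simp: e_def intro!: dist_rational)
  ultimately have "rational_metric_space (UNIV \<times> A) e"
    by (simp add: rational_metric_space_def)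
  moreover have "countable ((UNIV :: 'i set) \<times> A)" using A(1) by (simp add: countable_finite)
  ultimately obtain f where f: "f \<in> UNIV \<times> A \<rightarrow> M"
      "\<And>x y. x \<in> UNIV \<times> A \<Longrightarrow> y \<in> UNIV \<times> A \<Longrightarrow> d (f x) (f y) = e x y"
    using universal by metis
  have "\<exists>g\<in>carrier Iso. \<forall>a\<in>A. g a = f (i, a)" for i
  proof -
    have "(\<lambda>a. a) ` A \<subseteq> M" "(\<lambda>a. f (i, a)) ` A \<subseteq> M" using A(2) f(1) by auto
    moreover have "d a b = d (f (i, a)) (f (i, b))" if "a \<in> A" "b \<in> A" for a b
      using f(2) that by (simp add: e_def)
    ultimately show ?thesis using homogeneous[OF A(1), of "\<lambda>a. a" "\<lambda>a. f (i, a)"] by metis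
  qed
  then obtain g where g: "\<And>i. g i \<in> carrier Iso" "\<And>i a. a \<in> A \<Longrightarrow> g i a = f (i, a)" by metis
  have "d (g i a) (g j b) = r * real (\<delta> i j)" if "i \<noteq> j" "a \<in> A" "b \<in> A" for i j a b
    using that f(2)[of "(i, a)" "(j, b)"] g(2) by (simp add: e_def)
  then show ?thesis using g(1) by (intro exI[of _ g]) auto
qed

text \<open>Two copies of \<open>Q\<close> at distance \<open>r\<close>, moved back together so that
  the second becomes \<open>Q\<close> itself.\<close>

lemma far_copy:
  assumes Q: "finite Q" "Q \<subseteq> M" and r: "r \<in> \<rat>" "r > 0" "\<And>a b. a \<in> Q \<Longrightarrow> b \<in> Q \<Longrightarrow> d a b \<le> 2 * r"
  obtains g where "g \<in> carrier Iso" "\<And>a b. a \<in> Q \<Longrightarrow> b \<in> Q \<Longrightarrow> d (g a) b = r"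
proof -
  have "\<exists>g :: bool \<Rightarrow> 'a \<Rightarrow> 'a. (\<forall>i. g i \<in> carrier Iso) \<and> (\<forall>i j. \<forall>a\<in>Q. \<forall>b\<in>Q. i \<noteq> j \<longrightarrow>
      d (g i a) (g j b) = r * real (if i = j then 0 else 1))"
    by (rule spread_copies[OF Q r]) auto
  then obtain g :: "bool \<Rightarrow> 'a \<Rightarrow> 'a" where g1: "\<forall>i. g i \<in> carrier Iso"
    and g2: "\<forall>i j. \<forall>a\<in>Q. \<forall>b\<in>Q. i \<noteq> j \<longrightarrow> d (g i a) (g j b) = r * real (if i = j then 0 else 1)"
    by (elim exE conjE)
  have g: "g i \<in> carrier Iso" "\<And>a b. a \<in> Q \<Longrightarrow> b \<in> Q \<Longrightarrow> d (g True a) (g False b) = r" for i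
    using g1 g2[rule_format, of _ _ True False] by simp_all
  let ?h = "inv\<^bsub>Iso\<^esub> (g False) \<otimes>\<^bsub>Iso\<^esub> g True"
  show thesis
  proof (rule that[of ?h])
    show "?h \<in> carrier Iso" using g(1) by simp
    fix a b assume ab: "a \<in> Q" "b \<in> Q"
    then have abM: "a \<in> M" "b \<in> M" using Q(2) by auto
    then have "d (?h a) b = d ((inv\<^bsub>Iso\<^esub> (g False)) (g True a)) ((inv\<^bsub>Iso\<^esub> (g False)) (g False b))"
      using g(1) by (simp add: Iso_mult_apply Iso_inv_apply)
    also have "\<dots> = d (g True a) (g False b)"
      using Iso_dist[of "inv\<^bsub>Iso\<^esub> (g False)" "g True a" "g False b"]
        Iso_closed[OF g(1) abM(1)] Iso_closed[OF g(1) abM(2)] g(1) by simp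
    finally show "d (?h a) b = r" using g(2)[OF ab] by simp
  qed
qed

end

section \<open>Affine isometric actions\<close>

text \<open>The linear part and the cocycle are absorbed into \<open>act\<close>. Continuity is
  recorded at the identity only; isometry spreads it to the whole group in
  \<open>act_eq_on\<close>.\<close>

locale urysohn_affine_action = urysohn_space M d
  for M :: "'a set" and d :: "'a \<Rightarrow> 'a \<Rightarrow> real" +
  fixes act :: "('a \<Rightarrow> 'a) \<Rightarrow> 'e::real_normed_vector \<Rightarrow> 'e"
  assumes act_mult: "g \<in> carrier Iso \<Longrightarrow> h \<in> carrier Iso \<Longrightarrow> act (g \<otimes>\<^bsub>Iso\<^esub> h) \<xi> = act g (act h \<xi>)"
    and act_one: "act \<one>\<^bsub>Iso\<^esub> \<xi> = \<xi>"
    and act_isometric: "g \<in> carrier Iso \<Longrightarrow> norm (act g \<xi> - act g \<eta>) = norm (\<xi> - \<eta>)"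
    and act_affine: "g \<in> carrier Iso \<Longrightarrow> a + b = 1 \<Longrightarrow>
      act g (a *\<^sub>R \<xi> + b *\<^sub>R \<eta>) = a *\<^sub>R act g \<xi> + b *\<^sub>R act g \<eta>"
    and act_continuous: "\<epsilon> > 0 \<Longrightarrow>
      \<exists>A. finite A \<and> A \<subseteq> M \<and> (\<forall>v\<in>pointwise_stabiliser Iso A. norm (act v \<xi> - \<xi>) \<le> \<epsilon>)"
begin

lemma act_eq_on:
  assumes A: "A \<subseteq> M" "\<And>v. v \<in> pointwise_stabiliser Iso A \<Longrightarrow> norm (act v \<xi> - \<xi>) \<le> \<epsilon>"
    and g: "g \<in> carrier Iso" "h \<in> carrier Iso" "\<And>a. a \<in> A \<Longrightarrow> g a = h a"
  shows "norm (act g \<xi> - act h \<xi>) \<le> \<epsilon>"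
proof -
  let ?v = "inv\<^bsub>Iso\<^esub> h \<otimes>\<^bsub>Iso\<^esub> g"
  have "?v \<in> pointwise_stabiliser Iso A"
    using A(1) g by (auto simp: pointwise_stabiliser_def Iso_mult_apply Iso_inv_apply subset_iff)
  moreover have "h \<otimes>\<^bsub>Iso\<^esub> ?v = g" using g(1,2) by (simp add: Iso.m_assoc[symmetric])
  then have "act g \<xi> = act h (act ?v \<xi>)"
    using act_mult[of h ?v \<xi>] g(1,2) by simp
  ultimately show ?thesis using A(2)[of ?v] act_isometric[OF g(2)] by simp
qed

text \<open>All cross distances are \<open>r\<close>, so homogeneity gives one isometry
  \<open>k\<close> for which \<open>k g\<close> agrees with \<open>g'\<close> and \<open>k h\<close>
  with \<open>h'\<close> on \<open>A\<close>. Each of these two replacements costs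
  \<open>\<epsilon>\<close>.\<close>

lemma act_same_type:
  assumes A: "finite A" "A \<subseteq> M" "\<And>v. v \<in> pointwise_stabiliser Iso A \<Longrightarrow> norm (act v \<xi> - \<xi>) \<le> \<epsilon>"
    and g: "g \<in> carrier Iso" "h \<in> carrier Iso" "\<And>a b. a \<in> A \<Longrightarrow> b \<in> A \<Longrightarrow> d (g a) (h b) = r"
    and g': "g' \<in> carrier Iso" "h' \<in> carrier Iso" "\<And>a b. a \<in> A \<Longrightarrow> b \<in> A \<Longrightarrow> d (g' a) (h' b) = r"
  shows "norm (act g \<xi> - act h \<xi>) \<le> norm (act g' \<xi> - act h' \<xi>) + 2 * \<epsilon>"
proof -
  let ?x = "\<lambda>(i, a). if i then g a else h a" and ?y = "\<lambda>(i, a). if i then g' a else h' a"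
  have AM: "a \<in> M" if "a \<in> A" for a using A(2) that by blast
  obtain k where k: "k \<in> carrier Iso" "\<And>j. j \<in> (UNIV :: bool set) \<times> A \<Longrightarrow> k (?x j) = ?y j"
  proof (rule homogeneous[of "UNIV \<times> A" ?x ?y])
    show "finite ((UNIV :: bool set) \<times> A)" using A(1) by simp
    show "?x ` (UNIV \<times> A) \<subseteq> M" "?y ` (UNIV \<times> A) \<subseteq> M"
      using Iso_closed[OF g(1) AM] Iso_closed[OF g(2) AM] Iso_closed[OF g'(1) AM] Iso_closed[OF g'(2) AM]
      by auto
    fix i j assume ij: "i \<in> (UNIV :: bool set) \<times> A" "j \<in> (UNIV :: bool set) \<times> A"
    obtain u a v b where i: "i = (u, a)" "j = (v, b)" by (cases i, cases j) auto
    then have ab: "a \<in> A" "b \<in> A" using ij by auto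
    have "d (h a) (g b) = r" "d (h' a) (g' b) = r"
      using g(3)[OF ab(2,1)] g'(3)[OF ab(2,1)] by (simp_all add: commute)
    then show "d (?x i) (?x j) = d (?y i) (?y j)"
      using g(1,2) g'(1,2) g(3)[OF ab] g'(3)[OF ab] AM[OF ab(1)] AM[OF ab(2)]
      by (cases u; cases v) (simp_all add: i Iso_dist)
  qed auto
  have kg: "k (g a) = g' a" "k (h a) = h' a" if "a \<in> A" for a
    using k(2)[of "(True, a)"] k(2)[of "(False, a)"] that by auto
  have "norm (act (k \<otimes>\<^bsub>Iso\<^esub> g) \<xi> - act g' \<xi>) \<le> \<epsilon>"
    by (rule act_eq_on[OF A(2,3)]) (use k(1) g g' AM kg in \<open>simp_all add: Iso_mult_apply\<close>)
  moreover have "norm (act (k \<otimes>\<^bsub>Iso\<^esub> h) \<xi> - act h' \<xi>) \<le> \<epsilon>"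
    by (rule act_eq_on[OF A(2,3)]) (use k(1) g g' AM kg in \<open>simp_all add: Iso_mult_apply\<close>)
  moreover have "norm (act g \<xi> - act h \<xi>) = norm (act (k \<otimes>\<^bsub>Iso\<^esub> g) \<xi> - act (k \<otimes>\<^bsub>Iso\<^esub> h) \<xi>)"
    using k(1) g(1,2) by (simp add: act_mult act_isometric)
  ultimately show ?thesis
    using norm_triangle_ineq[of "act (k \<otimes>\<^bsub>Iso\<^esub> g) \<xi> - act g' \<xi>" "act g' \<xi> - act (k \<otimes>\<^bsub>Iso\<^esub> h) \<xi>"]
      norm_triangle_ineq[of "act g' \<xi> - act h' \<xi>" "act h' \<xi> - act (k \<otimes>\<^bsub>Iso\<^esub> h) \<xi>"]
    by (simp add: norm_minus_commute)
qed

lemma orbit_bounded: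
  assumes "interlacing_bound TYPE('e)"
  obtains R where "\<And>g. g \<in> carrier Iso \<Longrightarrow> norm (act g 0) \<le> R"
proof -
  obtain A where A: "finite A" "A \<subseteq> M" "\<And>v. v \<in> pointwise_stabiliser Iso A \<Longrightarrow> norm (act v 0 - 0) \<le> 1"
    using act_continuous[of 1 0] by auto
  obtain D :: nat where D: "1 \<le> D" "\<And>a b. a \<in> A \<Longrightarrow> b \<in> A \<Longrightarrow> d a b \<le> real D"
    using finite_diameter[OF A(1)] by blast
  have "\<exists>h\<in>carrier Iso. \<forall>a\<in>A. \<forall>b\<in>A. d (h a) b = real (k * D)" if "1 \<le> k" for k
  proof -
    have "D \<le> 2 * (k * D)" using that by (metis mult_le_mono1 mult_1 trans_le_add1 mult_2)
    then have "real D \<le> 2 * real (k * D)" by linarith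
    then have "d a b \<le> 2 * real (k * D)" if "a \<in> A" "b \<in> A" for a b
      using D(2)[OF that] by linarith
    then show ?thesis using far_copy[OF A(1,2), of "real (k * D)"] that D(1) by (metis Rats_of_nat mult_pos_pos of_nat_0_less_iff zero_less_one order_less_le_trans)
  qed
  then obtain h where h: "\<And>k. 1 \<le> k \<Longrightarrow> h k \<in> carrier Iso"
      "\<And>k a b. 1 \<le> k \<Longrightarrow> a \<in> A \<Longrightarrow> b \<in> A \<Longrightarrow> d (h k a) b = real (k * D)"
    by metis
  have near: "norm (act g 0 - act g' 0) \<le> norm (act (h k) 0) + 2"
    if "g \<in> carrier Iso" "g' \<in> carrier Iso" "1 \<le> k"
      "\<And>a b. a \<in> A \<Longrightarrow> b \<in> A \<Longrightarrow> d (g a) (g' b) = real (k * D)" for g g' k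
  proof -
    have "norm (act g 0 - act g' 0) \<le> norm (act (h k) 0 - act \<one>\<^bsub>Iso\<^esub> 0) + 2 * 1"
      by (rule act_same_type[OF A that(1,2,4)])
         (use h that(3) A(2) in \<open>auto simp: Iso_one_apply subset_iff\<close>)
    then show ?thesis by (simp add: act_one)
  qed
  \<comment> \<open>By \<open>near\<close> this bounds the displacement between copies at distance
    \<open>D\<close>, hence between copies for interlaced tuples. It does not depend on
    \<open>k\<close>.\<close>
  define C where "C = norm (act (h 1) 0) + 2"
  have key: "norm (act g 0 - act g' 0) \<le> 2 * C + 3"
    if g: "g \<in> carrier Iso" "g' \<in> carrier Iso"
      "\<And>a b. a \<in> A \<Longrightarrow> b \<in> A \<Longrightarrow> d (g a) (g' b) = real (k * D)" and k: "1 \<le> k" for g g' k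
  proof -
    have pos: "0 < real D" using D(1) by simp
    have bound: "d a b \<le> 2 * real D" if "a \<in> A" "b \<in> A" for a b
      using D(2)[OF that] by linarith
    have "\<exists>s :: nat list \<Rightarrow> 'a \<Rightarrow> 'a. (\<forall>p. s p \<in> carrier Iso) \<and> (\<forall>p q. \<forall>a\<in>A. \<forall>b\<in>A. p \<noteq> q \<longrightarrow>
        d (s p a) (s q b) = real D * real (tuple_dist p q))"
      by (rule spread_copies[OF A(1,2) Rats_of_nat pos bound tuple_dist_commute tuple_dist_pos
            tuple_dist_triangle])
    then obtain s :: "nat list \<Rightarrow> 'a \<Rightarrow> 'a" where s1: "\<forall>p. s p \<in> carrier Iso"
      and s2: "\<forall>p q. \<forall>a\<in>A. \<forall>b\<in>A. p \<noteq> q \<longrightarrow> d (s p a) (s q b) = real D * real (tuple_dist p q)"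
      by (elim exE conjE)
    have s: "s p \<in> carrier Iso"
      "\<And>a b. p \<noteq> q \<Longrightarrow> a \<in> A \<Longrightarrow> b \<in> A \<Longrightarrow> d (s p a) (s q b) = real D * real (tuple_dist p q)" for p q
      using s1 s2 by blast+
    have s_near: "norm (act (s p) 0 - act (s q) 0) \<le> norm (act (h (tuple_dist p q)) 0) + 2" if "p \<noteq> q" for p q
      using s that tuple_dist_pos[OF that] by (intro near) (auto simp: mult.commute)
    \<comment> \<open>The value \<open>0\<close> off length \<open>k\<close> keeps \<open>f\<close>
      bounded on all lists, as \<open>interlacing_boundD\<close> demands; the bound
      \<open>tuple_dist_le\<close> concerns tuples of one length.\<close>
    define f where "f p = (if length p = k then act (s p) 0 else 0)" for p
    define p0 where "p0 = replicate k (0 :: nat)"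
    \<comment> \<open>Every tuple of length \<open>k\<close> has \<open>tuple_dist\<close> at most
      \<open>k\<close> from \<open>p0\<close>, so one of finitely many summands controls its
      displacement; the \<open>2\<close> is the loss in \<open>near\<close>.\<close>
    define R where "R = norm (act (s p0) 0) + (\<Sum>j\<le>k. norm (act (h j) 0)) + 2"
    have "norm (f p) \<le> R" for p
    proof (cases "length p = k \<and> p \<noteq> p0")
      case True
      then have "tuple_dist p p0 \<le> k" using k by (intro tuple_dist_le) (auto simp: p0_def)
      then have "norm (act (h (tuple_dist p p0)) 0) \<le> (\<Sum>j\<le>k. norm (act (h j) 0))"
        by (intro member_le_sum) auto
      moreover have "norm (act (s p) 0) \<le> norm (act (s p0) 0) + norm (act (s p) 0 - act (s p0) 0)"
        by (rule norm_triangle_sub)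
      ultimately show ?thesis using s_near[of p p0] True by (simp add: f_def R_def)
    next
      case False
      then show ?thesis by (auto simp: f_def R_def sum_nonneg)
    qed
    then have "\<exists>p q. length p = k \<and> length q = k \<and> (\<forall>n\<in>set p. \<forall>m\<in>set q. n < m) \<and>
        norm (f p - f q) \<le> 2 * C + 1"
    proof (rule interlacing_boundD[OF assms])
      fix p q assume "length p = k" "length q = k" "interlaced 0 p q"
      then have "tuple_dist p q = 1" using k by (intro tuple_dist_interlaced) auto
      moreover from this have "p \<noteq> q" by (auto simp: tuple_dist_def)
      ultimately show "norm (f p - f q) \<le> C"
        using s_near[of p q] \<open>length p = k\<close> \<open>length q = k\<close> by (simp add: f_def C_def)
    qed
    then obtain p q where pq: "length p = k" "length q = k" "\<forall>n\<in>set p. \<forall>m\<in>set q. n < m"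
        "norm (f p - f q) \<le> 2 * C + 1"
      by blast
    have "tuple_dist p q = k" using pq(1-3) k by (intro tuple_dist_separated)
    moreover from this have "p \<noteq> q" using k by (auto simp: tuple_dist_def)
    ultimately have "d (s p a) (s q b) = real (k * D)" if "a \<in> A" "b \<in> A" for a b
      using s(2)[OF _ that] by (simp add: mult.commute)
    \<comment> \<open>The copies for the separated tuples \<open>p\<close>, \<open>q\<close> have
      the same mutual distances as those of \<open>g\<close>, \<open>g'\<close>. The comparison
      costs \<open>2\<close>, which turns \<open>2 * C + 1\<close> into
      \<open>2 * C + 3\<close>.\<close>
    then have "norm (act g 0 - act g' 0) \<le> norm (act (s p) 0 - act (s q) 0) + 2 * 1"
      using g s(1) by (intro act_same_type[OF A]) auto
    then show ?thesis using pq by (simp add: f_def)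
  qed
  have "norm (act g 0) \<le> 4 * C + 6" if g: "g \<in> carrier Iso" for g
  proof -
    \<comment> \<open>A third copy at distance \<open>k * D\<close> from both \<open>A\<close> and
      its image under \<open>g\<close> links the identity to \<open>g\<close> in two steps of at
      most \<open>2 * C + 3\<close>.\<close>
    let ?Q = "A \<union> g ` A"
    have Q: "finite ?Q" "?Q \<subseteq> M" using A Iso_closed[OF g] by auto
    obtain k :: nat where k: "1 \<le> k" "\<And>a b. a \<in> ?Q \<Longrightarrow> b \<in> ?Q \<Longrightarrow> d a b \<le> real k"
      using finite_diameter[OF Q(1)] by blast
    have "k \<le> 2 * (k * D)" using D(1) by (metis mult_le_mono2 mult_1_right trans_le_add1 mult_2)
    then have "real k \<le> 2 * real (k * D)" by linarith
    then have bound: "d a b \<le> 2 * real (k * D)" if "a \<in> ?Q" "b \<in> ?Q" for a b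
      using k(2)[OF that] by linarith
    have pos: "0 < real (k * D)" using k(1) D(1) by simp
    obtain g' where g': "g' \<in> carrier Iso" "\<And>a b. a \<in> ?Q \<Longrightarrow> b \<in> ?Q \<Longrightarrow> d (g' a) b = real (k * D)"
      using far_copy[OF Q Rats_of_nat pos bound] by blast
    have "norm (act g' 0 - act g 0) \<le> 2 * C + 3"
      using g' g by (intro key[OF _ _ _ k(1)]) auto
    moreover have "norm (act g' 0 - act \<one>\<^bsub>Iso\<^esub> 0) \<le> 2 * C + 3"
      using g' A(2) by (intro key[OF _ _ _ k(1)]) (auto simp: Iso_one_apply subset_iff)
    ultimately show ?thesis
      using norm_triangle_ineq4[of "act g' 0" "act g' 0 - act g 0"] by (simp add: act_one)
  qed
  then show thesis by (rule that)
qed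

lemma fixed_point:
  assumes "interlacing_bound TYPE('e)" "asymptotic_centres TYPE('e)"
  shows "has_fixed_point Iso act"
proof -
  obtain R where R: "\<And>g. g \<in> carrier Iso \<Longrightarrow> norm (act g 0) \<le> R"
    using orbit_bounded[OF assms(1)] by blast
  have "countable M" using urysohn by (simp add: rational_Urysohn_def)
  have "\<exists>A. finite A \<and> A \<subseteq> M \<and> (\<forall>v\<in>pointwise_stabiliser Iso A. norm (act v 0 - 0) \<le> 1 / Suc n)" for n
    by (rule act_continuous) simp
  then obtain A where A: "\<And>n. finite (A n)" "\<And>n. A n \<subseteq> M"
      "\<And>n v. v \<in> pointwise_stabiliser Iso (A n) \<Longrightarrow> norm (act v 0 - 0) \<le> 1 / Suc n"
    by metis
  \<comment> \<open>Finite sets exhausting \<open>M\<close>; below, the image of \<open>A n\<close>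
    under \<open>\<gamma> n\<close> has constant distance \<open>r n\<close> from
    \<open>Q n\<close>.\<close>
  define Q where "Q n = {x \<in> M. to_nat_on M x \<le> n}" for n
  have Q_fin: "finite (Q n)" for n
  proof (rule inj_on_finite[of "to_nat_on M" _ "{..n}"])
    show "inj_on (to_nat_on M) (Q n)"
      using inj_on_to_nat_on[OF \<open>countable M\<close>] by (rule inj_on_subset) (auto simp: Q_def)
  qed (auto simp: Q_def)
  have "\<exists>g\<in>carrier Iso. \<exists>r. \<forall>a\<in>A n. \<forall>q\<in>Q n. d (g a) q = r" for n
  proof -
    have fin: "finite (A n \<union> Q n)" "A n \<union> Q n \<subseteq> M" using A Q_fin by (auto simp: Q_def)
    obtain r :: nat where r: "1 \<le> r" "\<And>a b. a \<in> A n \<union> Q n \<Longrightarrow> b \<in> A n \<union> Q n \<Longrightarrow> d a b \<le> real r"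
      using finite_diameter[OF fin(1)] by blast
    have bound: "d a b \<le> 2 * real r" if "a \<in> A n \<union> Q n" "b \<in> A n \<union> Q n" for a b
      using r(2)[OF that] by linarith
    have "0 < real r" using r(1) by simp
    then obtain g where "g \<in> carrier Iso"
        "\<And>a b. a \<in> A n \<union> Q n \<Longrightarrow> b \<in> A n \<union> Q n \<Longrightarrow> d (g a) b = real r"
      using far_copy[OF fin Rats_of_nat _ bound] by blast
    then show ?thesis by blast
  qed
  then obtain \<gamma> r where \<gamma>: "\<And>n. \<gamma> n \<in> carrier Iso"
      "\<And>n a q. a \<in> A n \<Longrightarrow> q \<in> Q n \<Longrightarrow> d (\<gamma> n a) q = r n"
    by metis
  define \<xi> where "\<xi> n = act (\<gamma> n) 0" for n
  have "bounded (range \<xi>)" using R \<gamma>(1) by (auto simp: bounded_iff \<xi>_def)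
  then obtain \<zeta> x where \<zeta>: "\<And>n. \<zeta> n \<in> convex hull (\<xi> ` {n..})"
    and x: "\<And>\<eta>. (\<lambda>n. norm (\<eta> - \<zeta> n) - norm (x - \<zeta> n)) \<longlonglongrightarrow> norm (\<eta> - x)"
    using assms(2) unfolding asymptotic_centres_def by metis
  have "act g x = x" if g: "g \<in> carrier Iso" for g
  proof -
    have "norm (act g x - x) \<le> e" if e: "e > 0" for e
    proof -
      obtain B where B: "finite B" "B \<subseteq> M"
          "\<And>v. v \<in> pointwise_stabiliser Iso B \<Longrightarrow> norm (act v x - x) \<le> e / 2"
        using act_continuous[of "e / 2" x] e by auto
      define N where "N = Max (insert 0 (to_nat_on M ` (B \<union> g ` B)))"
      have BQ: "b \<in> Q n" "g b \<in> Q n" if "b \<in> B" "N \<le> n" for b n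
      proof -
        have "to_nat_on M b \<le> N" "to_nat_on M (g b) \<le> N"
          unfolding N_def using B(1) that(1) by (auto intro!: Max_ge)
        then show "b \<in> Q n" "g b \<in> Q n"
          using that B(2) Iso_closed[OF g] by (auto simp: Q_def)
      qed
      have "eventually (\<lambda>n. inverse (real (Suc n)) < e / 2) sequentially"
        by (rule order_tendstoD(2)[OF LIMSEQ_inverse_real_of_nat]) (use e in simp)
      then obtain N' where N': "\<And>n. n \<ge> N' \<Longrightarrow> 1 / real (Suc n) \<le> e / 2"
        by (auto simp: eventually_sequentially inverse_eq_divide intro: less_imp_le)
      have close: "norm (act g x - \<zeta> n) - norm (x - \<zeta> n) \<le> e" if n: "n \<ge> max N N'" for n
      proof -
        \<comment> \<open>A convex combination involves finitely many \<open>\<xi> i\<close>, so the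
          partial isometry to be extended is finite.\<close>
        obtain S where S: "finite S" "S \<subseteq> {n..}" "\<zeta> n \<in> convex hull (\<xi> ` S)"
        proof -
          obtain S' where "finite S'" "S' \<subseteq> \<xi> ` {n..}" "\<zeta> n \<in> convex hull S'"
            using \<zeta>[of n] unfolding convex_hull_explicit
            by (auto simp: convex_hull_finite)
          then show thesis using that finite_subset_image[of S' \<xi> "{n..}"] by blast
        qed
        let ?J = "Inl ` B \<union> Inr ` (SIGMA i:S. A i)"
        let ?y = "case_sum (\<lambda>b. b) (\<lambda>(i, a). \<gamma> i a)" and ?z = "case_sum g (\<lambda>(i, a). \<gamma> i a)"
        \<comment> \<open>As \<open>i \<ge> N\<close>, both \<open>b\<close> and \<open>g b\<close>
          lie in \<open>Q i\<close>, equidistant from the copy of \<open>A i\<close>. Hence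
          \<open>g\<close> on \<open>B\<close> together with the identity on these copies preserves
          distances and extends to an isometry \<open>h\<close>.\<close>
        have cross: "d b (\<gamma> i a) = d (g b) (\<gamma> i a)" if "b \<in> B" "i \<in> S" "a \<in> A i" for b i a
        proof -
          have "N \<le> i" using S(2) that(2) n by auto
          then have "d (\<gamma> i a) b = r i" "d (\<gamma> i a) (g b) = r i"
            using \<gamma>(2)[OF that(3)] BQ[OF that(1)] by auto
          then show ?thesis by (simp add: commute)
        qed
        obtain h where h: "h \<in> carrier Iso" "\<And>j. j \<in> ?J \<Longrightarrow> h (?y j) = ?z j"
        proof (rule homogeneous[of ?J ?y ?z])
          show "finite ?J" using B(1) S(1) A(1) by auto
          show "?y ` ?J \<subseteq> M" "?z ` ?J \<subseteq> M"
            using B(2) Iso_closed[OF \<gamma>(1) subsetD[OF A(2)]] Iso_closed[OF g subsetD[OF B(2)]] by auto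
          fix u v assume "u \<in> ?J" "v \<in> ?J"
          then consider
              (BB) b c where "u = Inl b" "v = Inl c" "b \<in> B" "c \<in> B"
            | (BA) b i a where "u = Inl b" "v = Inr (i, a)" "b \<in> B" "i \<in> S" "a \<in> A i"
            | (AB) b i a where "v = Inl b" "u = Inr (i, a)" "b \<in> B" "i \<in> S" "a \<in> A i"
            | (AA) i a j c where "u = Inr (i, a)" "v = Inr (j, c)"
            by blast
          then show "d (?y u) (?y v) = d (?z u) (?z v)"
          proof cases
            case BB
            then show ?thesis using Iso_dist[OF g subsetD[OF B(2)] subsetD[OF B(2)], of b c] by simp
          next
            case BA
            then show ?thesis using cross[OF BA(3-5)] by simp
          next
            case AB
            then show ?thesis
              using cross[OF AB(3-5)] commute[of "\<gamma> i a" b] commute[of "\<gamma> i a" "g b"] by simp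
          next
            case AA
            then show ?thesis by simp
          qed
        qed auto
        have hB: "h b = g b" if "b \<in> B" for b using h(2)[of "Inl b"] that by simp
        have hA: "h (\<gamma> i a) = \<gamma> i a" if "i \<in> S" "a \<in> A i" for i a
          using h(2)[of "Inr (i, a)"] that by simp
        have hx: "norm (act h x - act g x) \<le> e / 2"
          by (rule act_eq_on[OF B(2,3) h(1) g hB])
        have h\<xi>: "norm (act h (\<xi> i) - \<xi> i) \<le> e / 2" if i: "i \<in> S" for i
        proof -
          have "norm (act (h \<otimes>\<^bsub>Iso\<^esub> \<gamma> i) 0 - act (\<gamma> i) 0) \<le> 1 / Suc i"
            using h(1) \<gamma>(1) A(2) hA[OF i]
            by (intro act_eq_on[OF A(2,3)]) (auto simp: Iso_mult_apply subset_iff)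
          also have "\<dots> \<le> e / 2" using S(2) i n by (intro N') auto
          finally show ?thesis using h(1) \<gamma>(1) by (simp add: act_mult \<xi>_def)
        qed
        \<comment> \<open>Affinity passes the bound on the displacement under \<open>h\<close> from
          the \<open>\<xi> i\<close> to their convex combination \<open>\<zeta> n\<close>.\<close>
        have "convex {\<eta>. norm (act h \<eta> - \<eta>) \<le> e / 2}"
        proof (rule convexI)
          fix u v and a b :: real
          assume uv: "u \<in> {\<eta>. norm (act h \<eta> - \<eta>) \<le> e / 2}" "v \<in> {\<eta>. norm (act h \<eta> - \<eta>) \<le> e / 2}"
            and ab: "0 \<le> a" "0 \<le> b" "a + b = 1"
          have "act h (a *\<^sub>R u + b *\<^sub>R v) - (a *\<^sub>R u + b *\<^sub>R v) = a *\<^sub>R (act h u - u) + b *\<^sub>R (act h v - v)"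
            by (simp add: act_affine[OF h(1) ab(3)] algebra_simps)
          also have "\<dots> \<in> cball 0 (e / 2)"
            using uv ab by (intro convexD[OF convex_cball]) auto
          finally show "a *\<^sub>R u + b *\<^sub>R v \<in> {\<eta>. norm (act h \<eta> - \<eta>) \<le> e / 2}" by simp
        qed
        then have "convex hull (\<xi> ` S) \<subseteq> {\<eta>. norm (act h \<eta> - \<eta>) \<le> e / 2}"
          using h\<xi> by (intro hull_minimal) auto
        then have h\<zeta>: "norm (act h (\<zeta> n) - \<zeta> n) \<le> e / 2" using S(3) by auto
        have "norm (act g x - \<zeta> n) \<le> norm (act g x - act h x) + norm (act h x - act h (\<zeta> n)) + norm (act h (\<zeta> n) - \<zeta> n)"
          using norm_triangle_ineq[of "act g x - act h x" "act h x - act h (\<zeta> n)"]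
            norm_triangle_ineq[of "act g x - act h (\<zeta> n)" "act h (\<zeta> n) - \<zeta> n"] by simp
        then show ?thesis
          using hx h\<zeta> act_isometric[OF h(1), of x "\<zeta> n"] by (simp add: norm_minus_commute)
      qed
      \<comment> \<open>By the choice of \<open>x\<close>, applied to the point
        \<open>act g x\<close>, the left side of \<open>close\<close> tends to
        \<open>norm (act g x - x)\<close>.\<close>
      show ?thesis by (rule LIMSEQ_le_const2[OF x]) (use close in blast)
    qed
    then have "norm (act g x - x) \<le> 0" by (metis field_le_epsilon add_0)
    then show ?thesis by simp
  qed
  then show ?thesis unfolding has_fixed_point_def by blast
qed

end

section \<open>From continuous affine isometric actions to the locale\<close>

lemma urysohn_affine_actionI:
  assumes "rational_Urysohn M d"
    and action: "continuous_affine_isometric_action (isometry_group M d)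
      (permutation_group_topology (isometry_group M d) M) \<alpha>"
  shows "urysohn_affine_action M d \<alpha>"
proof -
  interpret urysohn_space M d by unfold_locales fact
  let ?T = "permutation_group_topology Iso M"
  obtain \<pi> b where \<pi>: "isometric_linear_representation Iso \<pi>" "strongly_continuous ?T \<pi>"
    and b: "cocycle Iso \<pi> b" "continuous_map ?T euclidean b"
    and \<alpha>: "\<And>g \<xi>. g \<in> carrier Iso \<Longrightarrow> \<alpha> g \<xi> = \<pi> g \<xi> + b g"
    using action unfolding continuous_affine_isometric_action_def by blast
  have lin: "linear (\<pi> g)" "norm (\<pi> g \<xi>) = norm \<xi>" if "g \<in> carrier Iso" for g \<xi>
    using \<pi>(1) that by (auto simp: isometric_linear_representation_def)
  have \<pi>_one: "\<pi> \<one>\<^bsub>Iso\<^esub> \<xi> = \<xi>" for \<xi>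
    using \<pi>(1) by (simp add: isometric_linear_representation_def)
  have \<pi>_mult: "\<pi> (g \<otimes>\<^bsub>Iso\<^esub> h) \<xi> = \<pi> g (\<pi> h \<xi>)" if "g \<in> carrier Iso" "h \<in> carrier Iso" for g h \<xi>
    using \<pi>(1) that by (simp add: isometric_linear_representation_def)
  have b_mult: "b (g \<otimes>\<^bsub>Iso\<^esub> h) = \<pi> g (b h) + b g" if "g \<in> carrier Iso" "h \<in> carrier Iso" for g h
    using b(1) that by (simp add: cocycle_def)
  have b_one: "b \<one>\<^bsub>Iso\<^esub> = 0"
    using b_mult[of "\<one>\<^bsub>Iso\<^esub>" "\<one>\<^bsub>Iso\<^esub>"] \<pi>_one by simp
  show ?thesis
  proof
    fix g h \<xi> assume "g \<in> carrier Iso" "h \<in> carrier Iso"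
    then show "\<alpha> (g \<otimes>\<^bsub>Iso\<^esub> h) \<xi> = \<alpha> g (\<alpha> h \<xi>)"
      by (simp add: \<alpha> \<pi>_mult b_mult linear_add[OF lin(1)])
  next
    show one: "\<alpha> \<one>\<^bsub>Iso\<^esub> \<xi> = \<xi>" for \<xi> by (simp add: \<alpha> \<pi>_one b_one)
  next
    fix g \<xi> \<eta> assume "g \<in> carrier Iso"
    then show "norm (\<alpha> g \<xi> - \<alpha> g \<eta>) = norm (\<xi> - \<eta>)"
      using lin(2)[of g "\<xi> - \<eta>"] by (simp add: \<alpha> linear_diff[OF lin(1)])
  next
    fix g \<xi> \<eta> and s t :: real assume g: "g \<in> carrier Iso" "s + t = 1"
    \<comment> \<open>As the coefficients add up to \<open>1\<close>, the translation part splits in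
      the same proportion.\<close>
    have "b g = s *\<^sub>R b g + t *\<^sub>R b g" using g(2) by (metis scaleR_add_left scaleR_one)
    then show "\<alpha> g (s *\<^sub>R \<xi> + t *\<^sub>R \<eta>) = s *\<^sub>R \<alpha> g \<xi> + t *\<^sub>R \<alpha> g \<eta>"
      using g(1) by (simp add: \<alpha> linear_add[OF lin(1)] linear_scale[OF lin(1)] algebra_simps)
  next
    fix \<epsilon> :: real and \<xi> assume \<epsilon>: "\<epsilon> > 0"
    \<comment> \<open>The preimage of a ball around \<open>\<xi>\<close> is open and contains the
      identity, hence contains the stabiliser of a finite set.\<close>
    let ?V = "{g \<in> topspace ?T. \<pi> g \<xi> + b g \<in> ball \<xi> \<epsilon>}"
    have "continuous_map ?T euclidean (\<lambda>g. \<pi> g \<xi> + b g)"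
      using \<pi>(2) b(2) by (intro continuous_map_add) (auto simp: strongly_continuous_def)
    then have "openin ?T ?V" by (rule openin_continuous_map_preimage) simp
    moreover have "\<one>\<^bsub>Iso\<^esub> \<in> ?V"
      using \<epsilon> by (simp add: topspace_permutation_group_topology[OF group_isometry_group] \<pi>_one b_one)
    ultimately obtain A where A: "finite A" "A \<subseteq> M" "\<one>\<^bsub>Iso\<^esub> <#\<^bsub>Iso\<^esub> pointwise_stabiliser Iso A \<subseteq> ?V"
      unfolding openin_permutation_group_topology by blast
    have "norm (\<alpha> v \<xi> - \<xi>) \<le> \<epsilon>" if v: "v \<in> pointwise_stabiliser Iso A" for v
    proof -
      have vG: "v \<in> carrier Iso" using v by (simp add: pointwise_stabiliser_def)
      then have "v \<in> \<one>\<^bsub>Iso\<^esub> <#\<^bsub>Iso\<^esub> pointwise_stabiliser Iso A"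
        using v by (force simp: l_coset_def)
      then have "\<pi> v \<xi> + b v \<in> ball \<xi> \<epsilon>" using A(3) by blast
      then show ?thesis using vG by (simp add: \<alpha> dist_norm norm_minus_commute)
    qed
    then show "\<exists>A. finite A \<and> A \<subseteq> M \<and> (\<forall>v\<in>pointwise_stabiliser Iso A. norm (\<alpha> v \<xi> - \<xi>) \<le> \<epsilon>)"
      using A(1,2) by blast
  qed
qed

theorem corollary12:
  fixes M :: "'a set" and d :: "'a \<Rightarrow> 'a \<Rightarrow> real"
  assumes "rational_Urysohn M d"
  shows "(reflexive_space TYPE('e::banach) \<longrightarrow>
           (\<forall>\<alpha> :: ('a \<Rightarrow> 'a) \<Rightarrow> 'e \<Rightarrow> 'e.
              continuous_affine_isometric_action (isometry_group M d)
                (permutation_group_topology (isometry_group M d) M) \<alpha> \<longrightarrow>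
              has_fixed_point (isometry_group M d) \<alpha>)) \<and>
         (\<forall>\<alpha> :: ('a \<Rightarrow> 'a) \<Rightarrow> L1_unit_interval \<Rightarrow> L1_unit_interval.
              continuous_affine_isometric_action (isometry_group M d)
                (permutation_group_topology (isometry_group M d) M) \<alpha> \<longrightarrow>
              has_fixed_point (isometry_group M d) \<alpha>)"
proof (intro conjI impI allI)
  fix \<alpha> :: "('a \<Rightarrow> 'a) \<Rightarrow> 'e \<Rightarrow> 'e"
  assume refl: "reflexive_space TYPE('e)" and "continuous_affine_isometric_action (isometry_group M d)
    (permutation_group_topology (isometry_group M d) M) \<alpha>"
  then interpret urysohn_affine_action M d \<alpha> by (intro urysohn_affine_actionI assms)
  show "has_fixed_point (isometry_group M d) \<alpha>"
    using refl by (intro fixed_point reflexive_interlacing_bound reflexive_asymptotic_centres)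
next
  fix \<alpha> :: "('a \<Rightarrow> 'a) \<Rightarrow> L1_unit_interval \<Rightarrow> L1_unit_interval"
  assume "continuous_affine_isometric_action (isometry_group M d)
    (permutation_group_topology (isometry_group M d) M) \<alpha>"
  then interpret urysohn_affine_action M d \<alpha> by (intro urysohn_affine_actionI assms)
  show "has_fixed_point (isometry_group M d) \<alpha>"
    by (intro fixed_point L1_interlacing_bound L1_asymptotic_centres)
qed

end
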